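(* Let $(M,L)$ be a Finsler manifold of dimension $n\ge3$ with non-zero horizontal Ricci tensor. If $(M,L)$ is Ricci recurrent and m-projectively recurrent with the same recurrence form, then $(M,L)$ is recurrent.
   Context: Setting. $(M,L)$ is a smooth Finsler manifold of dimension $n$ (with positive definite Finsler metric), $\mathcal{T}M$ is the bundle of nonzero tangent vectors, $\pi:\mathcal{T}M\to M$, and $\pi^{-1}(TM)\to\mathcal{T}M$ is the pullback bundle, whose sections $\overline X$ are called $\pi$-vector fields (1-forms on this bundle are $\pi$-forms). $g$ is the Finsler metric on $\pi^{-1}(TM)$ defined by $L$ (in coordinates $g_{ij}=\frac12\partial^2L^2/\partial y^i\partial y^j$). $\overline\eta(u)=(u,u)$ is the fundamental $\pi$-vector field. $\rho:T(\mathcal{T}M)\to\pi^{-1}(TM)$ is the morphism induced by $d\pi$ and $\gamma:\pi^{-1}(TM)\to T(\mathcal{T}M)$ is the vertical lift. A linear connection $D$ on $\pi^{-1}(TM)$ is regular if $T_u(\mathcal{T}M)=V_u\oplus H_u$ for all $u$, where $V_u=\ker d\pi$ and $H_u=\{X: D_X\overline\eta=0\}$; then $\beta:=(\rho|_{H})^{-1}$ is its horizontal map. The Cartan connection $\nabla$ is the unique regular connection with $\nabla g=0$, $Q(\overline X,\overline Y):=\mathbf T(\beta\overline X,\beta\overline Y)=0$, and $T(\overline X,\overline Y):=\mathbf T(\gamma\overline X,\beta\overline Y)$ satisfying $g(T(\overline X,\overline Y),\overline Z)=g(T(\overline X,\overline Z),\overline Y)$, where $\mathbf T(X,Y)=\nabla_X\rho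 Y-\nabla_Y\rho X-\rho[X,Y]$. Curvature. $\mathbf K(X,Y)\overline Z=-\nabla_X\nabla_Y\overline Z+\nabla_Y\nabla_X\overline Z+\nabla_{[X,Y]}\overline Z$; $R(\overline X,\overline Y)\overline Z=\mathbf K(\beta\overline X,\beta\overline Y)\overline Z$. The horizontal Ricci tensor is $\mathrm{Ric}(\overline X,\overline Y)=\mathrm{trace}\{\overline Z\mapsto R(\overline X,\overline Z)\overline Y\}$; $\mathrm{Ric}_o$ is the $(1,1)$ tensor with $g(\mathrm{Ric}_o\overline X,\overline Y)=\mathrm{Ric}(\overline X,\overline Y)$. The m-projective curvature tensor is $\mathbb H(\overline X,\overline Y)\overline Z=R(\overline X,\overline Y)\overline Z-\frac{1}{2(n-1)}\{\mathrm{Ric}(\overline X,\overline Z)\overline Y-\mathrm{Ric}(\overline Y,\overline Z)\overline X+g(\overline X,\overline Z)\mathrm{Ric}_o\overline Y-g(\overline Y,\overline Z)\mathrm{Ric}_o\overline X\}$. Recurrence. The $h$-covariant derivative of a $\pi$-tensor field $B$ is $(\stackrel{h}{\nabla}B)(\overline W,\dots)=(\nabla_{\beta\overline W}B)(\dots)$. $(M,L)$ is recurrent (resp. Ricci recurrent, m-projectively recurrent) if there is a non-zero $\pi$-form $A$, called the recurrence form, such that $\stackrel{h}{\nabla}R=A\otimes R$ with $R$ non-zero (resp. $\stackrel{h}{\nabla}\mathrm{Ric}=A\otimes\mathrm{Ric}$ with $\mathrm{Ric}$ non-zero, $\stackrel{h}{\nabla}\mathbb H=A\otimes\mathbb H$).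 *)

theory Defs
  imports "HOL-Analysis.Analysis" "HOL-Library.Function_Algebras"
begin

subsection \<open>Real-valued functions as a real vector space\<close>

instantiation "fun" :: (type, scaleR) scaleR
begin
definition scaleR_fun_def: "scaleR c f = (\<lambda>x. c *\<^sub>R f x)"
instance ..
end

instance "fun" :: (type, real_vector) real_vector
  by standard (simp_all add: scaleR_fun_def fun_eq_iff algebra_simps)

subsection \<open>Smooth manifolds\<close>

primrec Ck_on :: "nat \<Rightarrow> 'a::real_normed_vector set \<Rightarrow> ('a \<Rightarrow> 'b::real_normed_vector) \<Rightarrow> bool" where
  "Ck_on 0 S f \<longleftrightarrow> continuous_on S f"
| "Ck_on (Suc k) S f \<longleftrightarrow>
     (\<forall>x\<in>S. f differentiable (at x)) \<and> (\<forall>v. Ck_on k S (\<lambda>x. frechet_derivative f (at x) v))"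

text \<open>Only used for open \<open>S\<close> in Euclidean spaces.\<close>
definition smooth_on :: "'a::real_normed_vector set \<Rightarrow> ('a \<Rightarrow> 'b::real_normed_vector) \<Rightarrow> bool" where
  "smooth_on S f \<longleftrightarrow> (\<forall>k. Ck_on k S f)"

text \<open>A manifold modelled on the Euclidean space \<open>'e\<close> (so of dimension \<open>DIM('e)\<close>) is given by an
  atlas, a set of pairs (domain, chart map). The point set is the union of the chart domains, and the
  topology is the one making the charts homeomorphisms onto open sets.\<close>

type_synonym ('a, 'e) atlas = "('a set \<times> ('a \<Rightarrow> 'e)) set"

definition points :: "('a, 'e) atlas \<Rightarrow> 'a set" where
  "points A = (\<Union>(U, \<phi>)\<in>A. U)"

definition manifold_topology :: "('a, 'e::euclidean_space) atlas \<Rightarrow> 'a topology" where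
  "manifold_topology A =
     topology (\<lambda>W. W \<subseteq> points A \<and> (\<forall>(U, \<phi>)\<in>A. open (\<phi> ` (U \<inter> W))))"

definition smooth_manifold :: "('a, 'e::euclidean_space) atlas \<Rightarrow> bool" where
  "smooth_manifold A \<longleftrightarrow>
     (\<forall>(U, \<phi>)\<in>A. inj_on \<phi> U \<and> open (\<phi> ` U)) \<and>
     (\<forall>(U, \<phi>)\<in>A. \<forall>(V, \<psi>)\<in>A.
        open (\<phi> ` (U \<inter> V)) \<and> smooth_on (\<phi> ` (U \<inter> V)) (\<psi> \<circ> inv_into U \<phi>)) \<and>
     Hausdorff_space (manifold_topology A) \<and> second_countable (manifold_topology A)"

text \<open>Smoothness of a real function on some neighbourhood of \<open>p\<close>.\<close>
definition smooth_at :: "('a, 'e::euclidean_space) atlas \<Rightarrow> 'a \<Rightarrow> ('a \<Rightarrow> real) \<Rightarrow> bool" where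
  "smooth_at A p f \<longleftrightarrow>
     (\<exists>(U, \<phi>)\<in>A. p \<in> U \<and>
        (\<exists>V. open V \<and> \<phi> p \<in> V \<and> V \<subseteq> \<phi> ` U \<and> smooth_on V (f \<circ> inv_into U \<phi>)))"

definition smooth_functions :: "('a, 'e::euclidean_space) atlas \<Rightarrow> ('a \<Rightarrow> real) set" where
  "smooth_functions A = {f. \<forall>p\<in>points A. smooth_at A p f}"

text \<open>Tangent vectors at \<open>p\<close> are the derivations at \<open>p\<close> of the algebra of functions that are smooth
  near \<open>p\<close>. They are set to 0 on all other functions, so that equality of tangent vectors is equality
  of functions. Locality (\<open>v f\<close> depends only on the germ of \<open>f\<close>) is a consequence of the Leibniz rule.\<close>

type_synonym 'a tangent = "('a \<Rightarrow> real) \<Rightarrow> real"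

definition tangent_space :: "('a, 'e::euclidean_space) atlas \<Rightarrow> 'a \<Rightarrow> 'a tangent set" where
  "tangent_space A p = {v.
     (\<forall>f g. smooth_at A p f \<longrightarrow> smooth_at A p g \<longrightarrow> v (\<lambda>q. f q + g q) = v f + v g) \<and>
     (\<forall>c f. smooth_at A p f \<longrightarrow> v (\<lambda>q. c * f q) = c * v f) \<and>
     (\<forall>f g. smooth_at A p f \<longrightarrow> smooth_at A p g \<longrightarrow>
        v (\<lambda>q. f q * g q) = f p * v g + g p * v f) \<and>
     (\<forall>f. \<not> smooth_at A p f \<longrightarrow> v f = 0)}"

definition differential ::
  "('a, 'd::euclidean_space) atlas \<Rightarrow> ('b, 'e::euclidean_space) atlas \<Rightarrow> ('a \<Rightarrow> 'b) \<Rightarrow>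
    'a \<Rightarrow> 'a tangent \<Rightarrow> 'b tangent" where
  "differential N M h p X = (\<lambda>f. if smooth_at M (h p) f then X (\<lambda>q. f (h q)) else 0)"

text \<open>Smooth vector fields along \<open>h : N \<rightarrow> M\<close>, that is, smooth sections of the pullback bundle
  \<open>h\<^sup>-\<^sup>1(TM)\<close> over \<open>N\<close>. Smoothness of \<open>X\<close> means that \<open>X f\<close> is smooth for every locally defined
  smooth \<open>f\<close>. Values of a section outside \<open>N\<close> are irrelevant.\<close>
definition fields_along ::
  "('a, 'd::euclidean_space) atlas \<Rightarrow> ('b, 'e::euclidean_space) atlas \<Rightarrow> ('a \<Rightarrow> 'b) \<Rightarrow>
    ('a \<Rightarrow> 'b tangent) set" where
  "fields_along N M h = {X. \<forall>p\<in>points N. X p \<in> tangent_space M (h p) \<and>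
     (\<forall>f. smooth_at M (h p) f \<longrightarrow> smooth_at N p (\<lambda>q. X q f))}"

definition vector_fields :: "('a, 'e::euclidean_space) atlas \<Rightarrow> ('a \<Rightarrow> 'a tangent) set" where
  "vector_fields N = fields_along N N (\<lambda>p. p)"

definition lie_bracket ::
  "('a, 'e::euclidean_space) atlas \<Rightarrow> ('a \<Rightarrow> 'a tangent) \<Rightarrow> ('a \<Rightarrow> 'a tangent) \<Rightarrow> 'a \<Rightarrow> 'a tangent" where
  "lie_bracket N X Y p =
     (\<lambda>f. if smooth_at N p f then X p (\<lambda>q. Y q f) - Y p (\<lambda>q. X q f) else 0)"

subsection \<open>The slit tangent bundle and its pullback bundle\<close>

type_synonym 'm tvec = "'m \<times> 'm tangent"

text \<open>The manifold of nonzero tangent vectors, with the charts \<open>(x\<^sup>i, y\<^sup>i)\<close> induced by the charts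
  \<open>(x\<^sup>i)\<close> of \<open>M\<close>, where \<open>y\<^sup>i\<close> is the value of the tangent vector on \<open>x\<^sup>i\<close>.\<close>
definition slit :: "('m, 'e::euclidean_space) atlas \<Rightarrow> ('m tvec, 'e \<times> 'e) atlas" where
  "slit M = (\<lambda>(U, \<phi>).
     ({(p, v). p \<in> U \<and> v \<in> tangent_space M p \<and> v \<noteq> 0},
      \<lambda>(p, v). (\<phi> p, \<Sum>b\<in>Basis. v (\<lambda>q. \<phi> q \<bullet> b) *\<^sub>R b))) ` M"

text \<open>Sections of the pullback bundle of \<open>TM\<close> over the slit tangent bundle.\<close>

type_synonym 'm pi_section = "'m tvec \<Rightarrow> 'm tangent"

definition pi_fields :: "('m, 'e::euclidean_space) atlas \<Rightarrow> 'm pi_section set" where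
  "pi_fields M = fields_along (slit M) M fst"

definition fundamental_field :: "'m pi_section" where
  "fundamental_field u = snd u"

definition rho :: "('m, 'e::euclidean_space) atlas \<Rightarrow> 'm tvec \<Rightarrow> 'm tvec tangent \<Rightarrow> 'm tangent" where
  "rho M u = differential (slit M) M fst u"

definition vertical_lift ::
  "('m, 'e::euclidean_space) atlas \<Rightarrow> 'm tvec \<Rightarrow> 'm tangent \<Rightarrow> 'm tvec tangent" where
  "vertical_lift M u v =
     (\<lambda>F. if smooth_at (slit M) u F then deriv (\<lambda>t. F (fst u, snd u + t *\<^sub>R v)) 0 else 0)"

subsection \<open>Finsler structures\<close>

text \<open>In a chart, the value on the coordinate fields \<open>\<partial>\<^sub>i\<close>, \<open>\<partial>\<^sub>j\<close> is
  \<open>g\<^sub>i\<^sub>j = 1/2 \<partial>\<^sup>2 L\<^sup>2 / \<partial>y\<^sup>i \<partial>y\<^sup>j\<close>.\<close>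
definition fmetric :: "('m tvec \<Rightarrow> real) \<Rightarrow> 'm tvec \<Rightarrow> 'm tangent \<Rightarrow> 'm tangent \<Rightarrow> real" where
  "fmetric L u v w =
     1/2 * deriv (\<lambda>s. deriv (\<lambda>t. (L (fst u, snd u + s *\<^sub>R v + t *\<^sub>R w))\<^sup>2) 0) 0"

text \<open>\<open>L\<close> is the Finsler function on \<open>TM\<close>; its continuity along the zero section follows from
  homogeneity and smoothness off the zero section.\<close>
definition finsler_manifold :: "('m, 'e::euclidean_space) atlas \<Rightarrow> ('m tvec \<Rightarrow> real) \<Rightarrow> bool" where
  "finsler_manifold M L \<longleftrightarrow>
     smooth_manifold M \<and>
     L \<in> smooth_functions (slit M) \<and>
     (\<forall>u\<in>points (slit M). L u > 0) \<and>
     (\<forall>p\<in>points M. \<forall>v\<in>tangent_space M p. \<forall>c\<ge>0. L (p, c *\<^sub>R v) = c * L (p, v)) \<and>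
     (\<forall>u\<in>points (slit M). \<forall>v\<in>tangent_space M (fst u). v \<noteq> 0 \<longrightarrow> fmetric L u v v > 0)"

subsection \<open>Linear connections on the pullback bundle\<close>

text \<open>\<open>D u X s\<close> is the covariant derivative at \<open>u\<close> of the \<pi>-vector field \<open>s\<close> in the direction of
  the tangent vector \<open>X\<close> to the slit tangent bundle at \<open>u\<close>.\<close>

type_synonym 'm connection = "'m tvec \<Rightarrow> 'm tvec tangent \<Rightarrow> 'm pi_section \<Rightarrow> 'm tangent"

definition cov :: "'m connection \<Rightarrow> ('m tvec \<Rightarrow> 'm tvec tangent) \<Rightarrow> 'm pi_section \<Rightarrow> 'm pi_section" where
  "cov D X s = (\<lambda>u. D u (X u) s)"

definition linear_connection :: "('m, 'e::euclidean_space) atlas \<Rightarrow> 'm connection \<Rightarrow> bool" where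
  "linear_connection M D \<longleftrightarrow>
     (\<forall>u\<in>points (slit M). \<forall>s\<in>pi_fields M.
        (\<forall>X\<in>tangent_space (slit M) u. \<forall>Y\<in>tangent_space (slit M) u.
            D u (X + Y) s = D u X s + D u Y s) \<and>
        (\<forall>X\<in>tangent_space (slit M) u. \<forall>c. D u (c *\<^sub>R X) s = c *\<^sub>R D u X s)) \<and>
     (\<forall>u\<in>points (slit M). \<forall>X\<in>tangent_space (slit M) u.
        (\<forall>s\<in>pi_fields M. \<forall>t\<in>pi_fields M. D u X (s + t) = D u X s + D u X t) \<and>
        (\<forall>f\<in>smooth_functions (slit M). \<forall>s\<in>pi_fields M.
            D u X (\<lambda>w. f w *\<^sub>R s w) = X f *\<^sub>R s u + f u *\<^sub>R D u X s)) \<and>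
     (\<forall>X\<in>vector_fields (slit M). \<forall>s\<in>pi_fields M. cov D X s \<in> pi_fields M)"

definition vertical_space :: "('m, 'e::euclidean_space) atlas \<Rightarrow> 'm tvec \<Rightarrow> 'm tvec tangent set" where
  "vertical_space M u = {X \<in> tangent_space (slit M) u. rho M u X = 0}"

definition horizontal_space ::
  "('m, 'e::euclidean_space) atlas \<Rightarrow> 'm connection \<Rightarrow> 'm tvec \<Rightarrow> 'm tvec tangent set" where
  "horizontal_space M D u = {X \<in> tangent_space (slit M) u. D u X fundamental_field = 0}"

definition regular_connection :: "('m, 'e::euclidean_space) atlas \<Rightarrow> 'm connection \<Rightarrow> bool" where
  "regular_connection M D \<longleftrightarrow> linear_connection M D \<and>
     (\<forall>u\<in>points (slit M).
        tangent_space (slit M) u =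
          {X + Y | X Y. X \<in> vertical_space M u \<and> Y \<in> horizontal_space M D u} \<and>
        vertical_space M u \<inter> horizontal_space M D u = {0})"

definition horizontal_map ::
  "('m, 'e::euclidean_space) atlas \<Rightarrow> 'm connection \<Rightarrow> 'm tvec \<Rightarrow> 'm tangent \<Rightarrow> 'm tvec tangent" where
  "horizontal_map M D u = inv_into (horizontal_space M D u) (rho M u)"

definition hlift ::
  "('m, 'e::euclidean_space) atlas \<Rightarrow> 'm connection \<Rightarrow> 'm pi_section \<Rightarrow> 'm tvec \<Rightarrow> 'm tvec tangent" where
  "hlift M D s = (\<lambda>u. horizontal_map M D u (s u))"

definition vlift :: "('m, 'e::euclidean_space) atlas \<Rightarrow> 'm pi_section \<Rightarrow> 'm tvec \<Rightarrow> 'm tvec tangent" where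
  "vlift M s = (\<lambda>u. vertical_lift M u (s u))"

definition torsion ::
  "('m, 'e::euclidean_space) atlas \<Rightarrow> 'm connection \<Rightarrow>
    ('m tvec \<Rightarrow> 'm tvec tangent) \<Rightarrow> ('m tvec \<Rightarrow> 'm tvec tangent) \<Rightarrow> 'm pi_section" where
  "torsion M D X Y = (\<lambda>u.
     cov D X (\<lambda>w. rho M w (Y w)) u - cov D Y (\<lambda>w. rho M w (X w)) u
       - rho M u (lie_bracket (slit M) X Y u))"

definition curvature ::
  "('m, 'e::euclidean_space) atlas \<Rightarrow> 'm connection \<Rightarrow>
    ('m tvec \<Rightarrow> 'm tvec tangent) \<Rightarrow> ('m tvec \<Rightarrow> 'm tvec tangent) \<Rightarrow> 'm pi_section \<Rightarrow> 'm pi_section" where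
  "curvature M D X Y Z =
     - cov D X (cov D Y Z) + cov D Y (cov D X Z) + cov D (lie_bracket (slit M) X Y) Z"

text \<open>\<pi>-tensor fields are represented by their action on \<pi>-vector fields.\<close>

definition metric :: "('m tvec \<Rightarrow> real) \<Rightarrow> 'm pi_section \<Rightarrow> 'm pi_section \<Rightarrow> 'm tvec \<Rightarrow> real" where
  "metric L X Y = (\<lambda>u. fmetric L u (X u) (Y u))"

definition cov_scalar2 ::
  "'m connection \<Rightarrow> ('m tvec \<Rightarrow> 'm tvec tangent) \<Rightarrow>
    ('m pi_section \<Rightarrow> 'm pi_section \<Rightarrow> 'm tvec \<Rightarrow> real) \<Rightarrow> 'm pi_section \<Rightarrow> 'm pi_section \<Rightarrow> 'm tvec \<Rightarrow> real" where
  "cov_scalar2 D X B Y Z = (\<lambda>u. X u (B Y Z) - B (cov D X Y) Z u - B Y (cov D X Z) u)"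

definition cov_vector3 ::
  "'m connection \<Rightarrow> ('m tvec \<Rightarrow> 'm tvec tangent) \<Rightarrow>
    ('m pi_section \<Rightarrow> 'm pi_section \<Rightarrow> 'm pi_section \<Rightarrow> 'm pi_section) \<Rightarrow>
    'm pi_section \<Rightarrow> 'm pi_section \<Rightarrow> 'm pi_section \<Rightarrow> 'm pi_section" where
  "cov_vector3 D X B Y1 Y2 Y3 =
     cov D X (B Y1 Y2 Y3) - B (cov D X Y1) Y2 Y3 - B Y1 (cov D X Y2) Y3 - B Y1 Y2 (cov D X Y3)"

definition cartan_connection ::
  "('m, 'e::euclidean_space) atlas \<Rightarrow> ('m tvec \<Rightarrow> real) \<Rightarrow> 'm connection \<Rightarrow> bool" where
  "cartan_connection M L D \<longleftrightarrow> regular_connection M D \<and>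
     (\<forall>X\<in>vector_fields (slit M). \<forall>Y\<in>pi_fields M. \<forall>Z\<in>pi_fields M. \<forall>u\<in>points (slit M).
        cov_scalar2 D X (metric L) Y Z u = 0) \<and>
     (\<forall>X\<in>pi_fields M. \<forall>Y\<in>pi_fields M. \<forall>u\<in>points (slit M).
        torsion M D (hlift M D X) (hlift M D Y) u = 0) \<and>
     (\<forall>X\<in>pi_fields M. \<forall>Y\<in>pi_fields M. \<forall>Z\<in>pi_fields M. \<forall>u\<in>points (slit M).
        metric L (torsion M D (vlift M X) (hlift M D Y)) Z u =
        metric L (torsion M D (vlift M X) (hlift M D Z)) Y u)"

subsection \<open>Horizontal curvature, Ricci and m-projective curvature tensors\<close>

definition hcurvature ::
  "('m, 'e::euclidean_space) atlas \<Rightarrow> 'm connection \<Rightarrow> 'm pi_section \<Rightarrow> 'm pi_section \<Rightarrow> 'm pi_section \<Rightarrow> 'm pi_section" where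
  "hcurvature M D X Y Z = curvature M D (hlift M D X) (hlift M D Y) Z"

text \<open>Trace of a linear endomorphism of a finite-dimensional subspace \<open>S\<close>, computed in any basis.\<close>
definition subspace_trace :: "'v::real_vector set \<Rightarrow> ('v \<Rightarrow> 'v) \<Rightarrow> real" where
  "subspace_trace S f =
     (let B = (SOME B. independent B \<and> span B = S) in \<Sum>b\<in>B. representation B (f b) b)"

text \<open>Trace of a \<open>C\<^sup>\<infinity>\<close>-linear endomorphism \<open>\<Phi>\<close> of the module of \<pi>-vector fields. By tensoriality
  \<open>\<Phi> Z u\<close> depends only on \<open>Z u\<close>, so that \<open>\<Phi>\<close> induces an endomorphism of the fibre over \<open>u\<close>; to
  apply \<open>\<Phi>\<close> to a vector of the fibre, the vector is extended to an arbitrary \<pi>-vector field.\<close>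
definition pi_trace ::
  "('m, 'e::euclidean_space) atlas \<Rightarrow> ('m pi_section \<Rightarrow> 'm pi_section) \<Rightarrow> 'm tvec \<Rightarrow> real" where
  "pi_trace M \<Phi> u = subspace_trace (tangent_space M (fst u))
     (\<lambda>v. \<Phi> (SOME Z. Z \<in> pi_fields M \<and> Z u = v) u)"

definition ric ::
  "('m, 'e::euclidean_space) atlas \<Rightarrow> 'm connection \<Rightarrow> 'm pi_section \<Rightarrow> 'm pi_section \<Rightarrow> 'm tvec \<Rightarrow> real" where
  "ric M D X Y = pi_trace M (\<lambda>Z. hcurvature M D X Z Y)"

definition ric_op ::
  "('m, 'e::euclidean_space) atlas \<Rightarrow> ('m tvec \<Rightarrow> real) \<Rightarrow> 'm connection \<Rightarrow> 'm pi_section \<Rightarrow> 'm pi_section" where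
  "ric_op M L D X = (\<lambda>u. THE v. v \<in> tangent_space M (fst u) \<and>
     (\<forall>Y\<in>pi_fields M. fmetric L u v (Y u) = ric M D X Y u))"

definition m_projective ::
  "('m, 'e::euclidean_space) atlas \<Rightarrow> ('m tvec \<Rightarrow> real) \<Rightarrow> 'm connection \<Rightarrow>
    'm pi_section \<Rightarrow> 'm pi_section \<Rightarrow> 'm pi_section \<Rightarrow> 'm pi_section" where
  "m_projective M L D X Y Z = (\<lambda>u. hcurvature M D X Y Z u
     - (1 / (2 * (real DIM('e) - 1))) *\<^sub>R
         (ric M D X Z u *\<^sub>R Y u - ric M D Y Z u *\<^sub>R X u
          + metric L X Z u *\<^sub>R ric_op M L D Y u - metric L Y Z u *\<^sub>R ric_op M L D X u))"

subsection \<open>Recurrence\<close>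

definition pi_forms :: "('m, 'e::euclidean_space) atlas \<Rightarrow> ('m pi_section \<Rightarrow> 'm tvec \<Rightarrow> real) set" where
  "pi_forms M = {\<alpha>.
     (\<forall>X\<in>pi_fields M. \<alpha> X \<in> smooth_functions (slit M)) \<and>
     (\<forall>X\<in>pi_fields M. \<forall>Y\<in>pi_fields M. \<forall>u\<in>points (slit M). \<alpha> (X + Y) u = \<alpha> X u + \<alpha> Y u) \<and>
     (\<forall>f\<in>smooth_functions (slit M). \<forall>X\<in>pi_fields M. \<forall>u\<in>points (slit M).
        \<alpha> (\<lambda>w. f w *\<^sub>R X w) u = f u * \<alpha> X u)}"

definition nonzero_pi_form ::
  "('m, 'e::euclidean_space) atlas \<Rightarrow> ('m pi_section \<Rightarrow> 'm tvec \<Rightarrow> real) \<Rightarrow> bool" where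
  "nonzero_pi_form M \<alpha> \<longleftrightarrow> \<alpha> \<in> pi_forms M \<and> (\<exists>X\<in>pi_fields M. \<exists>u\<in>points (slit M). \<alpha> X u \<noteq> 0)"

definition hcurvature_nonzero :: "('m, 'e::euclidean_space) atlas \<Rightarrow> 'm connection \<Rightarrow> bool" where
  "hcurvature_nonzero M D \<longleftrightarrow>
     (\<exists>X\<in>pi_fields M. \<exists>Y\<in>pi_fields M. \<exists>Z\<in>pi_fields M. \<exists>u\<in>points (slit M). hcurvature M D X Y Z u \<noteq> 0)"

definition ric_nonzero :: "('m, 'e::euclidean_space) atlas \<Rightarrow> 'm connection \<Rightarrow> bool" where
  "ric_nonzero M D \<longleftrightarrow>
     (\<exists>X\<in>pi_fields M. \<exists>Y\<in>pi_fields M. \<exists>u\<in>points (slit M). ric M D X Y u \<noteq> 0)"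

text \<open>In the following, \<open>D\<close> is the Cartan connection and \<open>\<alpha>\<close> the recurrence form.\<close>

definition recurrent_with ::
  "('m, 'e::euclidean_space) atlas \<Rightarrow> 'm connection \<Rightarrow> ('m pi_section \<Rightarrow> 'm tvec \<Rightarrow> real) \<Rightarrow> bool" where
  "recurrent_with M D \<alpha> \<longleftrightarrow> nonzero_pi_form M \<alpha> \<and> hcurvature_nonzero M D \<and>
     (\<forall>W\<in>pi_fields M. \<forall>X\<in>pi_fields M. \<forall>Y\<in>pi_fields M. \<forall>Z\<in>pi_fields M. \<forall>u\<in>points (slit M).
        cov_vector3 D (hlift M D W) (hcurvature M D) X Y Z u = \<alpha> W u *\<^sub>R hcurvature M D X Y Z u)"

definition recurrent :: "('m, 'e::euclidean_space) atlas \<Rightarrow> 'm connection \<Rightarrow> bool" where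
  "recurrent M D \<longleftrightarrow> (\<exists>\<alpha>. recurrent_with M D \<alpha>)"

definition ricci_recurrent_with ::
  "('m, 'e::euclidean_space) atlas \<Rightarrow> 'm connection \<Rightarrow> ('m pi_section \<Rightarrow> 'm tvec \<Rightarrow> real) \<Rightarrow> bool" where
  "ricci_recurrent_with M D \<alpha> \<longleftrightarrow> nonzero_pi_form M \<alpha> \<and> ric_nonzero M D \<and>
     (\<forall>W\<in>pi_fields M. \<forall>X\<in>pi_fields M. \<forall>Y\<in>pi_fields M. \<forall>u\<in>points (slit M).
        cov_scalar2 D (hlift M D W) (ric M D) X Y u = \<alpha> W u * ric M D X Y u)"

definition m_projectively_recurrent_with ::
  "('m, 'e::euclidean_space) atlas \<Rightarrow> ('m tvec \<Rightarrow> real) \<Rightarrow> 'm connection \<Rightarrow>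
    ('m pi_section \<Rightarrow> 'm tvec \<Rightarrow> real) \<Rightarrow> bool" where
  "m_projectively_recurrent_with M L D \<alpha> \<longleftrightarrow> nonzero_pi_form M \<alpha> \<and>
     (\<forall>W\<in>pi_fields M. \<forall>X\<in>pi_fields M. \<forall>Y\<in>pi_fields M. \<forall>Z\<in>pi_fields M. \<forall>u\<in>points (slit M).
        cov_vector3 D (hlift M D W) (m_projective M L D) X Y Z u =
        \<alpha> W u *\<^sub>R m_projective M L D X Y Z u)"

end

theory Submission
  imports Defs
begin

text \<open>
  Solved for the curvature, the definition of the m-projective tensor reads
  \<open>R = \<H> + c (P - P' + Q - Q')\<close> with \<open>P(X,Y)Z = Ric(X,Z) Y\<close> and
  \<open>Q(X,Y)Z = g(X,Z) Ric\<^sub>o Y\<close>, where the primes exchange \<open>X\<close> and \<open>Y\<close>. For a fixed horizontal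
  direction \<open>V\<close> the condition \<open>\<nabla>\<^sub>V B = a B\<close> is linear in the tensor \<open>B\<close>, so \<open>R\<close> satisfies it
  as soon as \<open>\<H>\<close>, \<open>P\<close> and \<open>Q\<close> do with the same \<open>a\<close>. For \<open>\<H>\<close> this is the hypothesis. For \<open>P\<close> it
  is the Leibniz rule and Ricci recurrence. For \<open>Q\<close> one also uses that the Cartan connection is
  metric: \<open>g\<close> is parallel, so lowering an index commutes with \<open>\<nabla>\<^sub>V\<close> and \<open>Ric\<^sub>o\<close> inherits the
  recurrence of \<open>Ric\<close>. Finally \<open>R\<close> is not zero, because \<open>Ric\<close> is a trace of it. This argument is in
  \<open>eigentensor_add_scale\<close>, \<open>ricci_block_eigentensor\<close>, \<open>ric_op_recurrent\<close>,
  \<open>metric_block_eigentensor\<close> and \<open>hcurvature_nonzero_if_ric_nonzero\<close>.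

  Most of the work is to make this computation legitimate. A connection obeys the sum and Leibniz
  rules on smooth sections only, so that horizontal lifts, \<open>R\<close>, \<open>Ric\<close>, \<open>g\<close> and \<open>Ric\<^sub>o\<close> have to be
  shown smooth before \<open>\<nabla>\<^sub>V\<close> can be distributed over the right-hand side, and the trace and the
  operator \<open>Ric\<^sub>o\<close> only make sense once \<open>R\<close> and \<open>Ric\<close> are known to be tensorial. Four tools carry
  these proofs.

  Tangent vectors are derivations. Hadamard's lemma identifies them with directional derivatives
  (\<open>tangent_eq_coord_vec\<close>), which gives the charts of the slit tangent bundle and their smooth
  transition maps \<open>(x, y) \<mapsto> (t x, Dt x y)\<close> (\<open>smooth_atlas_slit\<close>).

  Bump functions on the base (\<open>manifold_bump\<close>) turn local coordinate fields into global sections.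

  A map that is linear over the smooth functions is determined at a point by its values on
  such a frame (\<open>tensor_expansion\<close>).

  Objects that are characterised by equations, namely horizontal lifts and \<open>Ric\<^sub>o\<close>, are solutions of
  injective linear systems with smooth coefficients, and such solutions are smooth
  (\<open>smooth_at_linear_system\<close>).
\<close>

section \<open>Smooth functions on Euclidean spaces\<close>

subsection \<open>Functions with k continuous derivatives\<close>

lemma has_derivative_frechet:
  "f differentiable (at x) \<Longrightarrow> (f has_derivative frechet_derivative f (at x)) (at x)"
  by (simp add: frechet_derivative_works)

lemma linear_sum_Basis:
  fixes f :: "'a::euclidean_space \<Rightarrow> 'b::real_vector"
  assumes "linear f"
  shows "f v = (\<Sum>b\<in>Basis. (v \<bullet> b) *\<^sub>R f b)"
proof -
  have "f v = f (\<Sum>b\<in>Basis. (v \<bullet> b) *\<^sub>R b)"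
    by (simp add: euclidean_representation)
  then show ?thesis
    by (simp only: linear_sum[OF assms] linear_cmul[OF assms])
qed

lemma Ck_on_cong:
  assumes "open S" "\<And>x. x \<in> S \<Longrightarrow> f x = g x"
  shows "Ck_on k S f \<longleftrightarrow> Ck_on k S g"
  using assms(2)
proof (induction k arbitrary: f g)
  case 0
  then show ?case by (auto cong: continuous_on_cong)
next
  case (Suc k)
  have "(f has_derivative f') (at x) \<longleftrightarrow> (g has_derivative f') (at x)" if "x \<in> S" for x f'
    using has_derivative_transform_within_open[OF _ assms(1) that] Suc.prems by metis
  then have "f differentiable (at x) \<longleftrightarrow> g differentiable (at x)"
    and "frechet_derivative f (at x) = frechet_derivative g (at x)" if "x \<in> S" for x
    using that by (auto simp: differentiable_def frechet_derivative_def)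
  moreover from this have "Ck_on k S (\<lambda>x. frechet_derivative f (at x) v)
      \<longleftrightarrow> Ck_on k S (\<lambda>x. frechet_derivative g (at x) v)" for v
    by (intro Suc.IH) auto
  ultimately show ?case by auto
qed

lemma Ck_on_subset: "Ck_on k S f \<Longrightarrow> T \<subseteq> S \<Longrightarrow> Ck_on k T f"
  by (induction k arbitrary: f) (auto intro: continuous_on_subset)

lemma Ck_on_Suc_imp: "Ck_on (Suc k) S f \<Longrightarrow> Ck_on k S f"
proof (induction k arbitrary: f)
  case 0
  then have "\<forall>x\<in>S. f differentiable (at x)" by simp
  then show ?case
    by (auto intro!: continuous_at_imp_continuous_on differentiable_imp_continuous_within)
qed simp

lemma Ck_on_const: "Ck_on k S (\<lambda>x. c)"
  by (induction k arbitrary: c) auto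

text \<open>The derivative is only specified through its values, so that a formula for it on an open set
  is all that is needed to descend from \<open>Suc k\<close> to \<open>k\<close>.\<close>
lemma Ck_on_SucI:
  assumes "open S" "\<And>x. x \<in> S \<Longrightarrow> (f has_derivative f' x) (at x)"
    and "\<And>v. Ck_on k S (\<lambda>x. f' x v)"
  shows "Ck_on (Suc k) S f"
proof -
  have "frechet_derivative f (at x) = f' x" if "x \<in> S" for x
    using assms(2)[OF that] frechet_derivative_at by metis
  then have "Ck_on k S (\<lambda>x. frechet_derivative f (at x) v)" for v
    using assms(3)[of v] by (subst Ck_on_cong[OF assms(1), where g = "\<lambda>x. f' x v"]) auto
  then show ?thesis
    using assms(2) by (auto simp: differentiable_def)
qed

lemma Ck_on_bounded_linear:
  assumes "bounded_linear f" "open S"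
  shows "Ck_on k S f"
proof (cases k)
  case 0
  then show ?thesis
    using assms by (auto intro!: linear_continuous_on)
next
  case (Suc j)
  show ?thesis
    unfolding Suc
    by (rule Ck_on_SucI[OF assms(2), where f' = "\<lambda>_. f"])
      (auto intro: bounded_linear_imp_has_derivative assms Ck_on_const)
qed

lemma Ck_on_add:
  assumes "open S" "Ck_on k S f" "Ck_on k S g"
  shows "Ck_on k S (\<lambda>x. f x + g x)"
  using assms(2,3)
proof (induction k arbitrary: f g)
  case 0
  then show ?case by (auto intro: continuous_intros)
next
  case (Suc k)
  show ?case
    using Suc.prems
    by (intro Ck_on_SucI[OF assms(1), where f' = "\<lambda>x v. frechet_derivative f (at x) v
        + frechet_derivative g (at x) v"] Suc.IH)
      (auto intro!: derivative_eq_intros has_derivative_frechet)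
qed

lemma Ck_on_sum:
  assumes "open S" "\<And>i. i \<in> I \<Longrightarrow> Ck_on k S (f i)"
  shows "Ck_on k S (\<lambda>x. \<Sum>i\<in>I. f i x)"
  using assms(2)
  by (induction I rule: infinite_finite_induct) (auto intro: Ck_on_const Ck_on_add[OF assms(1)])

lemma Ck_on_bilinear:
  assumes "bounded_bilinear B" "open S" "Ck_on k S f" "Ck_on k S g"
  shows "Ck_on k S (\<lambda>x. B (f x) (g x))"
  using assms(3,4)
proof (induction k arbitrary: f g)
  case 0
  then show ?case by (auto intro: bounded_bilinear.continuous_on[OF assms(1)])
next
  case (Suc k)
  note IH = Suc.IH
  have "Ck_on k S f" "Ck_on k S g"
    using Suc.prems Ck_on_Suc_imp by blast+
  then show ?case
    using Suc.prems
    by (intro Ck_on_SucI[OF assms(2), where f' = "\<lambda>x v. B (f x) (frechet_derivative g (at x) v)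
        + B (frechet_derivative f (at x) v) (g x)"] Ck_on_add IH assms(2))
      (auto intro!: bounded_bilinear.FDERIV[OF assms(1)] has_derivative_frechet)
qed

lemma Ck_on_inverse:
  fixes f :: "'a::real_normed_vector \<Rightarrow> real"
  assumes "open S" "Ck_on k S f" "\<And>x. x \<in> S \<Longrightarrow> f x \<noteq> 0"
  shows "Ck_on k S (\<lambda>x. inverse (f x))"
  using assms(2)
proof (induction k)
  case 0
  then show ?case using assms(3) by (auto intro: continuous_intros)
next
  case (Suc k)
  have "Ck_on k S (\<lambda>x. inverse (f x))"
    using Suc Ck_on_Suc_imp by blast
  then have "Ck_on k S (\<lambda>x. (- 1) * (inverse (f x) * frechet_derivative f (at x) v * inverse (f x)))" for v
    using Suc.prems
    by (intro Ck_on_bilinear[OF bounded_bilinear_mult] assms(1) Ck_on_const) auto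
  moreover have "((\<lambda>x. inverse (f x)) has_derivative
      (\<lambda>v. - (inverse (f x) * frechet_derivative f (at x) v * inverse (f x)))) (at x)" if "x \<in> S" for x
    using Suc.prems assms(3)[OF that] that by (intro Deriv.has_derivative_inverse has_derivative_frechet) auto
  ultimately show ?case
    by (intro Ck_on_SucI[OF assms(1)]) auto
qed

text \<open>The derivative of a composition is expanded in the standard basis, so that each summand is a
  product of functions covered by the induction hypothesis or by the product rule.\<close>
lemma Ck_on_compose:
  fixes g :: "'a::real_normed_vector \<Rightarrow> 'b::euclidean_space"
  assumes "open S" "open T" "g ` S \<subseteq> T" "Ck_on k T f" "Ck_on k S g"
  shows "Ck_on k S (\<lambda>x. f (g x))"
  using assms(4,5)
proof (induction k arbitrary: f)
  case 0
  then show ?case using assms(3) by (auto intro: continuous_on_compose2)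
next
  case (Suc k)
  have "Ck_on k S g"
    using Suc.prems Ck_on_Suc_imp by blast
  then have *: "Ck_on k S (\<lambda>x. \<Sum>b\<in>Basis. (frechet_derivative g (at x) v \<bullet> b) *\<^sub>R frechet_derivative f (at (g x)) b)" for v
    using Suc.prems
    by (intro Ck_on_sum Ck_on_bilinear[OF bounded_bilinear_scaleR]
        Ck_on_bilinear[OF bounded_bilinear_inner] Ck_on_const Suc.IH assms) auto
  show ?case
  proof (rule Ck_on_SucI[OF assms(1), where f' = "\<lambda>x v. frechet_derivative f (at (g x)) (frechet_derivative g (at x) v)"])
    fix x assume x: "x \<in> S"
    then show "((\<lambda>x. f (g x)) has_derivative (\<lambda>v. frechet_derivative f (at (g x)) (frechet_derivative g (at x) v))) (at x)"
      using Suc.prems assms(3)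
      by (intro has_derivative_compose[of g _ x UNIV f] has_derivative_frechet) auto
  next
    fix v
    have "(\<Sum>b\<in>Basis. (frechet_derivative g (at x) v \<bullet> b) *\<^sub>R frechet_derivative f (at (g x)) b)
        = frechet_derivative f (at (g x)) (frechet_derivative g (at x) v)" if "x \<in> S" for x
    proof -
      have l: "linear (frechet_derivative f (at (g x)))"
        using that Suc.prems assms(3) by (intro linear_frechet_derivative) auto
      show ?thesis
        by (rule linear_sum_Basis[OF l, symmetric])
    qed
    then show "Ck_on k S (\<lambda>x. frechet_derivative f (at (g x)) (frechet_derivative g (at x) v))"
      by (rule iffD1[OF Ck_on_cong[OF assms(1)] *[of v]])
  qed
qed

subsection \<open>Germs of smooth functions\<close>

text \<open>Smoothness of a germ. Leaving the neighbourhood unspecified makes the closure properties free of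
  conditions on domains.\<close>
definition smooth_around :: "('a::real_normed_vector \<Rightarrow> 'b::real_normed_vector) \<Rightarrow> 'a \<Rightarrow> bool" where
  "smooth_around f x \<longleftrightarrow> (\<exists>V. open V \<and> x \<in> V \<and> smooth_on V f)"

lemma smooth_on_subset: "smooth_on S f \<Longrightarrow> T \<subseteq> S \<Longrightarrow> smooth_on T f"
  unfolding smooth_on_def using Ck_on_subset by blast

lemma smooth_on_imp_around: "smooth_on S f \<Longrightarrow> open S \<Longrightarrow> x \<in> S \<Longrightarrow> smooth_around f x"
  unfolding smooth_around_def by blast

lemma smooth_around_eventually:
  "smooth_around f x \<Longrightarrow> eventually (smooth_around f) (nhds x)"
  unfolding smooth_around_def eventually_nhds by blast

lemma smooth_around_cong:
  assumes "eventually (\<lambda>y. f y = g y) (nhds x)"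
  shows "smooth_around f x \<longleftrightarrow> smooth_around g x"
proof -
  have "smooth_around g x" if "smooth_around f x" and eq: "eventually (\<lambda>y. f y = g y) (nhds x)" for f g :: "'a \<Rightarrow> 'b"
  proof -
    obtain V where V: "open V" "x \<in> V" "smooth_on V f"
      using \<open>smooth_around f x\<close> unfolding smooth_around_def by blast
    obtain W where W: "open W" "x \<in> W" "\<forall>y\<in>W. f y = g y"
      using eq unfolding eventually_nhds by blast
    have "Ck_on k (V \<inter> W) g" for k
      using Ck_on_cong[of "V \<inter> W" f g k] V W Ck_on_subset[of k V f "V \<inter> W"]
      unfolding smooth_on_def by (simp add: open_Int)
    then have "smooth_on (V \<inter> W) g"
      unfolding smooth_on_def by blast
    then show ?thesis
      using V W unfolding smooth_around_def by (meson IntI open_Int)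
  qed
  then show ?thesis
    using assms by (metis (mono_tags, lifting) eventually_mono)
qed

lemma smooth_around_const: "smooth_around (\<lambda>x. c) x"
  unfolding smooth_around_def smooth_on_def using Ck_on_const open_UNIV by blast

lemma smooth_around_bounded_linear: "bounded_linear f \<Longrightarrow> smooth_around f x"
  unfolding smooth_around_def smooth_on_def using Ck_on_bounded_linear open_UNIV by blast

lemma smooth_around_bilinear:
  assumes "bounded_bilinear B" "smooth_around f x" "smooth_around g x"
  shows "smooth_around (\<lambda>x. B (f x) (g x)) x"
proof -
  obtain V W where "open V" "x \<in> V" "smooth_on V f" "open W" "x \<in> W" "smooth_on W g"
    using assms(2,3) unfolding smooth_around_def by blast
  moreover from this have "smooth_on (V \<inter> W) f" "smooth_on (V \<inter> W) g"
    using smooth_on_subset by blast+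
  ultimately have "open (V \<inter> W)" "x \<in> V \<inter> W" "smooth_on (V \<inter> W) (\<lambda>x. B (f x) (g x))"
    using Ck_on_bilinear[OF assms(1)] unfolding smooth_on_def by blast+
  then show ?thesis
    unfolding smooth_around_def by blast
qed

lemmas smooth_around_mult = smooth_around_bilinear[OF bounded_bilinear_mult]
lemmas smooth_around_scaleR = smooth_around_bilinear[OF bounded_bilinear_scaleR]
lemmas smooth_around_inner = smooth_around_bilinear[OF bounded_bilinear_inner]

lemma smooth_around_add:
  assumes "smooth_around f x" "smooth_around g x"
  shows "smooth_around (\<lambda>x. f x + g x) x"
proof -
  obtain V W where "open V" "x \<in> V" "smooth_on V f" "open W" "x \<in> W" "smooth_on W g"
    using assms unfolding smooth_around_def by blast
  moreover from this have "smooth_on (V \<inter> W) f" "smooth_on (V \<inter> W) g"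
    using smooth_on_subset by blast+
  ultimately have "open (V \<inter> W)" "x \<in> V \<inter> W" "smooth_on (V \<inter> W) (\<lambda>x. f x + g x)"
    using Ck_on_add unfolding smooth_on_def by blast+
  then show ?thesis
    unfolding smooth_around_def by blast
qed

lemma smooth_around_sum:
  "(\<And>i. i \<in> I \<Longrightarrow> smooth_around (f i) x) \<Longrightarrow> smooth_around (\<lambda>x. \<Sum>i\<in>I. f i x) x"
  by (induction I rule: infinite_finite_induct) (auto intro: smooth_around_const smooth_around_add)

lemma smooth_around_continuous: "smooth_around f x \<Longrightarrow> isCont f x"
  unfolding smooth_around_def smooth_on_def
  using Ck_on.simps(1) continuous_on_eq_continuous_at by metis

lemma smooth_around_differentiable: "smooth_around f x \<Longrightarrow> f differentiable (at x)"
  unfolding smooth_around_def smooth_on_def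
  using Ck_on.simps(2) by blast

lemma smooth_around_has_derivative:
  "smooth_around f x \<Longrightarrow> (f has_derivative frechet_derivative f (at x)) (at x)"
  by (intro has_derivative_frechet smooth_around_differentiable)

lemma smooth_around_frechet_derivative:
  "smooth_around f x \<Longrightarrow> smooth_around (\<lambda>x. frechet_derivative f (at x) v) x"
  unfolding smooth_around_def smooth_on_def
  using Ck_on.simps(2) by blast

lemma smooth_around_inverse:
  fixes f :: "'a::real_normed_vector \<Rightarrow> real"
  assumes "smooth_around f x" "f x \<noteq> 0"
  shows "smooth_around (\<lambda>x. inverse (f x)) x"
proof -
  obtain V where V: "open V" "x \<in> V" "smooth_on V f"
    using assms unfolding smooth_around_def by blast
  then have "open (V \<inter> f -` (- {0}))"
    using Ck_on.simps(1)[of V f] unfolding smooth_on_def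
    by (intro continuous_open_preimage) (auto simp del: Ck_on.simps)
  moreover have "Ck_on k (V \<inter> f -` (- {0})) (\<lambda>x. inverse (f x))" for k
    using V calculation unfolding smooth_on_def
    by (intro Ck_on_inverse) (auto intro: Ck_on_subset)
  ultimately show ?thesis
    using V assms(2) unfolding smooth_around_def smooth_on_def
    by (intro exI[of _ "V \<inter> f -` (- {0})"]) auto
qed

lemma smooth_around_compose:
  fixes g :: "'a::real_normed_vector \<Rightarrow> 'b::euclidean_space"
  assumes "smooth_around f (g x)" "smooth_around g x"
  shows "smooth_around (\<lambda>x. f (g x)) x"
proof -
  obtain T where T: "open T" "g x \<in> T" "smooth_on T f"
    using assms(1) unfolding smooth_around_def by blast
  obtain V where V: "open V" "x \<in> V" "smooth_on V g"
    using assms(2) unfolding smooth_around_def by blast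
  have "open (V \<inter> g -` T)"
    using V T Ck_on.simps(1)[of V g] unfolding smooth_on_def
    by (intro continuous_open_preimage) (auto simp del: Ck_on.simps)
  moreover have "Ck_on k (V \<inter> g -` T) (\<lambda>x. f (g x))" for k
    using V T calculation Ck_on_subset[of k V g] unfolding smooth_on_def
    by (intro Ck_on_compose[OF _ T(1), of _ g k f]) auto
  ultimately show ?thesis
    using V T unfolding smooth_around_def smooth_on_def
    by (intro exI[of _ "V \<inter> g -` T"]) auto
qed

lemma smooth_around_components:
  fixes f :: "'a::real_normed_vector \<Rightarrow> 'b::euclidean_space"
  assumes "\<And>b. b \<in> Basis \<Longrightarrow> smooth_around (\<lambda>x. f x \<bullet> b) x"
  shows "smooth_around f x"
proof -
  have "smooth_around (\<lambda>x. \<Sum>b\<in>Basis. (f x \<bullet> b) *\<^sub>R b) x"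
    by (intro smooth_around_sum smooth_around_scaleR smooth_around_const assms)
  then show ?thesis
    by (simp add: euclidean_representation)
qed

lemma smooth_around_Pair:
  fixes f :: "'a::real_normed_vector \<Rightarrow> 'b::euclidean_space"
    and g :: "'a \<Rightarrow> 'c::euclidean_space"
  assumes "smooth_around f x" "smooth_around g x"
  shows "smooth_around (\<lambda>x. (f x, g x)) x"
proof (rule smooth_around_components)
  fix b :: "'b \<times> 'c" assume "b \<in> Basis"
  have "smooth_around (\<lambda>x. f x \<bullet> fst b + g x \<bullet> snd b) x"
    by (intro smooth_around_add smooth_around_inner smooth_around_const assms)
  then show "smooth_around (\<lambda>x. (f x, g x) \<bullet> b) x"
    by (simp add: inner_prod_def)
qed

lemma smooth_around_fst: "smooth_around fst x"
  by (rule smooth_around_bounded_linear[OF bounded_linear_fst])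

lemma smooth_around_snd: "smooth_around snd x"
  by (rule smooth_around_bounded_linear[OF bounded_linear_snd])

lemma smooth_around_ident: "smooth_around (\<lambda>x. x) x"
  by (rule smooth_around_bounded_linear[OF bounded_linear_ident])

lemma smooth_around_imp_on:
  assumes "open S" "\<And>x. x \<in> S \<Longrightarrow> smooth_around f x"
  shows "smooth_on S f"
proof -
  have "Ck_on k S f" for k
    using assms(2)
  proof (induction k arbitrary: f)
    case 0
    then show ?case
      by (auto intro!: continuous_at_imp_continuous_on smooth_around_continuous)
  next
    case (Suc k)
    then show ?case
      by (auto intro: smooth_around_differentiable smooth_around_frechet_derivative)
  qed
  then show ?thesis unfolding smooth_on_def by blast
qed

subsection \<open>Hadamard's lemma\<close>


text \<open>The coefficients in Hadamard's lemma are averages of derivatives along the segment from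
  \<open>p\<close> to \<open>x\<close>; a ball around \<open>p\<close> contains these segments.\<close>
lemma radial_segment_in_ball:
  fixes p y :: "'a::real_normed_vector" and t :: real
  assumes "y \<in> ball p r" "t \<in> cbox 0 1"
  shows "p + t *\<^sub>R (y - p) \<in> ball p r"
proof -
  have "\<bar>t\<bar> * norm (y - p) \<le> 1 * norm (y - p)"
    using assms by (intro mult_right_mono) auto
  then show ?thesis
    using assms by (simp add: dist_norm norm_minus_commute)
qed

text \<open>Differentiation under the integral sign produces an integral of the same kind, with one more
  power of \<open>t\<close> and with a derivative of \<open>f\<close> in place of \<open>f\<close>. Allowing an arbitrary power makes the
  class of such averages closed under differentiation.\<close>
lemma has_derivative_radial_average:
  fixes f :: "'a::euclidean_space \<Rightarrow> real"
  assumes "smooth_on (ball p r) f" "x \<in> ball p r"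
  shows "((\<lambda>x. integral (cbox 0 1) (\<lambda>t::real. t ^ m * f (p + t *\<^sub>R (x - p)))) has_derivative
    (\<lambda>v. integral (cbox 0 1) (\<lambda>t::real. t ^ Suc m * frechet_derivative f (at (p + t *\<^sub>R (x - p))) v))) (at x)"
proof -
  let ?q = "\<lambda>x t::real. p + t *\<^sub>R (x - p)"
  note q = radial_segment_in_ball[of _ p r]
  have cont: "continuous_on (ball p r) f"
    "continuous_on (ball p r) (\<lambda>x. frechet_derivative f (at x) v)" for v
    using assms Ck_on.simps(1) Ck_on.simps(2)[of 0] unfolding smooth_on_def by blast+
  have der: "(f has_derivative frechet_derivative f (at y)) (at y)" if "y \<in> ball p r" for y
    using assms that smooth_on_imp_around smooth_around_has_derivative open_ball by blast
  \<comment> \<open>The derivative as a continuous function with values in the bounded linear maps, which is the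
    form required for differentiation under the integral sign.\<close>
  define fx where "fx y t = (\<Sum>b\<in>Basis. (t ^ Suc m * frechet_derivative f (at (?q y t)) b) *\<^sub>R blinfun_inner_left b)"
    for y t
  have fx: "blinfun_apply (fx y t) v = t ^ Suc m * frechet_derivative f (at (?q y t)) v"
    if "y \<in> ball p r" "t \<in> cbox 0 1" for y t v
  proof -
    have l: "linear (frechet_derivative f (at (?q y t)))"
      using der[OF q[OF that]] has_derivative_linear by blast
    have "frechet_derivative f (at (?q y t)) v = (\<Sum>b\<in>Basis. (v \<bullet> b) * frechet_derivative f (at (?q y t)) b)"
      using linear_sum_Basis[OF l, of v] by simp
    then show ?thesis
      by (simp add: fx_def blinfun.sum_left blinfun.scaleR_left inner_commute sum_distrib_left mult_ac)
  qed
  have "((\<lambda>x. integral (cbox 0 1) (\<lambda>t::real. t ^ m * f (?q x t))) has_derivative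
      integral (cbox 0 1) (fx x)) (at x within ball p r)"
  proof (rule leibniz_rule)
    fix y t assume y: "y \<in> ball p r" and t: "t \<in> cbox 0 (1::real)"
    have "((\<lambda>y. t ^ m * f (?q y t)) has_derivative
        (\<lambda>v. t ^ m * frechet_derivative f (at (?q y t)) (t *\<^sub>R v))) (at y within ball p r)"
    proof (rule has_derivative_mult_right[OF has_derivative_compose[where f = "\<lambda>y. ?q y t", OF _ der[OF q[OF y t]]]])
      show "((\<lambda>y. ?q y t) has_derivative (\<lambda>v. t *\<^sub>R v)) (at y within ball p r)"
        by (auto intro!: derivative_eq_intros)
    qed
    moreover have "t ^ m * frechet_derivative f (at (?q y t)) (t *\<^sub>R v) = blinfun_apply (fx y t) v" for v
      using fx[OF y t] linear_cmul[OF has_derivative_linear[OF der[OF q[OF y t]]]] by simp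
    ultimately show "((\<lambda>y. t ^ m * f (?q y t)) has_derivative blinfun_apply (fx y t)) (at y within ball p r)"
      by simp
  next
    fix y assume y: "y \<in> ball p r"
    show "(\<lambda>t. t ^ m * f (?q y t)) integrable_on cbox 0 1"
      using q y by (intro integrable_continuous continuous_intros continuous_on_compose2[OF cont(1)]) auto
  next
    show "continuous_on (ball p r \<times> cbox 0 1) (\<lambda>(y, t). fx y t)"
      unfolding fx_def split_beta
      using q by (intro continuous_intros continuous_on_compose2[OF cont(2)]) auto
  qed (use assms in auto)
  moreover have "blinfun_apply (integral (cbox 0 1) (fx x)) v
      = integral (cbox 0 1) (\<lambda>t::real. t ^ Suc m * frechet_derivative f (at (?q x t)) v)" for v
  proof -
    have "fx x integrable_on cbox 0 1"
      unfolding fx_def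
      using q assms(2) by (intro integrable_continuous continuous_intros continuous_on_compose2[OF cont(2)]) auto
    then have "blinfun_apply (integral (cbox 0 1) (fx x)) v = integral (cbox 0 1) (\<lambda>t. blinfun_apply (fx x t) v)"
      using integral_linear[OF _ blinfun.bounded_linear_left, of "fx x" "cbox 0 1" v] by (simp add: o_def)
    also have "\<dots> = integral (cbox 0 1) (\<lambda>t::real. t ^ Suc m * frechet_derivative f (at (?q x t)) v)"
      by (intro integral_cong fx assms(2))
    finally show ?thesis .
  qed
  ultimately show ?thesis
    unfolding at_within_open[OF assms(2) open_ball]
    by (elim has_derivative_eq_rhs) (rule ext)
qed

lemma Ck_on_radial_average:
  fixes f :: "'a::euclidean_space \<Rightarrow> real"
  assumes "smooth_on (ball p r) f"
  shows "Ck_on k (ball p r) (\<lambda>x. integral (cbox 0 1) (\<lambda>t::real. t ^ m * f (p + t *\<^sub>R (x - p))))"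
  using assms
proof (induction k arbitrary: f m)
  case 0
  then show ?case
    using has_derivative_continuous[OF has_derivative_radial_average[OF 0]]
    by (auto intro!: continuous_at_imp_continuous_on simp del: integral_mult_right)
next
  case (Suc k)
  show ?case
  proof (rule Ck_on_SucI[OF open_ball has_derivative_radial_average[OF Suc.prems]])
    fix v
    have "smooth_on (ball p r) (\<lambda>x. frechet_derivative f (at x) v)"
      using Suc.prems Ck_on.simps(2) unfolding smooth_on_def by blast
    then show "Ck_on k (ball p r) (\<lambda>x. integral (cbox 0 1)
        (\<lambda>t::real. t ^ Suc m * frechet_derivative f (at (p + t *\<^sub>R (x - p))) v))"
      by (rule Suc.IH)
  qed
qed

text \<open>The coefficients are the averages of the partial derivatives along the segment from \<open>p\<close> to \<open>x\<close>,
  and the identity is the fundamental theorem of calculus on that segment.\<close>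
lemma hadamard:
  fixes f :: "'a::euclidean_space \<Rightarrow> real"
  assumes "smooth_around f p"
  obtains g where "\<And>b. b \<in> Basis \<Longrightarrow> smooth_around (g b) p"
    and "\<And>b. b \<in> Basis \<Longrightarrow> g b p = frechet_derivative f (at p) b"
    and "eventually (\<lambda>x. f x = f p + (\<Sum>b\<in>Basis. ((x - p) \<bullet> b) * g b x)) (nhds p)"
proof -
  obtain V where V: "open V" "p \<in> V" "smooth_on V f"
    using assms unfolding smooth_around_def by blast
  then obtain r where r: "r > 0" "ball p r \<subseteq> V"
    using open_contains_ball by blast
  let ?B = "ball p r"
  have sm: "smooth_on ?B f"
    using V r smooth_on_subset by blast
  let ?q = "\<lambda>x t::real. p + t *\<^sub>R (x - p)"
  note q = radial_segment_in_ball[of _ p r]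
  define g where "g b x = integral (cbox 0 1) (\<lambda>t::real. t ^ 0 * frechet_derivative f (at (?q x t)) b)" for b x
  have cont: "continuous_on ?B (\<lambda>x. frechet_derivative f (at x) v)" for v
    using sm Ck_on.simps(1) Ck_on.simps(2)[of 0] unfolding smooth_on_def by blast
  have der: "(f has_derivative frechet_derivative f (at y)) (at y)" if "y \<in> ?B" for y
    using sm that smooth_on_imp_around smooth_around_has_derivative open_ball by blast
  have "smooth_around (g b) p" for b
  proof -
    have "smooth_on ?B (\<lambda>x. frechet_derivative f (at x) b)"
      using sm Ck_on.simps(2) unfolding smooth_on_def by blast
    then have "smooth_on ?B (g b)"
      unfolding g_def using Ck_on_radial_average smooth_on_def by blast
    then show ?thesis
      using r by (intro smooth_on_imp_around) auto
  qed
  moreover have "g b p = frechet_derivative f (at p) b" for b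
    by (simp add: g_def)
  moreover have "f x = f p + (\<Sum>b\<in>Basis. ((x - p) \<bullet> b) * g b x)" if x: "x \<in> ?B" for x
  proof -
    have "((\<lambda>t. frechet_derivative f (at (?q x t)) (x - p)) has_integral f (?q x 1) - f (?q x 0)) {0..1}"
    proof (rule fundamental_theorem_of_calculus)
      fix t :: real assume t: "t \<in> {0..1}"
      have "((\<lambda>t. f (?q x t)) has_derivative (\<lambda>s. frechet_derivative f (at (?q x t)) (s *\<^sub>R (x - p)))) (at t within {0..1})"
      proof (rule has_derivative_compose[where f = "\<lambda>t. ?q x t", OF _ der])
        show "((\<lambda>t. ?q x t) has_derivative (\<lambda>s. s *\<^sub>R (x - p))) (at t within {0..1})"
          by (auto intro!: derivative_eq_intros)
        show "?q x t \<in> ?B"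
          using t by (intro q x) auto
      qed
      then show "((\<lambda>t. f (?q x t)) has_vector_derivative frechet_derivative f (at (?q x t)) (x - p)) (at t within {0..1})"
        using linear_cmul[OF has_derivative_linear[OF der[OF q[OF x]]]] t
        by (simp add: has_vector_derivative_def)
    qed simp
    then have "f x - f p = integral (cbox 0 1) (\<lambda>t. frechet_derivative f (at (?q x t)) (x - p))"
      by (simp add: integral_unique)
    also have "\<dots> = integral (cbox 0 1) (\<lambda>t. \<Sum>b\<in>Basis. ((x - p) \<bullet> b) * (t ^ 0 * frechet_derivative f (at (?q x t)) b))"
    proof (rule integral_cong)
      fix t :: real assume t: "t \<in> cbox 0 1"
      have l: "linear (frechet_derivative f (at (?q x t)))"
        using der[OF q[OF x t]] has_derivative_linear by blast
      show "frechet_derivative f (at (?q x t)) (x - p)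
        = (\<Sum>b\<in>Basis. ((x - p) \<bullet> b) * (t ^ 0 * frechet_derivative f (at (?q x t)) b))"
        using linear_sum_Basis[OF l, of "x - p"] by simp
    qed
    also have "\<dots> = (\<Sum>b\<in>Basis. ((x - p) \<bullet> b) * g b x)"
    proof -
      have "(\<lambda>t. ((x - p) \<bullet> b) * (t ^ 0 * frechet_derivative f (at (?q x t)) b)) integrable_on cbox 0 1" for b
        using q[OF x] by (intro integrable_continuous continuous_intros continuous_on_compose2[OF cont]) auto
      then show ?thesis
        unfolding g_def by (subst integral_sum) auto
    qed
    finally show ?thesis by simp
  qed
  then have "eventually (\<lambda>x. f x = f p + (\<Sum>b\<in>Basis. ((x - p) \<bullet> b) * g b x)) (nhds p)"
  proof (rule eventually_mono[rotated])
    show "eventually (\<lambda>x. x \<in> ?B) (nhds p)"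
      using r by (intro eventually_nhds_in_open) auto
  qed
  ultimately show ?thesis
    using that by blast
qed

subsection \<open>A bump function\<close>

text \<open>The functions \<open>t\<^sup>-\<^sup>n exp (- 1/t)\<close> extended by zero. Together they are closed under differentiation
  up to linear combinations, which makes all of them smooth at once.\<close>
definition flat_exp :: "nat \<Rightarrow> real \<Rightarrow> real" where
  "flat_exp n t = (if t > 0 then inverse t ^ n * exp (- inverse t) else 0)"

lemma flat_exp_tendsto_0: "(flat_exp n \<longlongrightarrow> 0) (at 0)"
proof -
  have "((\<lambda>t::real. inverse t ^ n / exp (inverse t)) \<longlongrightarrow> 0) (at_right 0)"
    using filterlim_compose[OF tendsto_power_div_exp_0 filterlim_inverse_at_top_right] .
  then have "(flat_exp n \<longlongrightarrow> 0) (at_right 0)"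
    by (rule Lim_transform_eventually)
      (auto simp: flat_exp_def exp_minus field_simps eventually_at_right_field intro!: exI[of _ 1])
  moreover have "(flat_exp n \<longlongrightarrow> 0) (at_left 0)"
    by (rule Lim_transform_eventually[of "\<lambda>_. 0"])
      (auto simp: flat_exp_def eventually_at_left_field intro!: exI[of _ "-1"])
  ultimately show ?thesis
    using filterlim_split_at by blast
qed

lemma flat_exp_has_derivative:
  "(flat_exp n has_real_derivative (flat_exp (n + 2) t - real n * flat_exp (n + 1) t)) (at t)"
proof -
  consider "t > 0" | "t < 0" | "t = 0" by linarith
  then show ?thesis
  proof cases
    case 1
    have "((\<lambda>t. inverse t ^ n * exp (- inverse t)) has_real_derivative
        (real n * inverse t ^ (n - 1) * - (inverse t)\<^sup>2) * exp (- inverse t)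
          + exp (- inverse t) * (inverse t)\<^sup>2 * inverse t ^ n) (at t)"
      using 1 by (auto intro!: derivative_eq_intros simp: power2_eq_square)
    also have "(real n * inverse t ^ (n - 1) * - (inverse t)\<^sup>2) * exp (- inverse t)
          + exp (- inverse t) * (inverse t)\<^sup>2 * inverse t ^ n
        = flat_exp (n + 2) t - real n * flat_exp (n + 1) t"
      using 1 by (cases n) (auto simp: flat_exp_def power2_eq_square algebra_simps)
    finally have "((\<lambda>t. inverse t ^ n * exp (- inverse t)) has_real_derivative
       (flat_exp (n + 2) t - real n * flat_exp (n + 1) t)) (at t)" .
    then show ?thesis
      using 1 by (rule_tac has_field_derivative_transform_within_open[where S = "{0<..}"]) (auto simp: flat_exp_def)
  next
    case 2
    have "((\<lambda>t. 0) has_real_derivative (flat_exp (n + 2) t - real n * flat_exp (n + 1) t)) (at t)"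
      using 2 by (simp add: flat_exp_def)
    then show ?thesis
      using 2 by (rule_tac has_field_derivative_transform_within_open[where S = "{..<0}"]) (auto simp: flat_exp_def)
  next
    case 3
    have "(\<lambda>h. (flat_exp n h - flat_exp n 0) / (h - 0)) = flat_exp (Suc n)"
      by (auto simp: flat_exp_def field_simps)
    then show ?thesis
      using flat_exp_tendsto_0[of "Suc n"] unfolding 3 has_field_derivative_iff by (simp add: flat_exp_def[of _ 0])
  qed
qed

lemma smooth_around_flat_exp: "smooth_around (flat_exp n) t"
proof -
  have "Ck_on k UNIV (flat_exp n)" for k
  proof (induction k arbitrary: n)
    case 0
    then show ?case
      using DERIV_isCont[OF flat_exp_has_derivative] by (auto intro!: continuous_at_imp_continuous_on)
  next
    case (Suc k)
    show ?case
    proof (rule Ck_on_SucI[OF open_UNIV])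
      show "(flat_exp n has_derivative (*) (flat_exp (n + 2) x + (- real n) * flat_exp (n + 1) x)) (at x)" for x
        using flat_exp_has_derivative[of n x] by (simp add: has_field_derivative_def)
    next
      fix v :: real
      show "Ck_on k UNIV (\<lambda>x. (flat_exp (n + 2) x + (- real n) * flat_exp (n + 1) x) * v)"
        by (intro Ck_on_bilinear[OF bounded_bilinear_mult] Ck_on_add Ck_on_const Suc.IH open_UNIV)
    qed
  qed
  then show ?thesis
    unfolding smooth_around_def smooth_on_def by blast
qed

lemma bump_exists:
  fixes p :: "'a::euclidean_space"
  assumes "r > 0"
  obtains f :: "'a \<Rightarrow> real" where "\<And>x. smooth_around f x" "f p \<noteq> 0" "\<And>x. x \<notin> cball p r \<Longrightarrow> f x = 0"
proof
  let ?f = "\<lambda>x. flat_exp 0 (r\<^sup>2 + (-1) * ((x - p) \<bullet> (x - p)))"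
  have diff: "smooth_around (\<lambda>x. x + (- p)) x" for x
    by (intro smooth_around_add smooth_around_ident smooth_around_const)
  show "smooth_around ?f x" for x
    unfolding diff_conv_add_uminus using diff
    by (intro smooth_around_compose[OF smooth_around_flat_exp] smooth_around_add[OF smooth_around_const]
        smooth_around_mult[OF smooth_around_const] smooth_around_inner)
  show "?f p \<noteq> 0"
    using assms by (simp add: flat_exp_def)
  show "?f x = 0" if "x \<notin> cball p r" for x
  proof -
    have "r\<^sup>2 \<le> (norm (x - p))\<^sup>2"
      using that assms by (intro power_mono) (auto simp: dist_norm norm_minus_commute)
    then show ?thesis
      by (simp add: flat_exp_def dot_square_norm)
  qed
qed

section \<open>Germs and tangent vectors on a manifold\<close>

text \<open>The filter of neighbourhoods of \<open>p\<close>, read off in one chart around \<open>p\<close>; continuity of the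
  transition maps makes the choice irrelevant (\<open>eventually_near\<close>).\<close>
definition near :: "('a, 'e::euclidean_space) atlas \<Rightarrow> 'a \<Rightarrow> 'a filter" where
  "near A p = (let c = SOME c. c \<in> A \<and> p \<in> fst c
     in filtermap (inv_into (fst c) (snd c)) (nhds (snd c p)))"

text \<open>The coordinate vector \<open>\<partial>\<^sub>y\<close> at \<open>p\<close>: the directional derivative along \<open>y\<close> in the chart.\<close>
definition coord_vec ::
  "('a, 'e::euclidean_space) atlas \<Rightarrow> 'a set \<Rightarrow> ('a \<Rightarrow> 'e) \<Rightarrow> 'a \<Rightarrow> 'e \<Rightarrow> 'a tangent" where
  "coord_vec A U \<phi> p y =
     (\<lambda>f. if smooth_at A p f then frechet_derivative (f \<circ> inv_into U \<phi>) (at (\<phi> p)) y else 0)"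

definition coords :: "('a \<Rightarrow> 'e::euclidean_space) \<Rightarrow> 'a tangent \<Rightarrow> 'e" where
  "coords \<phi> v = (\<Sum>b\<in>Basis. v (\<lambda>q. \<phi> q \<bullet> b) *\<^sub>R b)"

lemma coords_inner: "b \<in> Basis \<Longrightarrow> coords \<phi> v \<bullet> b = v (\<lambda>q. \<phi> q \<bullet> b)"
  by (simp add: coords_def inner_sum_left inner_Basis if_distrib cong: if_cong)

lemma smooth_at_pointsD: "smooth_at A p f \<Longrightarrow> p \<in> points A"
  unfolding smooth_at_def points_def by blast

lemma tangent_add: "v \<in> tangent_space A p \<Longrightarrow> smooth_at A p f \<Longrightarrow> smooth_at A p g \<Longrightarrow>
    v (\<lambda>q. f q + g q) = v f + v g"
  and tangent_scale: "v \<in> tangent_space A p \<Longrightarrow> smooth_at A p f \<Longrightarrow> v (\<lambda>q. c * f q) = c * v f"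
  and tangent_mult: "v \<in> tangent_space A p \<Longrightarrow> smooth_at A p f \<Longrightarrow> smooth_at A p g \<Longrightarrow>
    v (\<lambda>q. f q * g q) = f p * v g + g p * v f"
  and tangent_not_smooth: "v \<in> tangent_space A p \<Longrightarrow> \<not> smooth_at A p f \<Longrightarrow> v f = 0"
  unfolding tangent_space_def by blast+

lemma scaleR_tangent_apply [simp]: "(c *\<^sub>R (v :: 'a tangent)) f = c * v f"
  by (simp add: scaleR_fun_def)

lemma sum_fun_apply: "(\<Sum>i\<in>I. v i) x = (\<Sum>i\<in>I. v i x)"
  for v :: "'i \<Rightarrow> 'a \<Rightarrow> 'b::comm_monoid_add"
  by (induction I rule: infinite_finite_induct) auto

lemma subspace_tangent_space: "subspace (tangent_space A p)"
  unfolding subspace_def tangent_space_def by (auto simp: algebra_simps)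

text \<open>The differentiable structure of a manifold without its topological axioms. In this form it can be
  transferred to the slit tangent bundle; the bump functions used there are pulled back from the base.\<close>
locale smooth_atlas =
  fixes A :: "('a, 'e::euclidean_space) atlas"
  assumes chart_inj: "(U, \<phi>) \<in> A \<Longrightarrow> inj_on \<phi> U"
    and chart_open: "(U, \<phi>) \<in> A \<Longrightarrow> open (\<phi> ` U)"
    and transition_open: "(U, \<phi>) \<in> A \<Longrightarrow> (V, \<psi>) \<in> A \<Longrightarrow> open (\<phi> ` (U \<inter> V))"
    and transition_smooth: "(U, \<phi>) \<in> A \<Longrightarrow> (V, \<psi>) \<in> A \<Longrightarrow>
      smooth_on (\<phi> ` (U \<inter> V)) (\<psi> \<circ> inv_into U \<phi>)"
begin

lemma chart_inv: "(U, \<phi>) \<in> A \<Longrightarrow> q \<in> U \<Longrightarrow> inv_into U \<phi> (\<phi> q) = q"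
  by (simp add: chart_inj)

lemma points_chart:
  assumes "p \<in> points A" obtains U \<phi> where "(U, \<phi>) \<in> A" "p \<in> U"
  using assms unfolding points_def by blast

lemma chart_points: "(U, \<phi>) \<in> A \<Longrightarrow> p \<in> U \<Longrightarrow> p \<in> points A"
  unfolding points_def by blast

lemma transition_around:
  assumes "(U, \<phi>) \<in> A" "(V, \<psi>) \<in> A" "p \<in> U" "p \<in> V"
  shows "smooth_around (\<psi> \<circ> inv_into U \<phi>) (\<phi> p)"
    and "eventually (\<lambda>x. x \<in> \<phi> ` (U \<inter> V)) (nhds (\<phi> p))"
  using smooth_on_imp_around[OF transition_smooth[OF assms(1,2)] transition_open[OF assms(1,2)]]
    eventually_nhds_in_open[OF transition_open[OF assms(1,2)]] assms by auto

lemma nhds_chart_change: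
  assumes "(U, \<phi>) \<in> A" "(V, \<psi>) \<in> A" "p \<in> U" "p \<in> V"
    and "eventually (\<lambda>y. P (inv_into V \<psi> y)) (nhds (\<psi> p))"
  shows "eventually (\<lambda>x. P (inv_into U \<phi> x)) (nhds (\<phi> p))"
proof -
  let ?t = "\<psi> \<circ> inv_into U \<phi>"
  have "isCont ?t (\<phi> p)"
    using transition_around(1)[OF assms(1-4)] smooth_around_continuous by blast
  then have "(?t \<longlongrightarrow> \<psi> p) (nhds (\<phi> p))"
    unfolding isCont_def tendsto_at_iff_tendsto_nhds using assms chart_inv by simp
  then have "eventually (\<lambda>x. P (inv_into V \<psi> (?t x))) (nhds (\<phi> p))"
    using assms(5) filterlim_iff by blast
  with transition_around(2)[OF assms(1-4)] show ?thesis
    by eventually_elim (use assms(1,2) chart_inv in auto)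
qed

lemma eventually_near:
  assumes "(U, \<phi>) \<in> A" "p \<in> U"
  shows "eventually P (near A p) \<longleftrightarrow> eventually (\<lambda>x. P (inv_into U \<phi> x)) (nhds (\<phi> p))"
proof -
  define c where "c = (SOME c. c \<in> A \<and> p \<in> fst c)"
  have "c \<in> A \<and> p \<in> fst c"
    unfolding c_def by (rule someI[of _ "(U, \<phi>)"]) (use assms in auto)
  then have c: "(fst c, snd c) \<in> A" "p \<in> fst c" by auto
  show ?thesis
    unfolding near_def Let_def c_def[symmetric] eventually_filtermap
    using nhds_chart_change[OF assms(1) c(1) assms(2) c(2)]
      nhds_chart_change[OF c(1) assms(1) c(2) assms(2)] by blast
qed

lemma eventually_near_chart:
  assumes "(U, \<phi>) \<in> A" "p \<in> U"
  shows "eventually (\<lambda>q. q \<in> U) (near A p)"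
  unfolding eventually_near[OF assms]
  using eventually_nhds_in_open[OF chart_open[OF assms(1)], of "\<phi> p"] assms
  by (auto elim!: eventually_mono simp: inv_into_into)

lemma eventually_near_points: "p \<in> points A \<Longrightarrow> eventually (\<lambda>q. q \<in> points A) (near A p)"
  by (erule points_chart) (rule eventually_mono[OF eventually_near_chart], assumption+, rule chart_points)

lemma eventually_near_self: "p \<in> points A \<Longrightarrow> eventually P (near A p) \<Longrightarrow> P p"
  by (erule points_chart) (auto simp: eventually_near chart_inv dest: eventually_nhds_x_imp_x)

lemma smooth_at_iff:
  assumes "(U, \<phi>) \<in> A" "p \<in> U"
  shows "smooth_at A p f \<longleftrightarrow> smooth_around (f \<circ> inv_into U \<phi>) (\<phi> p)"
proof
  assume "smooth_at A p f"
  then obtain V \<psi> W where c: "(V, \<psi>) \<in> A" "p \<in> V" and W: "open W" "\<psi> p \<in> W"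
    "smooth_on W (f \<circ> inv_into V \<psi>)"
    unfolding smooth_at_def by blast
  let ?t = "\<psi> \<circ> inv_into U \<phi>"
  have "smooth_around (f \<circ> inv_into V \<psi>) (\<psi> p)"
    using W smooth_on_imp_around by blast
  then have "smooth_around (f \<circ> inv_into V \<psi>) (?t (\<phi> p))"
    using assms by (simp add: chart_inv)
  from smooth_around_compose[OF this transition_around(1)[OF assms(1) c(1) assms(2) c(2)]]
  have "smooth_around (\<lambda>x. (f \<circ> inv_into V \<psi>) (?t x)) (\<phi> p)" .
  moreover have "eventually (\<lambda>x. (f \<circ> inv_into V \<psi>) (?t x) = (f \<circ> inv_into U \<phi>) x) (nhds (\<phi> p))"
    using transition_around(2)[OF assms(1) c(1) assms(2) c(2)]
    by eventually_elim (use assms(1) c(1) chart_inv in auto)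
  ultimately show "smooth_around (f \<circ> inv_into U \<phi>) (\<phi> p)"
    by (rule iffD1[OF smooth_around_cong, rotated])
next
  assume "smooth_around (f \<circ> inv_into U \<phi>) (\<phi> p)"
  then obtain W where W: "open W" "\<phi> p \<in> W" "smooth_on W (f \<circ> inv_into U \<phi>)"
    unfolding smooth_around_def by blast
  then have "open (W \<inter> \<phi> ` U)" "\<phi> p \<in> W \<inter> \<phi> ` U" "W \<inter> \<phi> ` U \<subseteq> \<phi> ` U"
    "smooth_on (W \<inter> \<phi> ` U) (f \<circ> inv_into U \<phi>)"
    using assms chart_open smooth_on_subset[OF W(3)] by auto
  then show "smooth_at A p f"
    using assms unfolding smooth_at_def by blast
qed

lemma smooth_at_cong:
  assumes "p \<in> points A" "eventually (\<lambda>q. f q = g q) (near A p)"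
  shows "smooth_at A p f \<longleftrightarrow> smooth_at A p g"
proof -
  obtain U \<phi> where c: "(U, \<phi>) \<in> A" "p \<in> U"
    by (rule points_chart) (rule assms)
  show ?thesis
    using assms(2) unfolding smooth_at_iff[OF c] eventually_near[OF c]
    by (intro smooth_around_cong) simp
qed

lemma smooth_at_transfer:
  "smooth_at A p f \<Longrightarrow> eventually (\<lambda>q. f q = g q) (near A p) \<Longrightarrow> smooth_at A p g"
  using smooth_at_cong[OF smooth_at_pointsD, of p f f g] by simp

lemma smooth_at_eventually:
  assumes "smooth_at A p f"
  shows "eventually (\<lambda>q. smooth_at A q f) (near A p)"
proof -
  obtain U \<phi> where c: "(U, \<phi>) \<in> A" "p \<in> U"
    by (rule points_chart[OF smooth_at_pointsD]) (rule assms)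
  have "eventually (\<lambda>x. smooth_around (f \<circ> inv_into U \<phi>) x) (nhds (\<phi> p))"
    using assms smooth_around_eventually unfolding smooth_at_iff[OF c] by blast
  moreover have "eventually (\<lambda>x. x \<in> \<phi> ` U) (nhds (\<phi> p))"
    using c by (intro eventually_nhds_in_open chart_open) auto
  ultimately have "eventually (\<lambda>x. smooth_at A (inv_into U \<phi> x) f) (nhds (\<phi> p))"
    by eventually_elim (use smooth_at_iff c chart_inv in auto)
  then show ?thesis
    unfolding eventually_near[OF c] .
qed

lemma smooth_at_const:
  assumes "p \<in> points A"
  shows "smooth_at A p (\<lambda>q. c)"
proof -
  obtain U \<phi> where c: "(U, \<phi>) \<in> A" "p \<in> U"
    by (rule points_chart) (rule assms)
  show ?thesis
    unfolding smooth_at_iff[OF c] comp_def by (rule smooth_around_const)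
qed

lemma smooth_at_add:
  assumes "smooth_at A p f" "smooth_at A p g"
  shows "smooth_at A p (\<lambda>q. f q + g q)"
proof -
  obtain U \<phi> where c: "(U, \<phi>) \<in> A" "p \<in> U"
    by (rule points_chart[OF smooth_at_pointsD]) (rule assms)
  show ?thesis
    using assms unfolding smooth_at_iff[OF c] comp_def by (rule smooth_around_add)
qed

lemma smooth_at_mult:
  assumes "smooth_at A p f" "smooth_at A p g"
  shows "smooth_at A p (\<lambda>q. f q * g q)"
proof -
  obtain U \<phi> where c: "(U, \<phi>) \<in> A" "p \<in> U"
    by (rule points_chart[OF smooth_at_pointsD]) (rule assms)
  show ?thesis
    using assms unfolding smooth_at_iff[OF c] comp_def by (rule smooth_around_mult)
qed

lemma smooth_at_cmult: "smooth_at A p f \<Longrightarrow> smooth_at A p (\<lambda>q. c * f q)"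
  by (rule smooth_at_mult[OF smooth_at_const[OF smooth_at_pointsD]])

lemma smooth_at_diff:
  assumes "smooth_at A p f" "smooth_at A p g"
  shows "smooth_at A p (\<lambda>q. f q - g q)"
  using smooth_at_add[OF assms(1) smooth_at_cmult[OF assms(2), of "- 1"]] by simp

lemma smooth_at_sum:
  assumes "p \<in> points A" "\<And>i. i \<in> I \<Longrightarrow> smooth_at A p (f i)"
  shows "smooth_at A p (\<lambda>q. \<Sum>i\<in>I. f i q)"
  using assms(2)
proof (induction I rule: infinite_finite_induct)
  case (insert i I)
  then show ?case
    using smooth_at_add[of p "f i" "\<lambda>q. \<Sum>i\<in>I. f i q"] by simp
qed (simp_all add: smooth_at_const[OF assms(1)])

lemma smooth_at_inverse:
  assumes "smooth_at A p f" "f p \<noteq> 0"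
  shows "smooth_at A p (\<lambda>q. inverse (f q))"
proof -
  obtain U \<phi> where c: "(U, \<phi>) \<in> A" "p \<in> U"
    by (rule points_chart[OF smooth_at_pointsD]) (rule assms)
  show ?thesis
    using assms smooth_around_inverse[of "f \<circ> inv_into U \<phi>" "\<phi> p"] c
    unfolding smooth_at_iff[OF c] by (simp add: comp_def chart_inv)
qed

lemma smooth_at_nonzero:
  assumes "smooth_at A p f" "f p \<noteq> 0"
  shows "eventually (\<lambda>q. f q \<noteq> 0) (near A p)"
proof -
  obtain U \<phi> where c: "(U, \<phi>) \<in> A" "p \<in> U"
    by (rule points_chart[OF smooth_at_pointsD]) (rule assms)
  have "isCont (f \<circ> inv_into U \<phi>) (\<phi> p)"
    using assms smooth_around_continuous unfolding smooth_at_iff[OF c] by blast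
  then have "((f \<circ> inv_into U \<phi>) \<longlongrightarrow> f p) (nhds (\<phi> p))"
    unfolding isCont_def tendsto_at_iff_tendsto_nhds using c chart_inv by simp
  then have "eventually (\<lambda>x. (f \<circ> inv_into U \<phi>) x \<noteq> 0) (nhds (\<phi> p))"
    using assms(2) by (rule tendsto_imp_eventually_ne)
  then show ?thesis
    unfolding eventually_near[OF c] by simp
qed

lemma smooth_at_chart:
  fixes F :: "'e \<Rightarrow> real"
  assumes "(U, \<phi>) \<in> A" "p \<in> U" "smooth_around F (\<phi> p)"
  shows "smooth_at A p (\<lambda>q. F (\<phi> q))"
proof -
  have "eventually (\<lambda>x. F x = ((\<lambda>q. F (\<phi> q)) \<circ> inv_into U \<phi>) x) (nhds (\<phi> p))"
    using eventually_nhds_in_open[OF chart_open[OF assms(1)], of "\<phi> p"] assms chart_inv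
    by (auto elim!: eventually_mono simp: f_inv_into_f)
  then show ?thesis
    unfolding smooth_at_iff[OF assms(1,2)] using assms(3) smooth_around_cong by blast
qed

lemma smooth_at_coordinate:
  "(U, \<phi>) \<in> A \<Longrightarrow> p \<in> U \<Longrightarrow> smooth_at A p (\<lambda>q. \<phi> q \<bullet> b)"
  by (rule smooth_at_chart) (auto intro: smooth_around_inner smooth_around_ident smooth_around_const)

lemma tangent_const:
  assumes "v \<in> tangent_space A p" "p \<in> points A"
  shows "v (\<lambda>q. c) = 0"
  using tangent_mult[OF assms(1) smooth_at_const[OF assms(2)] smooth_at_const[OF assms(2)], of 1 1]
    tangent_scale[OF assms(1) smooth_at_const[OF assms(2)], of c 1] by simp

text \<open>A function that vanishes near \<open>p\<close> equals its product with a function that vanishes at \<open>p\<close>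
  and is constant near \<open>p\<close>, so that the Leibniz rule forces its derivative to be zero.\<close>
lemma tangent_local:
  assumes v: "v \<in> tangent_space A p" and p: "p \<in> points A"
    and eq: "eventually (\<lambda>q. f q = g q) (near A p)"
  shows "v f = v g"
proof (cases "smooth_at A p f")
  case True
  then have g: "smooth_at A p g"
    using smooth_at_cong[OF p eq] by blast
  define d where "d q = f q + (- 1) * g q" for q
  define k where "k q = (if d q = 0 then 0 else 1 :: real)" for q
  have d: "smooth_at A p d"
    unfolding d_def by (rule smooth_at_add[OF True smooth_at_cmult[OF g]])
  have "eventually (\<lambda>q. 0 = k q) (near A p)"
    using eq by eventually_elim (simp add: k_def d_def)
  then have k: "smooth_at A p k" "k p = 0"
    using smooth_at_cong[OF p] smooth_at_const[OF p] eventually_near_self[OF p] by fastforce+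
  have "d p = 0"
    using eventually_near_self[OF p eq] by (simp add: d_def)
  have "v (\<lambda>q. d q * k q) = 0"
    using tangent_mult[OF v d k(1)] k(2) \<open>d p = 0\<close> by simp
  moreover have "(\<lambda>q. d q * k q) = (\<lambda>q. f q + (- 1) * g q)"
    by (auto simp: d_def k_def)
  moreover have "v (\<lambda>q. f q + (- 1) * g q) = v f + (- 1) * v g"
    using tangent_add[OF v True smooth_at_cmult[OF g, of "- 1"]] tangent_scale[OF v g, of "- 1"] by simp
  ultimately show ?thesis by simp
next
  case False
  then have "\<not> smooth_at A p g"
    using smooth_at_cong[OF p eq] by blast
  then show ?thesis
    using False tangent_not_smooth[OF v] by simp
qed

lemma tangent_sum:
  assumes "v \<in> tangent_space A p" "p \<in> points A" "\<And>i. i \<in> I \<Longrightarrow> smooth_at A p (f i)"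
  shows "v (\<lambda>q. \<Sum>i\<in>I. f i q) = (\<Sum>i\<in>I. v (f i))"
  using assms(3)
proof (induction I rule: infinite_finite_induct)
  case (insert i I)
  then show ?case
    using tangent_add[OF assms(1), of "f i" "\<lambda>q. \<Sum>i\<in>I. f i q"] smooth_at_sum[OF assms(2), of I f] by (simp add: insert)
qed (auto simp: tangent_const[OF assms(1,2)])

subsection \<open>Coordinate vectors\<close>

lemma coord_vec_tangent:
  assumes c: "(U, \<phi>) \<in> A" "p \<in> U"
  shows "coord_vec A U \<phi> p y \<in> tangent_space A p"
proof -
  note sm = smooth_at_add smooth_at_mult smooth_at_cmult
  have d: "((f \<circ> inv_into U \<phi>) has_derivative frechet_derivative (f \<circ> inv_into U \<phi>) (at (\<phi> p))) (at (\<phi> p))"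
    if "smooth_at A p f" for f
    using that smooth_around_has_derivative unfolding smooth_at_iff[OF c] by blast
  have u: "frechet_derivative (\<lambda>x. f x) (at x) y = f' y" if "(f has_derivative f') (at x)" for f :: "'e \<Rightarrow> real" and f' x
    using frechet_derivative_at[OF that] by simp
  have "coord_vec A U \<phi> p y (\<lambda>q. f q + g q) = coord_vec A U \<phi> p y f + coord_vec A U \<phi> p y g"
    if "smooth_at A p f" "smooth_at A p g" for f g
    using u[OF has_derivative_add[OF d[OF that(1)] d[OF that(2)]]] that sm
    by (simp add: coord_vec_def comp_def)
  moreover have "coord_vec A U \<phi> p y (\<lambda>q. f q * g q) = f p * coord_vec A U \<phi> p y g + g p * coord_vec A U \<phi> p y f"
    if "smooth_at A p f" "smooth_at A p g" for f g
    using u[OF has_derivative_mult[OF d[OF that(1)] d[OF that(2)]]] that sm c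
    by (simp add: coord_vec_def comp_def chart_inv)
  moreover have "coord_vec A U \<phi> p y (\<lambda>q. k * f q) = k * coord_vec A U \<phi> p y f"
    if "smooth_at A p f" for f k
    using u[OF has_derivative_mult_right[OF d[OF that], of k]] that sm c
    by (simp add: coord_vec_def comp_def)
  ultimately show ?thesis
    unfolding tangent_space_def by (simp add: coord_vec_def)
qed

lemma linear_coord_vec:
  assumes c: "(U, \<phi>) \<in> A" "p \<in> U"
  shows "linear (coord_vec A U \<phi> p)"
proof -
  have "linear (frechet_derivative (f \<circ> inv_into U \<phi>) (at (\<phi> p)))" if "smooth_at A p f" for f
    using that smooth_around_differentiable linear_frechet_derivative unfolding smooth_at_iff[OF c] by blast
  then show ?thesis
    by (intro linearI) (auto simp: coord_vec_def fun_eq_iff linear_add linear_cmul)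
qed

lemma coord_vec_chart:
  fixes F :: "'e \<Rightarrow> real"
  assumes c: "(U, \<phi>) \<in> A" "p \<in> U" and F: "smooth_around F (\<phi> p)"
  shows "coord_vec A U \<phi> p y (\<lambda>q. F (\<phi> q)) = frechet_derivative F (at (\<phi> p)) y"
proof -
  have "frechet_derivative F (at (\<phi> p)) = frechet_derivative ((\<lambda>q. F (\<phi> q)) \<circ> inv_into U \<phi>) (at (\<phi> p))"
    using c by (intro frechet_derivative_transform_within_open[OF smooth_around_differentiable[OF F] chart_open[OF c(1)]])
      (auto simp: f_inv_into_f)
  then show ?thesis
    using smooth_at_chart[OF c F] by (simp add: coord_vec_def)
qed

lemma coords_coord_vec:
  assumes c: "(U, \<phi>) \<in> A" "p \<in> U"
  shows "coords \<phi> (coord_vec A U \<phi> p y) = y"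
proof (rule euclidean_eqI)
  fix b :: 'e assume b: "b \<in> Basis"
  have "frechet_derivative (\<lambda>x. x \<bullet> b) (at (\<phi> p)) y = y \<bullet> b"
    using frechet_derivative_at[OF bounded_linear_imp_has_derivative[OF bounded_linear_inner_left[of b]], of "\<phi> p"]
    by simp
  moreover have "smooth_around (\<lambda>x. x \<bullet> b) (\<phi> p)"
    by (intro smooth_around_inner smooth_around_ident smooth_around_const)
  ultimately show "coords \<phi> (coord_vec A U \<phi> p y) \<bullet> b = y \<bullet> b"
    using coord_vec_chart[OF c, of "\<lambda>x. x \<bullet> b"] b by (simp add: coords_inner)
qed

text \<open>In Hadamard's expansion each term is a product of a coordinate difference, which vanishes at the
  point, and a smooth factor, so that a derivation only sees the value of that factor at the point,
  which is a partial derivative.\<close>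
lemma tangent_eq_coord_vec:
  assumes c: "(U, \<phi>) \<in> A" "p \<in> U" and v: "v \<in> tangent_space A p"
  shows "v = coord_vec A U \<phi> p (coords \<phi> v)"
proof
  fix f
  have p: "p \<in> points A" by (rule chart_points[OF c])
  show "v f = coord_vec A U \<phi> p (coords \<phi> v) f"
  proof (cases "smooth_at A p f")
    case True
    let ?F = "f \<circ> inv_into U \<phi>"
    have F: "smooth_around ?F (\<phi> p)"
      using True smooth_at_iff[OF c] by simp
    obtain g where g: "\<And>b. b \<in> Basis \<Longrightarrow> smooth_around (g b) (\<phi> p)"
      "\<And>b. b \<in> Basis \<Longrightarrow> g b (\<phi> p) = frechet_derivative ?F (at (\<phi> p)) b"
      "eventually (\<lambda>x. ?F x = ?F (\<phi> p) + (\<Sum>b\<in>Basis. ((x - \<phi> p) \<bullet> b) * g b x)) (nhds (\<phi> p))"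
      using hadamard[OF F] by blast
    let ?h = "\<lambda>b q. \<phi> q \<bullet> b + (- (\<phi> p \<bullet> b))"
    have h: "smooth_at A p (?h b)" "v (?h b) = v (\<lambda>q. \<phi> q \<bullet> b)" for b
      using tangent_add[OF v smooth_at_coordinate[OF c] smooth_at_const[OF p]] tangent_const[OF v p]
      by (auto intro: smooth_at_add[OF smooth_at_coordinate[OF c] smooth_at_const[OF p]] simp del: add_uminus_conv_diff)
    have gs: "smooth_at A p (\<lambda>q. g b (\<phi> q))" if "b \<in> Basis" for b
      using smooth_at_chart[OF c g(1)[OF that]] .
    have "eventually (\<lambda>q. f q = f p + (\<Sum>b\<in>Basis. ?h b q * g b (\<phi> q))) (near A p)"
      unfolding eventually_near[OF c]
      using g(3) eventually_nhds_in_open[OF chart_open[OF c(1)] imageI[OF c(2)]]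
      by eventually_elim (use c chart_inv in \<open>auto simp: inner_diff_left\<close>)
    then have "v f = v (\<lambda>q. f p + (\<Sum>b\<in>Basis. ?h b q * g b (\<phi> q)))"
      by (rule tangent_local[OF v p])
    also have "\<dots> = (\<Sum>b\<in>Basis. v (\<lambda>q. ?h b q * g b (\<phi> q)))"
    proof -
      have s: "smooth_at A p (\<lambda>q. ?h b q * g b (\<phi> q))" if "b \<in> Basis" for b
        by (rule smooth_at_mult[OF h(1) gs[OF that]])
      then have "smooth_at A p (\<lambda>q. \<Sum>b\<in>Basis. ?h b q * g b (\<phi> q))"
        by (rule smooth_at_sum[OF p])
      from tangent_add[OF v smooth_at_const[OF p] this] tangent_const[OF v p] tangent_sum[OF v p s]
      show ?thesis by (simp only: add_0_left)
    qed
    also have "\<dots> = (\<Sum>b\<in>Basis. g b (\<phi> p) * v (?h b))"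
      using tangent_mult[OF v h(1) gs] by (intro sum.cong) auto
    also have "\<dots> = (\<Sum>b\<in>Basis. (coords \<phi> v \<bullet> b) *\<^sub>R frechet_derivative ?F (at (\<phi> p)) b)"
      using g(2) by (intro sum.cong) (simp_all add: coords_inner h(2) del: add_uminus_conv_diff)
    also have "\<dots> = frechet_derivative ?F (at (\<phi> p)) (coords \<phi> v)"
      by (rule linear_sum_Basis[symmetric, OF linear_frechet_derivative[OF smooth_around_differentiable[OF F]]])
    finally show ?thesis
      using True by (simp add: coord_vec_def)
  next
    case False
    then show ?thesis
      using tangent_not_smooth[OF v] by (simp add: coord_vec_def)
  qed
qed

lemma tangent_expansion:
  assumes c: "(U, \<phi>) \<in> A" "p \<in> U" and v: "v \<in> tangent_space A p"
  shows "v = (\<Sum>b\<in>Basis. v (\<lambda>q. \<phi> q \<bullet> b) *\<^sub>R coord_vec A U \<phi> p b)"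
  by (subst tangent_eq_coord_vec[OF c v], subst linear_sum_Basis[OF linear_coord_vec[OF c]])
    (auto intro!: sum.cong simp: coords_inner)

lemma tangent_eqI:
  assumes "(U, \<phi>) \<in> A" "p \<in> U" "v \<in> tangent_space A p" "w \<in> tangent_space A p"
    and "\<And>b. b \<in> Basis \<Longrightarrow> v (\<lambda>q. \<phi> q \<bullet> b) = w (\<lambda>q. \<phi> q \<bullet> b)"
  shows "v = w"
proof -
  have "coords \<phi> v = coords \<phi> w"
    unfolding coords_def using assms(5) by simp
  then show ?thesis
    using tangent_eq_coord_vec[OF assms(1,2)] assms(3,4) by metis
qed

lemma smooth_at_coord_vec:
  assumes c: "(U, \<phi>) \<in> A" "p \<in> U" and f: "smooth_at A p f"
  shows "smooth_at A p (\<lambda>q. coord_vec A U \<phi> q y f)"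
proof -
  let ?F = "f \<circ> inv_into U \<phi>"
  have "smooth_around (\<lambda>x. frechet_derivative ?F (at x) y) (\<phi> p)"
    using f smooth_around_frechet_derivative unfolding smooth_at_iff[OF c] by blast
  from smooth_at_chart[OF c this]
  have "smooth_at A p (\<lambda>q. frechet_derivative ?F (at (\<phi> q)) y)" .
  moreover have "eventually (\<lambda>q. frechet_derivative ?F (at (\<phi> q)) y = coord_vec A U \<phi> q y f) (near A p)"
    using smooth_at_eventually[OF f] by eventually_elim (simp add: coord_vec_def)
  ultimately show ?thesis
    by (rule smooth_at_transfer)
qed

subsection \<open>Bump functions on a manifold\<close>

lemma openin_manifold_topology:
  "openin (manifold_topology A) W \<longleftrightarrow> W \<subseteq> points A \<and> (\<forall>(U, \<phi>)\<in>A. open (\<phi> ` (U \<inter> W)))"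
proof -
  let ?L = "\<lambda>W. W \<subseteq> points A \<and> (\<forall>(U, \<phi>)\<in>A. open (\<phi> ` (U \<inter> W)))"
  have "istopology ?L"
    unfolding istopology_def
  proof (intro conjI allI impI; safe)
    fix S T U \<phi> assume "(U, \<phi>) \<in> A" "\<forall>(U, \<phi>)\<in>A. open (\<phi> ` (U \<inter> S))" "\<forall>(U, \<phi>)\<in>A. open (\<phi> ` (U \<inter> T))"
    moreover have "\<phi> ` (U \<inter> (S \<inter> T)) = \<phi> ` (U \<inter> S) \<inter> \<phi> ` (U \<inter> T)"
      using chart_inj[OF \<open>(U, \<phi>) \<in> A\<close>] by (auto simp: inj_on_def)
    ultimately show "open (\<phi> ` (U \<inter> (S \<inter> T)))" by auto
  next
    fix K U \<phi> assume "(U, \<phi>) \<in> A" and K: "\<forall>W\<in>K. W \<subseteq> points A \<and> (\<forall>(U, \<phi>)\<in>A. open (\<phi> ` (U \<inter> W)))"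
    moreover have "\<phi> ` (U \<inter> \<Union>K) = (\<Union>W\<in>K. \<phi> ` (U \<inter> W))"
      by auto
    ultimately show "open (\<phi> ` (U \<inter> \<Union>K))"
      by (auto intro!: open_UN)
  qed auto
  then show ?thesis
    unfolding manifold_topology_def by (simp add: topology_inverse')
qed

lemma topspace_manifold_topology: "topspace (manifold_topology A) = points A"
proof
  have "U \<inter> points A = U" if "(U, \<phi>) \<in> A" for U \<phi>
    using that unfolding points_def by blast
  then have "openin (manifold_topology A) (points A)"
    unfolding openin_manifold_topology using chart_open by auto
  then show "points A \<subseteq> topspace (manifold_topology A)"
    by (rule openin_subset)
  show "topspace (manifold_topology A) \<subseteq> points A"
    using openin_topspace[of "manifold_topology A"] unfolding openin_manifold_topology by blast
qed

text \<open>The Hausdorff property is what makes the extension by zero smooth: the support of the bump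
  function is compact, hence closed.\<close>
lemma manifold_bump:
  assumes H: "Hausdorff_space (manifold_topology A)" and c: "(U, \<phi>) \<in> A" "p \<in> U"
  obtains \<kappa> where "\<kappa> \<in> smooth_functions A" "\<kappa> p \<noteq> 0"
    "\<And>q. q \<in> points A - U \<Longrightarrow> eventually (\<lambda>q. \<kappa> q = 0) (near A q)"
proof -
  obtain r where r: "r > 0" "cball (\<phi> p) r \<subseteq> \<phi> ` U"
    using open_contains_cball chart_open[OF c(1)] c(2) by blast
  obtain f where f: "\<And>x. smooth_around f x" "f (\<phi> p) \<noteq> 0" "\<And>x. x \<notin> cball (\<phi> p) r \<Longrightarrow> f x = (0::real)"
    using bump_exists[OF r(1)] by metis
  define K where "K = inv_into U \<phi> ` cball (\<phi> p) r"
  define \<kappa> where "\<kappa> q = (if q \<in> U then f (\<phi> q) else 0)" for q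
  have "continuous_map (top_of_set (\<phi> ` U)) (manifold_topology A) (inv_into U \<phi>)"
    unfolding continuous_map_def
  proof (intro conjI allI impI)
    show "inv_into U \<phi> \<in> topspace (top_of_set (\<phi> ` U)) \<rightarrow> topspace (manifold_topology A)"
      using c chart_points[OF c(1)] by (auto simp: topspace_manifold_topology chart_inv)
    fix W assume "openin (manifold_topology A) W"
    then have "open (\<phi> ` (U \<inter> W))"
      using c unfolding openin_manifold_topology by blast
    moreover have "{x \<in> topspace (top_of_set (\<phi> ` U)). inv_into U \<phi> x \<in> W} = \<phi> ` (U \<inter> W)"
      using c by (auto simp: chart_inv)
    ultimately show "openin (top_of_set (\<phi> ` U)) {x \<in> topspace (top_of_set (\<phi> ` U)). inv_into U \<phi> x \<in> W}"
      by (auto intro: open_subset)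
  qed
  moreover have "compactin (top_of_set (\<phi> ` U)) (cball (\<phi> p) r)"
    using r by (simp add: compactin_subtopology)
  ultimately have "compactin (manifold_topology A) K"
    unfolding K_def by (rule image_compactin[rotated])
  then have "closedin (manifold_topology A) K"
    using H compactin_imp_closedin by blast
  then have "openin (manifold_topology A) (points A - K)"
    unfolding closedin_def topspace_manifold_topology by blast
  then have open_compl: "open (\<psi> ` (V \<inter> (points A - K)))" if "(V, \<psi>) \<in> A" for V \<psi>
    using that unfolding openin_manifold_topology by blast
  have zero: "\<kappa> q = 0" if "q \<notin> K" for q
  proof (cases "q \<in> U")
    case True
    then have "q = inv_into U \<phi> (\<phi> q)"
      using c chart_inv by simp
    then have "\<phi> q \<notin> cball (\<phi> p) r"
      using that unfolding K_def by blast
    then show ?thesis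
      using f by (simp add: \<kappa>_def)
  qed (simp add: \<kappa>_def)
  have "K \<subseteq> U"
    using r c chart_inv unfolding K_def by auto
  have out: "eventually (\<lambda>q. \<kappa> q = 0) (near A q)" if q: "q \<in> points A - U" for q
  proof -
    obtain V \<psi> where d: "(V, \<psi>) \<in> A" "q \<in> V"
      using points_chart[of q] q by blast
    have "\<psi> q \<in> \<psi> ` (V \<inter> (points A - K))"
      using q \<open>K \<subseteq> U\<close> d by blast
    then have "eventually (\<lambda>x. x \<in> \<psi> ` (V \<inter> (points A - K))) (nhds (\<psi> q))"
      by (rule eventually_nhds_in_open[OF open_compl[OF d(1)]])
    then show ?thesis
      unfolding eventually_near[OF d] by eventually_elim (use d chart_inv zero in auto)
  qed
  moreover have "\<kappa> \<in> smooth_functions A"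
    unfolding smooth_functions_def
  proof (intro CollectI ballI)
    fix q assume q: "q \<in> points A"
    show "smooth_at A q \<kappa>"
    proof (cases "q \<in> U")
      case True
      have "smooth_at A q (\<lambda>q. f (\<phi> q))"
        by (rule smooth_at_chart[OF c(1) True f(1)])
      moreover have "eventually (\<lambda>q. f (\<phi> q) = \<kappa> q) (near A q)"
        using eventually_near_chart[OF c(1) True] by eventually_elim (simp add: \<kappa>_def)
      ultimately show ?thesis
        by (rule smooth_at_transfer)
    next
      case False
      then show ?thesis
        using out[of q] smooth_at_cong[OF q, of \<kappa> "\<lambda>q. 0"] smooth_at_const[OF q] q by simp
    qed
  qed
  moreover have "\<kappa> p \<noteq> 0"
    using f c by (simp add: \<kappa>_def)
  ultimately show ?thesis
    using that by blast
qed

end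

section \<open>Linear systems with smooth coefficients\<close>

text \<open>Germs of smooth functions form a local ring, so Gaussian elimination works: a coefficient that
  does not vanish at the point can be inverted near it. This replaces Cramer's rule.\<close>
lemma (in smooth_atlas) smooth_at_linear_system:
  fixes a :: "'i \<Rightarrow> 'j \<Rightarrow> 'a \<Rightarrow> real"
  assumes p: "p \<in> points A" and J: "finite J"
    and a: "\<And>i j. i \<in> I \<Longrightarrow> j \<in> J \<Longrightarrow> smooth_at A p (a i j)"
    and b: "\<And>i. i \<in> I \<Longrightarrow> smooth_at A p (b i)"
    and eq: "\<And>i. i \<in> I \<Longrightarrow> eventually (\<lambda>q. (\<Sum>j\<in>J. a i j q * x j q) = b i q) (near A p)"
    and inj: "\<And>c. (\<And>i. i \<in> I \<Longrightarrow> (\<Sum>j\<in>J. a i j p * c j) = 0) \<Longrightarrow> \<forall>j\<in>J. c j = 0"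
  shows "\<forall>j\<in>J. smooth_at A p (x j)"
  using J a b eq inj
proof (induction J arbitrary: a b rule: finite_induct)
  case (insert k J)
  have "\<exists>i\<in>I. a i k p \<noteq> 0"
  proof (rule ccontr)
    assume "\<not> (\<exists>i\<in>I. a i k p \<noteq> 0)"
    then have "\<forall>j\<in>insert k J. (if j = k then 1 else 0 :: real) = 0"
      using insert.hyps by (intro insert.prems(4)) (auto intro!: sum.neutral)
    then show False by simp
  qed
  then obtain l where l: "l \<in> I" "a l k p \<noteq> 0" by blast
  define r where "r i q = a i k q * inverse (a l k q)" for i q
  define a' where "a' i j q = a i j q - r i q * a l j q" for i j q
  define b' where "b' i q = b i q - r i q * b l q" for i q
  have inv: "smooth_at A p (\<lambda>q. inverse (a l k q))"
    using insert.prems(1) l by (intro smooth_at_inverse) auto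
  then have r: "smooth_at A p (r i)" if "i \<in> I" for i
    unfolding r_def using insert.prems(1) that by (intro smooth_at_mult) auto
  have nz: "eventually (\<lambda>q. a l k q \<noteq> 0) (near A p)"
    using insert.prems(1) l by (intro smooth_at_nonzero) auto
  have "\<forall>j\<in>J. smooth_at A p (x j)"
  proof (rule insert.IH)
    show "smooth_at A p (a' i j)" if "i \<in> I" "j \<in> J" for i j
      unfolding a'_def using insert.prems(1) r l that by (intro smooth_at_diff smooth_at_mult) auto
    show "smooth_at A p (b' i)" if "i \<in> I" for i
      unfolding b'_def using insert.prems(2) r l that by (intro smooth_at_diff smooth_at_mult) auto
    show "eventually (\<lambda>q. (\<Sum>j\<in>J. a' i j q * x j q) = b' i q) (near A p)" if i: "i \<in> I" for i
      using nz insert.prems(3)[OF i] insert.prems(3)[OF l(1)]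
    proof eventually_elim
      case (elim q)
      have "(\<Sum>j\<in>J. a' i j q * x j q) = (\<Sum>j\<in>J. a i j q * x j q) - r i q * (\<Sum>j\<in>J. a l j q * x j q)"
        by (simp add: a'_def left_diff_distrib sum_subtractf sum_distrib_left mult.assoc)
      also have "(\<Sum>j\<in>J. a i j q * x j q) = b i q - a i k q * x k q"
        using elim insert.hyps by simp
      also have "(\<Sum>j\<in>J. a l j q * x j q) = b l q - a l k q * x k q"
        using elim insert.hyps by simp
      also have "b i q - a i k q * x k q - r i q * (b l q - a l k q * x k q) = b' i q"
        using elim by (simp add: b'_def r_def field_simps)
      finally show ?case .
    qed
    show "\<forall>j\<in>J. c j = 0" if c: "\<And>i. i \<in> I \<Longrightarrow> (\<Sum>j\<in>J. a' i j p * c j) = 0" for c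
    proof -
      \<comment> \<open>A solution of the reduced homogeneous system extends to one of the full system, the
        component at \<open>k\<close> being read off from the pivot row \<open>l\<close>.\<close>
      define d where "d j = (if j = k then - inverse (a l k p) * (\<Sum>j\<in>J. a l j p * c j) else c j)" for j
      have "\<forall>j\<in>insert k J. d j = 0"
      proof (rule insert.prems(4))
        fix i assume i: "i \<in> I"
        have "(\<Sum>j\<in>J. a i j p * d j) = (\<Sum>j\<in>J. a i j p * c j)"
          using insert.hyps by (intro sum.cong) (auto simp: d_def)
        then have "(\<Sum>j\<in>insert k J. a i j p * d j) = (\<Sum>j\<in>J. a i j p * c j) - r i p * (\<Sum>j\<in>J. a l j p * c j)"
          using insert.hyps by (simp add: d_def r_def)
        also have "\<dots> = (\<Sum>j\<in>J. a' i j p * c j)"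
          by (simp add: a'_def left_diff_distrib sum_subtractf sum_distrib_left mult.assoc)
        finally show "(\<Sum>j\<in>insert k J. a i j p * d j) = 0"
          using c[OF i] by simp
      qed
      then show ?thesis
        using insert.hyps by (metis d_def insertCI)
    qed
  qed
  moreover have "smooth_at A p (x k)"
  proof (rule smooth_at_transfer)
    show "smooth_at A p (\<lambda>q. inverse (a l k q) * (b l q - (\<Sum>j\<in>J. a l j q * x j q)))"
      using insert.prems(1,2) l inv \<open>\<forall>j\<in>J. smooth_at A p (x j)\<close> p
      by (intro smooth_at_mult smooth_at_diff smooth_at_sum) auto
    show "eventually (\<lambda>q. inverse (a l k q) * (b l q - (\<Sum>j\<in>J. a l j q * x j q)) = x k q) (near A p)"
      using nz insert.prems(3)[OF l(1)]
      by eventually_elim (use insert.hyps in \<open>auto simp: field_simps\<close>)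
  qed
  ultimately show ?case by simp
qed simp

section \<open>The slit tangent bundle\<close>

definition slit_dom :: "('m, 'e::euclidean_space) atlas \<Rightarrow> 'm set \<Rightarrow> 'm tvec set" where
  "slit_dom A U = {(p, v). p \<in> U \<and> v \<in> tangent_space A p \<and> v \<noteq> 0}"

definition slit_chart :: "('m \<Rightarrow> 'e::euclidean_space) \<Rightarrow> 'm tvec \<Rightarrow> 'e \<times> 'e" where
  "slit_chart \<phi> = (\<lambda>(p, v). (\<phi> p, coords \<phi> v))"

lemma slit_alt: "slit A = (\<lambda>(U, \<phi>). (slit_dom A U, slit_chart \<phi>)) ` A"
  unfolding slit_def slit_dom_def slit_chart_def coords_def ..

lemma slit_mem: "(U, \<phi>) \<in> A \<Longrightarrow> (slit_dom A U, slit_chart \<phi>) \<in> slit A"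
  unfolding slit_alt by (rule image_eqI) auto

lemma slit_cases:
  assumes "(U', \<phi>') \<in> slit A"
  obtains U \<phi> where "(U, \<phi>) \<in> A" "U' = slit_dom A U" "\<phi>' = slit_chart \<phi>"
  using assms unfolding slit_alt by auto

lemma points_slit: "u \<in> points (slit A) \<longleftrightarrow>
    fst u \<in> points A \<and> snd u \<in> tangent_space A (fst u) \<and> snd u \<noteq> 0"
proof -
  have "points (slit A) = (\<Union>(U, \<phi>)\<in>A. slit_dom A U)"
    unfolding points_def slit_alt by auto
  then show ?thesis
    unfolding points_def slit_dom_def by (cases u) auto
qed

context smooth_atlas
begin

lemma coords_eq_0:
  assumes "(U, \<phi>) \<in> A" "p \<in> U" "v \<in> tangent_space A p"
  shows "coords \<phi> v = 0 \<longleftrightarrow> v = 0"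
proof
  assume "coords \<phi> v = 0"
  then show "v = 0"
    using tangent_eq_coord_vec[OF assms] linear_0[OF linear_coord_vec[OF assms(1,2)]] by simp
qed (simp add: coords_def)

lemma slit_chart_inj:
  assumes "(U, \<phi>) \<in> A"
  shows "inj_on (slit_chart \<phi>) (slit_dom A U)"
proof (rule inj_onI)
  fix u w assume u: "u \<in> slit_dom A U" and w: "w \<in> slit_dom A U" and eq: "slit_chart \<phi> u = slit_chart \<phi> w"
  have "fst u = fst w"
    by (rule inj_onD[OF chart_inj[OF assms]]) (use u w eq in \<open>auto simp: slit_dom_def slit_chart_def\<close>)
  moreover from this have "snd u = snd w"
    using u w eq tangent_eq_coord_vec[OF assms, of "fst u" "snd u"]
      tangent_eq_coord_vec[OF assms, of "fst u" "snd w"]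
    by (auto simp: slit_dom_def slit_chart_def)
  ultimately show "u = w"
    by (simp add: prod_eq_iff)
qed

lemma slit_chart_coord_vec:
  assumes "(U, \<phi>) \<in> A" "p \<in> U" "y \<noteq> 0"
  shows "(p, coord_vec A U \<phi> p y) \<in> slit_dom A U"
    and "slit_chart \<phi> (p, coord_vec A U \<phi> p y) = (\<phi> p, y)"
  using coord_vec_tangent[OF assms(1,2), of y] coords_coord_vec[OF assms(1,2), of y] assms
    coords_eq_0[OF assms(1,2) coord_vec_tangent[OF assms(1,2)], of y]
  by (auto simp: slit_dom_def slit_chart_def)

lemma slit_chart_image:
  assumes "(U, \<phi>) \<in> A"
  shows "slit_chart \<phi> ` (slit_dom A U \<inter> slit_dom A V) = \<phi> ` (U \<inter> V) \<times> (- {0})"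
proof
  show "slit_chart \<phi> ` (slit_dom A U \<inter> slit_dom A V) \<subseteq> \<phi> ` (U \<inter> V) \<times> (- {0})"
    using coords_eq_0[OF assms] by (auto simp: slit_dom_def slit_chart_def)
  show "\<phi> ` (U \<inter> V) \<times> (- {0}) \<subseteq> slit_chart \<phi> ` (slit_dom A U \<inter> slit_dom A V)"
  proof
    fix z :: "'e \<times> 'e" assume "z \<in> \<phi> ` (U \<inter> V) \<times> (- {0})"
    then obtain p y where p: "p \<in> U" "p \<in> V" and y: "y \<noteq> 0" and z: "z = (\<phi> p, y)"
      by auto
    note * = slit_chart_coord_vec[OF assms p(1) y]
    have "(p, coord_vec A U \<phi> p y) \<in> slit_dom A U \<inter> slit_dom A V"
      using *(1) p by (auto simp: slit_dom_def)
    then show "z \<in> slit_chart \<phi> ` (slit_dom A U \<inter> slit_dom A V)"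
      unfolding z *(2)[symmetric] by (rule imageI)
  qed
qed

text \<open>The inverse of an induced chart rebuilds a tangent vector from its components, using that every
  vector of the model space is the component vector of some derivation.\<close>
lemma slit_chart_inv:
  assumes "(U, \<phi>) \<in> A" "x \<in> \<phi> ` U" "y \<noteq> 0"
  shows "inv_into (slit_dom A U) (slit_chart \<phi>) (x, y) = (inv_into U \<phi> x, coord_vec A U \<phi> (inv_into U \<phi> x) y)"
proof -
  have "inv_into U \<phi> x \<in> U" "\<phi> (inv_into U \<phi> x) = x"
    using assms by (auto simp: inv_into_into f_inv_into_f)
  then show ?thesis
    using slit_chart_coord_vec[OF assms(1) _ assms(3), of "inv_into U \<phi> x"]
    by (intro inv_into_f_eq[OF slit_chart_inj[OF assms(1)]]) simp_all
qed

text \<open>Applying a derivation to the new coordinates is the chain rule: the components of a tangent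
  vector transform by the derivative of the transition map of the base.\<close>
lemma slit_transition:
  assumes "(U, \<phi>) \<in> A" "(V, \<psi>) \<in> A" "x \<in> \<phi> ` (U \<inter> V)" "y \<noteq> 0"
  defines "t \<equiv> \<psi> \<circ> inv_into U \<phi>"
  shows "(slit_chart \<psi> \<circ> inv_into (slit_dom A U) (slit_chart \<phi>)) (x, y)
    = (t x, frechet_derivative t (at x) y)"
proof -
  obtain p where p: "p \<in> U" "p \<in> V" "x = \<phi> p"
    using assms by blast
  have t: "(t has_derivative frechet_derivative t (at x)) (at x)"
    unfolding t_def p using transition_around(1)[OF assms(1,2) p(1,2)] by (rule smooth_around_has_derivative)
  have "coords \<psi> (coord_vec A U \<phi> p y) = frechet_derivative t (at x) y"
  proof (rule euclidean_eqI)
    fix b :: 'e assume b: "b \<in> Basis"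
    have "((\<lambda>q. \<psi> q \<bullet> b) \<circ> inv_into U \<phi> has_derivative (\<lambda>y. frechet_derivative t (at x) y \<bullet> b)) (at x)"
      using has_derivative_inner_left[OF t, of b] unfolding t_def comp_def .
    from frechet_derivative_at[OF this]
    show "coords \<psi> (coord_vec A U \<phi> p y) \<bullet> b = frechet_derivative t (at x) y \<bullet> b"
      using b smooth_at_coordinate[OF assms(2) p(2)] by (simp add: coords_inner coord_vec_def p(3) fun_eq_iff)
  qed
  then show ?thesis
    using slit_chart_inv[OF assms(1) _ assms(4), of x] p chart_inv[OF assms(1)]
    by (simp add: slit_chart_def t_def)
qed

lemma smooth_atlas_slit: "smooth_atlas (slit A)"
proof
  fix U' \<phi>' assume "(U', \<phi>') \<in> slit A"
  then obtain U \<phi> where c: "(U, \<phi>) \<in> A" "U' = slit_dom A U" "\<phi>' = slit_chart \<phi>"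
    by (rule slit_cases)
  show "inj_on \<phi>' U'"
    unfolding c(2,3) by (rule slit_chart_inj[OF c(1)])
  show "open (\<phi>' ` U')"
    using slit_chart_image[OF c(1), of U] chart_open[OF c(1)] unfolding c(2,3)
    by (simp add: open_Times open_Compl)
  fix V' \<psi>' assume "(V', \<psi>') \<in> slit A"
  then obtain V \<psi> where d: "(V, \<psi>) \<in> A" "V' = slit_dom A V" "\<psi>' = slit_chart \<psi>"
    by (rule slit_cases)
  have im: "\<phi>' ` (U' \<inter> V') = \<phi> ` (U \<inter> V) \<times> (- {0})"
    unfolding c(2,3) d(2,3) by (rule slit_chart_image[OF c(1)])
  show op: "open (\<phi>' ` (U' \<inter> V'))"
    unfolding im by (intro open_Times transition_open[OF c(1) d(1)]) (simp add: open_Compl)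
  show "smooth_on (\<phi>' ` (U' \<inter> V')) (\<psi>' \<circ> inv_into U' \<phi>')"
  proof (rule smooth_around_imp_on[OF op])
    fix z assume z: "z \<in> \<phi>' ` (U' \<inter> V')"
    let ?t = "\<psi> \<circ> inv_into U \<phi>"
    have fz: "fst z \<in> \<phi> ` (U \<inter> V)"
      using z unfolding im by auto
    have t: "smooth_around ?t x" if "x \<in> \<phi> ` (U \<inter> V)" for x
      by (rule smooth_on_imp_around[OF transition_smooth[OF c(1) d(1)] transition_open[OF c(1) d(1)] that])
    have "smooth_around (\<lambda>z. (?t (fst z), \<Sum>b\<in>Basis. (snd z \<bullet> b) *\<^sub>R frechet_derivative ?t (at (fst z)) b)) z"
      by (intro smooth_around_Pair smooth_around_sum smooth_around_scaleR smooth_around_inner smooth_around_snd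
          smooth_around_const smooth_around_compose[OF t[OF fz] smooth_around_fst]
          smooth_around_compose[OF smooth_around_frechet_derivative[OF t[OF fz]] smooth_around_fst])
    moreover have "eventually (\<lambda>z. (?t (fst z), \<Sum>b\<in>Basis. (snd z \<bullet> b) *\<^sub>R frechet_derivative ?t (at (fst z)) b)
        = (\<psi>' \<circ> inv_into U' \<phi>') z) (nhds z)"
      using eventually_nhds_in_open[OF op z]
    proof eventually_elim
      case (elim w)
      have w: "fst w \<in> \<phi> ` (U \<inter> V)" "snd w \<noteq> 0"
        using elim unfolding im by auto
      then show ?case
        using slit_transition[OF c(1) d(1) w] unfolding c(2,3) d(2,3)
        by (simp add: linear_sum_Basis[OF linear_frechet_derivative[OF smooth_around_differentiable[OF t[OF w(1)]]], symmetric])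
    qed
    ultimately show "smooth_around (\<psi>' \<circ> inv_into U' \<phi>') z"
      by (rule iffD1[OF smooth_around_cong, rotated])
  qed
qed

lemma near_slit:
  assumes u: "u \<in> points (slit A)" and P: "eventually P (near A (fst u))"
  shows "eventually (\<lambda>w. P (fst w)) (near (slit A) u)"
proof -
  interpret N: smooth_atlas "slit A" by (rule smooth_atlas_slit)
  have "fst u \<in> points A"
    using u points_slit by blast
  then obtain U \<phi> where c: "(U, \<phi>) \<in> A" "fst u \<in> U"
    by (rule points_chart)
  then have u': "u \<in> slit_dom A U"
    using u by (auto simp: slit_dom_def points_slit)
  have "(fst \<longlongrightarrow> fst (slit_chart \<phi> u)) (nhds (slit_chart \<phi> u))"
    by (intro tendsto_fst filterlim_ident)
  moreover have "fst (slit_chart \<phi> u) = \<phi> (fst u)"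
    by (simp add: slit_chart_def case_prod_unfold)
  ultimately have "eventually (\<lambda>z. P (inv_into U \<phi> (fst z))) (nhds (slit_chart \<phi> u))"
    using P unfolding eventually_near[OF c] filterlim_iff by auto
  moreover have "eventually (\<lambda>z. z \<in> slit_chart \<phi> ` slit_dom A U) (nhds (slit_chart \<phi> u))"
    using u' by (intro eventually_nhds_in_open N.chart_open[OF slit_mem[OF c(1)]]) auto
  ultimately have "eventually (\<lambda>z. P (fst (inv_into (slit_dom A U) (slit_chart \<phi>) z))) (nhds (slit_chart \<phi> u))"
  proof eventually_elim
    case (elim z)
    then have "fst z \<in> \<phi> ` U" "snd z \<noteq> 0"
      using slit_chart_image[OF c(1), of U] by auto
    from slit_chart_inv[OF c(1) this] elim(1) show ?case
      by simp
  qed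
  then show ?thesis
    unfolding N.eventually_near[OF slit_mem[OF c(1)] u'] .
qed

lemma smooth_at_slit:
  assumes u: "u \<in> points (slit A)" and f: "smooth_at A (fst u) f"
  shows "smooth_at (slit A) u (\<lambda>w. f (fst w))"
proof -
  interpret N: smooth_atlas "slit A" by (rule smooth_atlas_slit)
  have "fst u \<in> points A"
    using u points_slit by blast
  then obtain U \<phi> where c: "(U, \<phi>) \<in> A" "fst u \<in> U"
    by (rule points_chart)
  then have u': "u \<in> slit_dom A U"
    using u by (auto simp: slit_dom_def points_slit)
  have "smooth_around (f \<circ> inv_into U \<phi>) (fst (slit_chart \<phi> u))"
    using f unfolding smooth_at_iff[OF c] by (simp add: slit_chart_def case_prod_unfold)
  from smooth_around_compose[OF this smooth_around_fst]
  have "smooth_at (slit A) u (\<lambda>w. (f \<circ> inv_into U \<phi>) (fst (slit_chart \<phi> w)))"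
    by (rule N.smooth_at_chart[OF slit_mem[OF c(1)] u'])
  moreover have "eventually (\<lambda>w. (f \<circ> inv_into U \<phi>) (fst (slit_chart \<phi> w)) = f (fst w)) (near (slit A) u)"
    using near_slit[OF u eventually_near_chart[OF c]]
    by eventually_elim (use c chart_inv in \<open>simp add: slit_chart_def case_prod_unfold\<close>)
  ultimately show ?thesis
    by (rule N.smooth_at_transfer)
qed

end

section \<open>Vector fields along a map\<close>

text \<open>Sections of the pullback of a tangent bundle. The instance with the bundle projection gives the
  \<pi>-vector fields, the instance with the identity the vector fields of the slit tangent bundle itself.\<close>
locale fields_along_map = N: smooth_atlas N + M: smooth_atlas M
  for N :: "('a, 'd::euclidean_space) atlas" and M :: "('b, 'e::euclidean_space) atlas" +
  fixes h :: "'a \<Rightarrow> 'b"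
  assumes h_points: "p \<in> points N \<Longrightarrow> h p \<in> points M"
    and h_near: "p \<in> points N \<Longrightarrow> eventually P (near M (h p)) \<Longrightarrow> eventually (\<lambda>q. P (h q)) (near N p)"
    and h_smooth: "p \<in> points N \<Longrightarrow> smooth_at M (h p) f \<Longrightarrow> smooth_at N p (\<lambda>q. f (h q))"
begin

abbreviation "F \<equiv> fields_along N M h"

lemma field_tangent: "s \<in> F \<Longrightarrow> p \<in> points N \<Longrightarrow> s p \<in> tangent_space M (h p)"
  and field_smooth: "s \<in> F \<Longrightarrow> p \<in> points N \<Longrightarrow> smooth_at M (h p) f \<Longrightarrow> smooth_at N p (\<lambda>q. s q f)"
  unfolding fields_along_def by blast+

lemma fieldI:
  "(\<And>p. p \<in> points N \<Longrightarrow> s p \<in> tangent_space M (h p)) \<Longrightarrow>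
   (\<And>p f. p \<in> points N \<Longrightarrow> smooth_at M (h p) f \<Longrightarrow> smooth_at N p (\<lambda>q. s q f)) \<Longrightarrow> s \<in> F"
  unfolding fields_along_def by blast

lemma smooth_functionD: "f \<in> smooth_functions N \<Longrightarrow> p \<in> points N \<Longrightarrow> smooth_at N p f"
  unfolding smooth_functions_def by blast

lemma field_add: "s \<in> F \<Longrightarrow> t \<in> F \<Longrightarrow> s + t \<in> F"
  by (rule fieldI)
    (auto intro: subspace_add[OF subspace_tangent_space] field_tangent N.smooth_at_add field_smooth)

lemma field_scale: "f \<in> smooth_functions N \<Longrightarrow> s \<in> F \<Longrightarrow> (\<lambda>p. f p *\<^sub>R s p) \<in> F"
  by (rule fieldI)
    (auto intro: subspace_scale[OF subspace_tangent_space] field_tangent N.smooth_at_mult field_smooth smooth_functionD)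

lemma field_cscale: "s \<in> F \<Longrightarrow> c *\<^sub>R s \<in> F"
  unfolding scaleR_fun_def[of c s]
  by (rule fieldI)
    (auto intro: subspace_scale[OF subspace_tangent_space] field_tangent N.smooth_at_cmult field_smooth)

lemma field_zero: "0 \<in> F"
  by (rule fieldI) (auto intro: subspace_0[OF subspace_tangent_space] N.smooth_at_const)

lemma field_diff: "s \<in> F \<Longrightarrow> t \<in> F \<Longrightarrow> s - t \<in> F"
  using field_add[of s "(- 1) *\<^sub>R t"] field_cscale[of t "- 1"] by simp

lemma field_sum: "(\<And>i. i \<in> I \<Longrightarrow> s i \<in> F) \<Longrightarrow> (\<Sum>i\<in>I. s i) \<in> F"
  by (induction I rule: infinite_finite_induct) (auto intro: field_zero field_add)

text \<open>A field is smooth where its components in a chart are.\<close>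
lemma smooth_local_combination:
  assumes c: "(U, \<phi>) \<in> M" "h p \<in> U" and p: "p \<in> points N"
    and sm: "\<And>b. b \<in> Basis \<Longrightarrow> smooth_at N p (c b)"
    and eq: "eventually (\<lambda>q. s q = (\<Sum>b\<in>Basis. c b q *\<^sub>R coord_vec M U \<phi> (h q) b)) (near N p)"
    and f: "smooth_at M (h p) f"
  shows "smooth_at N p (\<lambda>q. s q f)"
proof (rule N.smooth_at_transfer)
  show "smooth_at N p (\<lambda>q. \<Sum>b\<in>Basis. c b q * coord_vec M U \<phi> (h q) b f)"
    by (intro N.smooth_at_sum p N.smooth_at_mult sm h_smooth[where f = "\<lambda>x. coord_vec M U \<phi> x _ f"] M.smooth_at_coord_vec[OF c f])
  show "eventually (\<lambda>q. (\<Sum>b\<in>Basis. c b q * coord_vec M U \<phi> (h q) b f) = s q f) (near N p)"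
    using eq by eventually_elim (simp add: sum_fun_apply)
qed

text \<open>The multiple \<open>\<kappa> \<partial>\<^sub>y\<close> of a coordinate field, extended by zero.\<close>
definition frame :: "'b set \<Rightarrow> ('b \<Rightarrow> 'e) \<Rightarrow> ('a \<Rightarrow> real) \<Rightarrow> 'e \<Rightarrow> 'a \<Rightarrow> 'b tangent" where
  "frame U \<phi> \<kappa> y q = (if h q \<in> U then \<kappa> q *\<^sub>R coord_vec M U \<phi> (h q) y else 0)"

text \<open>The condition under which the product of \<open>\<kappa>\<close> with a field defined over \<open>U\<close> extends smoothly by
  zero.\<close>
definition cutoff :: "'b set \<Rightarrow> ('a \<Rightarrow> real) \<Rightarrow> bool" where
  "cutoff U \<kappa> \<longleftrightarrow> \<kappa> \<in> smooth_functions N \<and>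
     (\<forall>q\<in>points N. h q \<notin> U \<longrightarrow> eventually (\<lambda>q. \<kappa> q = 0) (near N q))"

lemma frame_field:
  assumes c: "(U, \<phi>) \<in> M" and k: "cutoff U \<kappa>"
  shows "frame U \<phi> \<kappa> y \<in> F"
proof (rule fieldI)
  fix p assume p: "p \<in> points N"
  show "frame U \<phi> \<kappa> y p \<in> tangent_space M (h p)"
    using M.coord_vec_tangent[OF c] subspace_0[OF subspace_tangent_space]
    by (auto simp: frame_def intro: subspace_scale[OF subspace_tangent_space])
  fix f assume f: "smooth_at M (h p) f"
  show "smooth_at N p (\<lambda>q. frame U \<phi> \<kappa> y q f)"
  proof (cases "h p \<in> U")
    case True
    have "smooth_at N p (\<lambda>q. \<kappa> q * coord_vec M U \<phi> (h q) y f)"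
      using k p unfolding cutoff_def
      by (intro N.smooth_at_mult smooth_functionD h_smooth[where f = "\<lambda>x. coord_vec M U \<phi> x _ f"] M.smooth_at_coord_vec[OF c True f]) auto
    then show ?thesis
      by (rule N.smooth_at_transfer)
        (use h_near[OF p M.eventually_near_chart[OF c True]] in \<open>auto elim!: eventually_mono simp: frame_def\<close>)
  next
    case False
    then have "eventually (\<lambda>q. \<kappa> q = 0) (near N p)"
      using k p unfolding cutoff_def by blast
    then show ?thesis
      by (intro N.smooth_at_transfer[OF N.smooth_at_const[OF p, of 0]]) (auto elim!: eventually_mono simp: frame_def)
  qed
qed

lemma cutoff_zero: "cutoff U \<kappa> \<Longrightarrow> q \<in> points N \<Longrightarrow> h q \<notin> U \<Longrightarrow> \<kappa> q = 0"
  unfolding cutoff_def using N.eventually_near_self by blast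

text \<open>A map that is linear over smooth functions only sees the values of its argument at \<open>p\<close>: up to
  the factor \<open>\<kappa>\<^sup>2\<close>, which can be cancelled at \<open>p\<close>, every field is a combination of the fields
  \<open>\<kappa> \<partial>\<^sub>b\<close> with smooth coefficients.\<close>
lemma tensor_expansion:
  fixes T :: "('a \<Rightarrow> 'b tangent) \<Rightarrow> 'v::real_vector"
  assumes add: "\<And>s t. s \<in> F \<Longrightarrow> t \<in> F \<Longrightarrow> T (s + t) = T s + T t"
    and scale: "\<And>f s. f \<in> smooth_functions N \<Longrightarrow> s \<in> F \<Longrightarrow> T (\<lambda>q. f q *\<^sub>R s q) = f p *\<^sub>R T s"
    and c: "(U, \<phi>) \<in> M" "h p \<in> U" and p: "p \<in> points N" and k: "cutoff U \<kappa>" "\<kappa> p \<noteq> 0" and s: "s \<in> F"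
  shows "T s = (\<Sum>b\<in>Basis. (s p (\<lambda>q. \<phi> q \<bullet> b) / \<kappa> p) *\<^sub>R T (frame U \<phi> \<kappa> b))"
proof -
  \<comment> \<open>Outside \<open>N\<close> the values of a section are arbitrary. Vanishing coefficients there make the
    expansion below an identity of functions.\<close>
  define g where "g q = (if q \<in> points N then \<kappa> q * \<kappa> q else 0)" for q
  define f where "f b q = (if q \<in> points N \<and> h q \<in> U then \<kappa> q * s q (\<lambda>q. \<phi> q \<bullet> b) else 0)" for b q
  have ks: "\<kappa> \<in> smooth_functions N"
    using k unfolding cutoff_def by blast
  have g: "g \<in> smooth_functions N"
    unfolding smooth_functions_def
  proof (intro CollectI ballI)
    fix q assume q: "q \<in> points N"
    show "smooth_at N q g"
      by (rule N.smooth_at_transfer[OF N.smooth_at_mult[OF smooth_functionD[OF ks q] smooth_functionD[OF ks q]]])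
        (auto intro: eventually_mono[OF N.eventually_near_points[OF q]] simp: g_def)
  qed
  have f: "f b \<in> smooth_functions N" for b
    unfolding smooth_functions_def
  proof (intro CollectI ballI)
    fix q assume q: "q \<in> points N"
    show "smooth_at N q (f b)"
    proof (cases "h q \<in> U")
      case True
      have "smooth_at N q (\<lambda>q. \<kappa> q * s q (\<lambda>q. \<phi> q \<bullet> b))"
        by (intro N.smooth_at_mult smooth_functionD[OF ks q] field_smooth[OF s q] M.smooth_at_coordinate[OF c(1) True])
      moreover have "eventually (\<lambda>q. \<kappa> q * s q (\<lambda>q. \<phi> q \<bullet> b) = f b q) (near N q)"
        using h_near[OF q M.eventually_near_chart[OF c(1) True]] N.eventually_near_points[OF q]
        by eventually_elim (simp add: f_def)
      ultimately show ?thesis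
        by (rule N.smooth_at_transfer)
    next
      case False
      then have "eventually (\<lambda>q. \<kappa> q = 0) (near N q)"
        using k q unfolding cutoff_def by blast
      then show ?thesis
        by (intro N.smooth_at_transfer[OF N.smooth_at_const[OF q, of 0]]) (auto elim!: eventually_mono simp: f_def)
    qed
  qed
  have eq: "(\<lambda>q. g q *\<^sub>R s q) = (\<Sum>b\<in>Basis. (\<lambda>q. f b q *\<^sub>R frame U \<phi> \<kappa> b q))"
  proof
    fix q
    show "g q *\<^sub>R s q = (\<Sum>b\<in>Basis. (\<lambda>q. f b q *\<^sub>R frame U \<phi> \<kappa> b q)) q"
    proof (cases "q \<in> points N \<and> h q \<in> U")
      case True
      have "g q *\<^sub>R s q = (\<kappa> q * \<kappa> q) *\<^sub>R (\<Sum>b\<in>Basis. s q (\<lambda>q. \<phi> q \<bullet> b) *\<^sub>R coord_vec M U \<phi> (h q) b)"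
        using True M.tangent_expansion[OF c(1) _ field_tangent[OF s, of q]] by (simp add: g_def)
      then show ?thesis
        using True by (simp add: sum_fun_apply f_def frame_def scaleR_sum_right mult_ac)
    next
      case False
      then show ?thesis
        using cutoff_zero[OF k(1), of q] by (auto simp: sum_fun_apply f_def g_def)
    qed
  qed
  have T0: "T 0 = 0"
    using add[OF field_zero field_zero] by simp
  have T_sum: "T (\<Sum>i\<in>I. t i) = (\<Sum>i\<in>I. T (t i))" if "\<And>i. i \<in> I \<Longrightarrow> t i \<in> F" for t and I :: "'e set"
    using that by (induction I rule: infinite_finite_induct) (auto simp: T0 add field_sum)
  have "(\<kappa> p * \<kappa> p) *\<^sub>R T s = T (\<lambda>q. g q *\<^sub>R s q)"
    using scale[OF g s] p by (simp add: g_def)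
  also have "\<dots> = (\<Sum>b\<in>Basis. T (\<lambda>q. f b q *\<^sub>R frame U \<phi> \<kappa> b q))"
    unfolding eq by (intro T_sum field_scale f frame_field[OF c(1) k(1)])
  also have "\<dots> = (\<Sum>b\<in>Basis. (\<kappa> p * s p (\<lambda>q. \<phi> q \<bullet> b)) *\<^sub>R T (frame U \<phi> \<kappa> b))"
    using scale[OF f frame_field[OF c(1) k(1)]] p c by (intro sum.cong) (auto simp: f_def)
  finally have "(\<kappa> p * \<kappa> p) *\<^sub>R T s = \<dots>" .
  then have "inverse (\<kappa> p * \<kappa> p) *\<^sub>R (\<kappa> p * \<kappa> p) *\<^sub>R T s
      = inverse (\<kappa> p * \<kappa> p) *\<^sub>R (\<Sum>b\<in>Basis. (\<kappa> p * s p (\<lambda>q. \<phi> q \<bullet> b)) *\<^sub>R T (frame U \<phi> \<kappa> b))"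
    by simp
  then show ?thesis
    using k(2) by (simp add: scaleR_sum_right field_simps)
qed

end

section \<open>Lie brackets on the slit tangent bundle\<close>

lemma smooth_manifold_atlas: "smooth_manifold A \<Longrightarrow> smooth_atlas A"
  unfolding smooth_manifold_def by unfold_locales fast+

locale slit_manifold =
  fixes M :: "('m, 'e::euclidean_space) atlas"
  assumes manifold: "smooth_manifold M"

sublocale slit_manifold \<subseteq> M: smooth_atlas M
  by (rule smooth_manifold_atlas[OF manifold])

sublocale slit_manifold \<subseteq> N: smooth_atlas "slit M"
  by (rule M.smooth_atlas_slit)

sublocale slit_manifold \<subseteq> pi: fields_along_map "slit M" M fst
  by unfold_locales (auto simp: points_slit intro: M.near_slit M.smooth_at_slit)

sublocale slit_manifold \<subseteq> vf: fields_along_map "slit M" "slit M" "\<lambda>u. u"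
  by unfold_locales auto

context slit_manifold
begin

abbreviation "S \<equiv> points (slit M)"
abbreviation "T \<equiv> tangent_space (slit M)"

lemmas pi_tangent = pi.field_tangent[folded pi_fields_def]
lemmas pi_smooth = pi.field_smooth[folded pi_fields_def]
lemmas pi_add = pi.field_add[folded pi_fields_def]
lemmas pi_scale = pi.field_scale[folded pi_fields_def]
lemmas pi_cscale = pi.field_cscale[folded pi_fields_def]
lemmas pi_diff = pi.field_diff[folded pi_fields_def]
lemmas pi_sum = pi.field_sum[folded pi_fields_def]
lemmas pi_frame = pi.frame_field[folded pi_fields_def]
lemmas pi_expansion = pi.tensor_expansion[folded pi_fields_def]
lemmas vf_tangent = vf.field_tangent[folded vector_fields_def]
lemmas vf_smooth = vf.field_smooth[folded vector_fields_def]
lemmas vf_frame = vf.frame_field[folded vector_fields_def]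
lemmas vfI = vf.fieldI[folded vector_fields_def]

lemma bracket_apply:
  "lie_bracket (slit M) X Y u f = (if smooth_at (slit M) u f then X u (\<lambda>q. Y q f) - Y u (\<lambda>q. X q f) else 0)"
  by (simp add: lie_bracket_def)

text \<open>The terms of the Leibniz rule with one derivative on each factor are symmetric in \<open>X\<close> and \<open>Y\<close>
  and cancel in the commutator.\<close>
lemma bracket_tangent:
  assumes X: "X \<in> vector_fields (slit M)" and Y: "Y \<in> vector_fields (slit M)" and u: "u \<in> S"
  shows "lie_bracket (slit M) X Y u \<in> T u"
proof -
  note tX = vf_tangent[OF X u] and tY = vf_tangent[OF Y u]
  have add: "Z u (\<lambda>q. W q (\<lambda>q. f q + g q)) = Z u (\<lambda>q. W q f) + Z u (\<lambda>q. W q g)"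
    if Z: "Z \<in> vector_fields (slit M)" and W: "W \<in> vector_fields (slit M)"
      and f: "smooth_at (slit M) u f" and g: "smooth_at (slit M) u g" for Z W f g
  proof -
    have "eventually (\<lambda>q. W q (\<lambda>q. f q + g q) = W q f + W q g) (near (slit M) u)"
      using N.smooth_at_eventually[OF f] N.smooth_at_eventually[OF g] N.eventually_near_points[OF u]
      by eventually_elim (rule tangent_add[OF vf_tangent[OF W]])
    from N.tangent_local[OF vf_tangent[OF Z u] u this]
    show ?thesis
      using tangent_add[OF vf_tangent[OF Z u] vf_smooth[OF W u f] vf_smooth[OF W u g]] by simp
  qed
  have cmult: "Z u (\<lambda>q. W q (\<lambda>q. c * f q)) = c * Z u (\<lambda>q. W q f)"
    if Z: "Z \<in> vector_fields (slit M)" and W: "W \<in> vector_fields (slit M)"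
      and f: "smooth_at (slit M) u f" for Z W f c
  proof -
    have "eventually (\<lambda>q. W q (\<lambda>q. c * f q) = c * W q f) (near (slit M) u)"
      using N.smooth_at_eventually[OF f] N.eventually_near_points[OF u]
      by eventually_elim (rule tangent_scale[OF vf_tangent[OF W]])
    from N.tangent_local[OF vf_tangent[OF Z u] u this]
    show ?thesis
      using tangent_scale[OF vf_tangent[OF Z u] vf_smooth[OF W u f]] by simp
  qed
  have mult: "Z u (\<lambda>q. W q (\<lambda>q. f q * g q))
      = f u * Z u (\<lambda>q. W q g) + W u g * Z u f + (g u * Z u (\<lambda>q. W q f) + W u f * Z u g)"
    if Z: "Z \<in> vector_fields (slit M)" and W: "W \<in> vector_fields (slit M)"
      and f: "smooth_at (slit M) u f" and g: "smooth_at (slit M) u g" for Z W f g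
  proof -
    have "eventually (\<lambda>q. W q (\<lambda>q. f q * g q) = f q * W q g + g q * W q f) (near (slit M) u)"
      using N.smooth_at_eventually[OF f] N.smooth_at_eventually[OF g] N.eventually_near_points[OF u]
      by eventually_elim (rule tangent_mult[OF vf_tangent[OF W]])
    from N.tangent_local[OF vf_tangent[OF Z u] u this]
    have "Z u (\<lambda>q. W q (\<lambda>q. f q * g q)) = Z u (\<lambda>q. f q * W q g + g q * W q f)" .
    also have "\<dots> = Z u (\<lambda>q. f q * W q g) + Z u (\<lambda>q. g q * W q f)"
      by (rule tangent_add[OF vf_tangent[OF Z u] N.smooth_at_mult[OF f vf_smooth[OF W u g]]
            N.smooth_at_mult[OF g vf_smooth[OF W u f]]])
    finally show ?thesis
      using tangent_mult[OF vf_tangent[OF Z u] f vf_smooth[OF W u g]]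
        tangent_mult[OF vf_tangent[OF Z u] g vf_smooth[OF W u f]] by simp
  qed
  show ?thesis
    unfolding tangent_space_def mem_Collect_eq
  proof (intro conjI allI impI)
    fix f g c assume f: "smooth_at (slit M) u f"
    show "lie_bracket (slit M) X Y u (\<lambda>q. c * f q) = c * lie_bracket (slit M) X Y u f"
      using cmult[OF X Y f] cmult[OF Y X f] N.smooth_at_cmult[OF f] f
      by (simp add: bracket_apply right_diff_distrib)
    assume g: "smooth_at (slit M) u g"
    show "lie_bracket (slit M) X Y u (\<lambda>q. f q + g q) = lie_bracket (slit M) X Y u f + lie_bracket (slit M) X Y u g"
      using add[OF X Y f g] add[OF Y X f g] N.smooth_at_add[OF f g] f g by (simp add: bracket_apply)
    show "lie_bracket (slit M) X Y u (\<lambda>q. f q * g q)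
        = f u * lie_bracket (slit M) X Y u g + g u * lie_bracket (slit M) X Y u f"
      using mult[OF X Y f g] mult[OF Y X f g] N.smooth_at_mult[OF f g] f g
      by (simp add: bracket_apply algebra_simps)
  qed (simp add: bracket_apply)
qed

lemma bracket_vf:
  assumes X: "X \<in> vector_fields (slit M)" and Y: "Y \<in> vector_fields (slit M)"
  shows "lie_bracket (slit M) X Y \<in> vector_fields (slit M)"
proof (rule vfI)
  fix u f assume u: "u \<in> S" and f: "smooth_at (slit M) u f"
  show "smooth_at (slit M) u (\<lambda>q. lie_bracket (slit M) X Y q f)"
    by (rule N.smooth_at_transfer[OF N.smooth_at_diff[OF vf_smooth[OF X u vf_smooth[OF Y u f]]
            vf_smooth[OF Y u vf_smooth[OF X u f]]]])
      (use N.smooth_at_eventually[OF f] in \<open>auto elim!: eventually_mono simp: bracket_apply\<close>)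
qed (rule bracket_tangent[OF X Y])

lemma bracket_cong:
  assumes X: "X \<in> vector_fields (slit M)" and u: "u \<in> S" and eq: "\<And>q. q \<in> S \<Longrightarrow> Y q = Z q"
  shows "lie_bracket (slit M) X Y u = lie_bracket (slit M) X Z u"
proof
  fix f
  have "eventually (\<lambda>q. Y q f = Z q f) (near (slit M) u)"
    using N.eventually_near_points[OF u] by eventually_elim (simp add: eq)
  from N.tangent_local[OF vf_tangent[OF X u] u this]
  show "lie_bracket (slit M) X Y u f = lie_bracket (slit M) X Z u f"
    using eq[OF u] by (simp add: bracket_apply)
qed

lemma bracket_add:
  assumes X: "X \<in> vector_fields (slit M)" and Y: "Y \<in> vector_fields (slit M)"
    and Z: "Z \<in> vector_fields (slit M)" and u: "u \<in> S"
  shows "lie_bracket (slit M) X (\<lambda>q. Y q + Z q) u = lie_bracket (slit M) X Y u + lie_bracket (slit M) X Z u"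
proof
  fix f
  show "lie_bracket (slit M) X (\<lambda>q. Y q + Z q) u f = (lie_bracket (slit M) X Y u + lie_bracket (slit M) X Z u) f"
    using tangent_add[OF vf_tangent[OF X u] vf_smooth[OF Y u] vf_smooth[OF Z u]]
    by (simp add: bracket_apply)
qed

lemma bracket_scale:
  assumes X: "X \<in> vector_fields (slit M)" and Y: "Y \<in> vector_fields (slit M)"
    and g: "g \<in> smooth_functions (slit M)" and u: "u \<in> S"
  shows "lie_bracket (slit M) X (\<lambda>q. g q *\<^sub>R Y q) u = X u g *\<^sub>R Y u + g u *\<^sub>R lie_bracket (slit M) X Y u"
proof
  fix f
  show "lie_bracket (slit M) X (\<lambda>q. g q *\<^sub>R Y q) u f = (X u g *\<^sub>R Y u + g u *\<^sub>R lie_bracket (slit M) X Y u) f"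
    using tangent_mult[OF vf_tangent[OF X u] vf.smooth_functionD[OF g u] vf_smooth[OF Y u]]
      tangent_not_smooth[OF vf_tangent[OF Y u]]
    by (simp add: bracket_apply algebra_simps)
qed

section \<open>Local frames, extension of vectors, and the projection\<close>

text \<open>One bump function on the base localises both \<pi>-vector fields and vector fields on the slit tangent
  bundle, since the induced charts lie over the charts of the base.\<close>
lemma cutoff_exists:
  assumes c: "(U, \<phi>) \<in> M" "p \<in> U"
  obtains \<kappa> where "\<kappa> p \<noteq> (0::real)" "pi.cutoff U (\<lambda>u. \<kappa> (fst u))"
    "vf.cutoff (slit_dom M U) (\<lambda>u. \<kappa> (fst u))"
proof -
  have "Hausdorff_space (manifold_topology M)"
    using manifold unfolding smooth_manifold_def by blast
  then obtain \<kappa> where k: "\<kappa> \<in> smooth_functions M" "\<kappa> p \<noteq> 0"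
    "\<And>q. q \<in> points M - U \<Longrightarrow> eventually (\<lambda>q. \<kappa> q = 0) (near M q)"
    using M.manifold_bump[OF _ c] by blast
  have "(\<lambda>u. \<kappa> (fst u)) \<in> smooth_functions (slit M)"
    using k(1) M.smooth_at_slit unfolding smooth_functions_def by (auto simp: points_slit)
  moreover have "eventually (\<lambda>q. \<kappa> (fst q) = 0) (near (slit M) u)" if "u \<in> S" "fst u \<notin> U" for u
    using that by (intro M.near_slit[where P = "\<lambda>q. \<kappa> q = 0"] k(3)) (auto simp: points_slit)
  moreover have "fst u \<notin> U" if "u \<in> S" "u \<notin> slit_dom M U" for u
    using that by (auto simp: points_slit slit_dom_def)
  ultimately show ?thesis
    using that[of \<kappa>] k(2) unfolding pi.cutoff_def vf.cutoff_def by blast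
qed

lemma slit_dom_mem: "u \<in> S \<Longrightarrow> fst u \<in> U \<Longrightarrow> u \<in> slit_dom M U"
  by (auto simp: slit_dom_def points_slit)

text \<open>A combination of the frame fields with constant coefficients takes the prescribed value. This
  supplies the test fields for statements about single vectors, such as nondegeneracy of the metric.\<close>
lemma pi_extend:
  assumes u: "u \<in> S" and v: "v \<in> tangent_space M (fst u)"
  obtains Z where "Z \<in> pi_fields M" "Z u = v"
proof -
  obtain U \<phi> where c: "(U, \<phi>) \<in> M" "fst u \<in> U"
    using M.points_chart[of "fst u"] u points_slit by blast
  obtain \<kappa> where k: "\<kappa> (fst u) \<noteq> 0" "pi.cutoff U (\<lambda>u. \<kappa> (fst u))"
    using cutoff_exists[OF c] by blast
  let ?E = "pi.frame U \<phi> (\<lambda>u. \<kappa> (fst u))"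
  have "(\<Sum>b\<in>Basis. (v (\<lambda>q. \<phi> q \<bullet> b) / \<kappa> (fst u)) *\<^sub>R ?E b) u
      = (\<Sum>b\<in>Basis. v (\<lambda>q. \<phi> q \<bullet> b) *\<^sub>R coord_vec M U \<phi> (fst u) b)"
    unfolding sum_fun_apply[where x = u] using k c by (intro sum.cong) (auto simp: scaleR_fun_def[of _ "?E _"] pi.frame_def)
  also have "\<dots> = v"
    by (rule M.tangent_expansion[OF c v, symmetric])
  finally show ?thesis
    by (intro that[OF pi_sum[OF pi_cscale[OF pi_frame[OF c(1) k(2)]]]])
qed

text \<open>The components of the fundamental field are the fibre coordinates of the induced chart.\<close>
lemma eta_pi: "fundamental_field \<in> pi_fields M"
  unfolding pi_fields_def
proof (rule pi.fieldI)
  fix u assume u: "u \<in> S"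
  then show "fundamental_field u \<in> tangent_space M (fst u)"
    by (simp add: fundamental_field_def points_slit)
  obtain U \<phi> where c: "(U, \<phi>) \<in> M" "fst u \<in> U"
    using M.points_chart[of "fst u"] u points_slit by blast
  fix f assume f: "smooth_at M (fst u) f"
  show "smooth_at (slit M) u (\<lambda>w. fundamental_field w f)"
  proof (rule pi.smooth_local_combination[OF c u _ _ f])
    fix b :: 'e
    show "smooth_at (slit M) u (\<lambda>w. snd (slit_chart \<phi> w) \<bullet> b)"
      by (rule N.smooth_at_chart[OF slit_mem[OF c(1)] slit_dom_mem[OF u c(2)]])
        (intro smooth_around_inner smooth_around_snd smooth_around_const)
  next
    show "eventually (\<lambda>w. fundamental_field w
        = (\<Sum>b\<in>Basis. (snd (slit_chart \<phi> w) \<bullet> b) *\<^sub>R coord_vec M U \<phi> (fst w) b)) (near (slit M) u)"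
      using N.eventually_near_chart[OF slit_mem[OF c(1)] slit_dom_mem[OF u c(2)]]
    proof eventually_elim
      case (elim w)
      then have w: "fst w \<in> U" "snd w \<in> tangent_space M (fst w)"
        by (auto simp: slit_dom_def)
      show ?case
        using M.tangent_expansion[OF c(1) w]
        by (simp add: fundamental_field_def slit_chart_def case_prod_unfold coords_inner)
    qed
  qed
qed

lemma rho_apply: "rho M u X f = (if smooth_at M (fst u) f then X (\<lambda>q. f (fst q)) else 0)"
  by (simp add: rho_def differential_def)

lemma rho_linear: "rho M u (X + Y) = rho M u X + rho M u Y" "rho M u (c *\<^sub>R X) = c *\<^sub>R rho M u X"
  by (auto simp: fun_eq_iff rho_apply)

lemma rho_tangent:
  assumes u: "u \<in> S" and X: "X \<in> T u"
  shows "rho M u X \<in> tangent_space M (fst u)"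
  unfolding tangent_space_def mem_Collect_eq
  using M.smooth_at_add M.smooth_at_cmult M.smooth_at_mult
    tangent_add[OF X M.smooth_at_slit[OF u] M.smooth_at_slit[OF u]]
    tangent_mult[OF X M.smooth_at_slit[OF u] M.smooth_at_slit[OF u]]
    tangent_scale[OF X M.smooth_at_slit[OF u]]
  by (simp add: rho_apply)

text \<open>A preimage is the coordinate vector with the given base components and vanishing fibre
  components.\<close>
lemma rho_surj:
  assumes u: "u \<in> S" and v: "v \<in> tangent_space M (fst u)"
  obtains X where "X \<in> T u" "rho M u X = v"
proof -
  obtain U \<phi> where c: "(U, \<phi>) \<in> M" "fst u \<in> U"
    using M.points_chart[of "fst u"] u points_slit by blast
  note c' = slit_mem[OF c(1)] slit_dom_mem[OF u c(2)]
  define X where "X = coord_vec (slit M) (slit_dom M U) (slit_chart \<phi>) u (coords \<phi> v, 0)"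
  have X: "X \<in> T u"
    unfolding X_def by (rule N.coord_vec_tangent[OF c'])
  have "rho M u X = v"
  proof (rule M.tangent_eqI[OF c rho_tangent[OF u X] v])
    fix b :: 'e assume b: "b \<in> Basis"
    have bl: "bounded_linear (\<lambda>z::'e \<times> 'e. fst z \<bullet> b)"
      by (intro bounded_linear_inner_left_comp bounded_linear_fst)
    have "X (\<lambda>q. fst (slit_chart \<phi> q) \<bullet> b)
        = frechet_derivative (\<lambda>z. fst z \<bullet> b) (at (slit_chart \<phi> u)) (coords \<phi> v, 0)"
      unfolding X_def by (rule N.coord_vec_chart[OF c' smooth_around_bounded_linear[OF bl]])
    also have "\<dots> = coords \<phi> v \<bullet> b"
      using frechet_derivative_at[OF bounded_linear_imp_has_derivative[OF bl], of "slit_chart \<phi> u"]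
      by (metis fst_conv)
    finally show "rho M u X (\<lambda>q. \<phi> q \<bullet> b) = v (\<lambda>q. \<phi> q \<bullet> b)"
      using b M.smooth_at_coordinate[OF c]
      by (simp add: rho_apply coords_inner slit_chart_def case_prod_unfold)
  qed
  with X show ?thesis
    by (rule that)
qed

end

section \<open>Horizontal lifts\<close>

locale regular_pi_connection = slit_manifold M for M :: "('m, 'e::euclidean_space) atlas" +
  fixes D :: "'m connection"
  assumes regular: "regular_connection M D"
begin

lemma D_add_dir: "u \<in> S \<Longrightarrow> s \<in> pi_fields M \<Longrightarrow> X \<in> T u \<Longrightarrow> Y \<in> T u \<Longrightarrow> D u (X + Y) s = D u X s + D u Y s"
  and D_scale_dir: "u \<in> S \<Longrightarrow> s \<in> pi_fields M \<Longrightarrow> X \<in> T u \<Longrightarrow> D u (c *\<^sub>R X) s = c *\<^sub>R D u X s"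
  and D_add: "u \<in> S \<Longrightarrow> X \<in> T u \<Longrightarrow> s \<in> pi_fields M \<Longrightarrow> t \<in> pi_fields M \<Longrightarrow> D u X (s + t) = D u X s + D u X t"
  and D_leibniz: "u \<in> S \<Longrightarrow> X \<in> T u \<Longrightarrow> f \<in> smooth_functions (slit M) \<Longrightarrow> s \<in> pi_fields M \<Longrightarrow>
     D u X (\<lambda>w. f w *\<^sub>R s w) = X f *\<^sub>R s u + f u *\<^sub>R D u X s"
  and cov_pi: "Z \<in> vector_fields (slit M) \<Longrightarrow> s \<in> pi_fields M \<Longrightarrow> cov D Z s \<in> pi_fields M"
  using regular unfolding regular_connection_def linear_connection_def by blast+

lemma smooth_function_const: "(\<lambda>w. c) \<in> smooth_functions (slit M)"
  unfolding smooth_functions_def using N.smooth_at_const by blast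

lemma D_cscale:
  assumes "u \<in> S" "X \<in> T u" "s \<in> pi_fields M"
  shows "D u X (c *\<^sub>R s) = c *\<^sub>R D u X s"
  using D_leibniz[OF assms(1,2) smooth_function_const assms(3), of c] N.tangent_const[OF assms(2,1)]
  unfolding scaleR_fun_def[of c s] by simp

lemma D_diff:
  assumes "u \<in> S" "X \<in> T u" "s \<in> pi_fields M" "t \<in> pi_fields M"
  shows "D u X (s - t) = D u X s - D u X t"
  using D_add[OF assms(1,2,3) pi_cscale[OF assms(4), of "- 1"]] D_cscale[OF assms(1,2,4), of "- 1"] by simp

lemma D_sum_dir:
  assumes "u \<in> S" "s \<in> pi_fields M" "\<And>i. i \<in> I \<Longrightarrow> X i \<in> T u"
  shows "D u (\<Sum>i\<in>I. c i *\<^sub>R X i) s = (\<Sum>i\<in>I. c i *\<^sub>R D u (X i) s)"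
  using assms(3)
proof (induction I rule: infinite_finite_induct)
  case (insert i I)
  have "D u (c i *\<^sub>R X i + (\<Sum>i\<in>I. c i *\<^sub>R X i)) s = D u (c i *\<^sub>R X i) s + D u (\<Sum>i\<in>I. c i *\<^sub>R X i) s"
    using insert.prems by (intro D_add_dir assms(1,2) subspace_sum subspace_scale subspace_tangent_space) auto
  moreover have "D u (c i *\<^sub>R X i) s = c i *\<^sub>R D u (X i) s"
    using insert.prems by (intro D_scale_dir assms(1,2)) auto
  moreover have "D u (\<Sum>i\<in>I. c i *\<^sub>R X i) s = (\<Sum>i\<in>I. c i *\<^sub>R D u (X i) s)"
    using insert.prems by (intro insert.IH) auto
  ultimately show ?case
    by (simp only: sum.insert[OF insert.hyps])
qed (use D_scale_dir[OF assms(1,2) subspace_0[OF subspace_tangent_space], of 0] in auto)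

text \<open>The covariant derivative only sees a section over the slit tangent bundle: the difference of two
  sections that agree there is its own product with an indicator function that is zero, hence smooth,
  on this bundle.\<close>
lemma D_cong:
  assumes u: "u \<in> S" and X: "X \<in> T u" and s: "s \<in> pi_fields M" and t: "t \<in> pi_fields M"
    and eq: "\<And>w. w \<in> S \<Longrightarrow> s w = t w"
  shows "D u X s = D u X t"
proof -
  define f where "f w = (if w \<in> S then 0 else 1 :: real)" for w
  have "f \<in> smooth_functions (slit M)"
    unfolding smooth_functions_def
  proof (intro CollectI ballI)
    fix w assume w: "w \<in> S"
    show "smooth_at (slit M) w f"
      by (rule N.smooth_at_transfer[OF N.smooth_at_const[OF w, of 0]])
        (auto intro: eventually_mono[OF N.eventually_near_points[OF w]] simp: f_def)
  qed
  from D_leibniz[OF u X this pi_diff[OF s t]]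
  have "D u X (\<lambda>w. f w *\<^sub>R (s - t) w) = 0"
    using eq[OF u] u by (simp add: f_def)
  moreover have "(\<lambda>w. f w *\<^sub>R (s - t) w) = s - t"
    by (auto simp: f_def eq)
  ultimately show ?thesis
    using D_diff[OF u X s t] by simp
qed

lemma horizontal_eq_0:
  assumes "u \<in> S" "X \<in> T u" "D u X fundamental_field = 0" "rho M u X = 0"
  shows "X = 0"
  using assms regular unfolding regular_connection_def vertical_space_def horizontal_space_def by blast

text \<open>By regularity a preimage under the projection splits into a vertical and a horizontal part; the
  projection kills the vertical one, so the horizontal part is again a preimage.\<close>
lemma hmap:
  assumes u: "u \<in> S" and v: "v \<in> tangent_space M (fst u)"
  shows "horizontal_map M D u v \<in> T u" "D u (horizontal_map M D u v) fundamental_field = 0"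
    "rho M u (horizontal_map M D u v) = v"
proof -
  obtain X where X: "X \<in> T u" "rho M u X = v"
    using rho_surj[OF u v] by blast
  then obtain Y H where "X = Y + H" "Y \<in> vertical_space M u" and H: "H \<in> horizontal_space M D u"
    using regular u unfolding regular_connection_def by blast
  then have "rho M u H = v"
    using X(2) rho_linear(1)[of u Y H] unfolding vertical_space_def by simp
  then have v': "v \<in> rho M u ` horizontal_space M D u"
    using H by blast
  show "rho M u (horizontal_map M D u v) = v"
    unfolding horizontal_map_def by (rule f_inv_into_f[OF v'])
  have "horizontal_map M D u v \<in> horizontal_space M D u"
    unfolding horizontal_map_def by (rule inv_into_into[OF v'])
  then show "horizontal_map M D u v \<in> T u" "D u (horizontal_map M D u v) fundamental_field = 0"
    unfolding horizontal_space_def by auto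
qed

lemma hmap_unique:
  assumes u: "u \<in> S" and X: "X \<in> T u" "D u X fundamental_field = 0"
  shows "horizontal_map M D u (rho M u X) = X"
proof -
  let ?h = "horizontal_map M D u (rho M u X)"
  note h = hmap[OF u rho_tangent[OF u X(1)]]
  have "X + (- 1) *\<^sub>R ?h = 0"
  proof (rule horizontal_eq_0[OF u])
    show "X + (- 1) *\<^sub>R ?h \<in> T u"
      by (intro subspace_add[OF subspace_tangent_space] subspace_scale[OF subspace_tangent_space] X h)
    show "D u (X + (- 1) *\<^sub>R ?h) fundamental_field = 0"
      using D_add_dir[OF u eta_pi X(1) subspace_scale[OF subspace_tangent_space h(1)], of "- 1"]
        D_scale_dir[OF u eta_pi h(1), of "- 1"] X(2) h(2) by simp
    show "rho M u (X + (- 1) *\<^sub>R ?h) = 0"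
      using h(3) by (simp only: rho_linear) simp
  qed
  then show ?thesis by simp
qed

lemma hmap_add:
  assumes u: "u \<in> S" and v: "v \<in> tangent_space M (fst u)" "w \<in> tangent_space M (fst u)"
  shows "horizontal_map M D u (v + w) = horizontal_map M D u v + horizontal_map M D u w"
  using hmap_unique[OF u subspace_add[OF subspace_tangent_space hmap(1)[OF u v(1)] hmap(1)[OF u v(2)]]]
    D_add_dir[OF u eta_pi hmap(1)[OF u v(1)] hmap(1)[OF u v(2)]] hmap[OF u v(1)] hmap[OF u v(2)]
  by (simp add: rho_linear)

lemma hmap_scale:
  assumes u: "u \<in> S" and v: "v \<in> tangent_space M (fst u)"
  shows "horizontal_map M D u (c *\<^sub>R v) = c *\<^sub>R horizontal_map M D u v"
  using hmap_unique[OF u subspace_scale[OF subspace_tangent_space hmap(1)[OF u v]]]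
    D_scale_dir[OF u eta_pi hmap(1)[OF u v]] hmap[OF u v]
  by (simp add: rho_linear)

text \<open>In local coordinates the horizontal lift is the solution of a linear system, made of the
  equations that define horizontal vectors and of those that fix the projection. Regularity of the
  connection says that the system is injective.\<close>
lemma hlift_vf:
  assumes s: "s \<in> pi_fields M"
  shows "hlift M D s \<in> vector_fields (slit M)"
proof (rule vfI)
  fix u assume u: "u \<in> S"
  show "hlift M D s u \<in> T u"
    unfolding hlift_def by (rule hmap(1)[OF u pi_tangent[OF s u]])
  fix f assume f: "smooth_at (slit M) u f"
  obtain U \<phi> where c: "(U, \<phi>) \<in> M" "fst u \<in> U"
    using M.points_chart[of "fst u"] u points_slit by blast
  obtain \<kappa> where k: "\<kappa> (fst u) \<noteq> 0" "vf.cutoff (slit_dom M U) (\<lambda>u. \<kappa> (fst u))"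
    using cutoff_exists[OF c] by blast
  note c' = slit_mem[OF c(1)] slit_dom_mem[OF u c(2)]
  define E where "E = vf.frame (slit_dom M U) (slit_chart \<phi>) (\<lambda>u. \<kappa> (fst u))"
  have E: "E a \<in> vector_fields (slit M)" for a
    unfolding E_def by (rule vf_frame[OF c'(1) k(2)])
  define x where "x b = (\<lambda>q. \<phi> q \<bullet> b)" for b
  define C where "C a w = hlift M D s w (\<lambda>q. slit_chart \<phi> q \<bullet> a)" for a w
  \<comment> \<open>The rows \<open>Inl b\<close> say that the vector is horizontal, the rows \<open>Inr b\<close> that it projects to \<open>s\<close>.
    The unknowns are its components \<open>C\<close> in the induced chart.\<close>
  define A :: "'e + 'e \<Rightarrow> 'e \<times> 'e \<Rightarrow> 'm tvec \<Rightarrow> real" where "A i a w = (case i of Inl b \<Rightarrow> cov D (E a) fundamental_field w (x b)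
    | Inr b \<Rightarrow> E a w (\<lambda>q. x b (fst q)))" for i a w
  define r :: "'e + 'e \<Rightarrow> 'm tvec \<Rightarrow> real" where "r i w = (case i of Inl b \<Rightarrow> 0 | Inr b \<Rightarrow> \<kappa> (fst w) * s w (x b))" for i w
  have sx: "smooth_at M (fst u) (x b)" for b
    unfolding x_def by (rule M.smooth_at_coordinate[OF c])
  have ks: "smooth_at (slit M) u (\<lambda>w. \<kappa> (fst w))"
    using k(2) u unfolding vf.cutoff_def smooth_functions_def by blast
  have E_expand: "\<kappa> (fst w) *\<^sub>R X = (\<Sum>a\<in>Basis. X (\<lambda>q. slit_chart \<phi> q \<bullet> a) *\<^sub>R E a w)"
    if "w \<in> slit_dom M U" "X \<in> T w" for w X
    using that unfolding E_def vf.frame_def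
    by (subst N.tangent_expansion[OF c'(1) that]) (simp add: scaleR_sum_right mult_ac)
  have "\<forall>a\<in>Basis. smooth_at (slit M) u (C a)"
  proof (rule N.smooth_at_linear_system[OF u finite_Basis, of "UNIV" A r])
    show "smooth_at (slit M) u (A i a)" for i a
      using pi_smooth[OF cov_pi[OF E eta_pi] u sx] vf_smooth[OF E u M.smooth_at_slit[OF u sx]]
      by (cases i) (auto simp: A_def[abs_def])
    show "smooth_at (slit M) u (r i)" for i
      using N.smooth_at_const[OF u, of 0] N.smooth_at_mult[OF ks pi_smooth[OF s u sx]]
      by (cases i) (auto simp: r_def[abs_def])
    show "eventually (\<lambda>w. (\<Sum>a\<in>Basis. A i a w * C a w) = r i w) (near (slit M) u)" for i
      using N.eventually_near_chart[OF c'] N.eventually_near_points[OF u]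
    proof eventually_elim
      case (elim w)
      let ?X = "hlift M D s w"
      have h: "?X \<in> T w" "D w ?X fundamental_field = 0" "rho M w ?X = s w"
        unfolding hlift_def by (rule hmap[OF elim(2) pi_tangent[OF s elim(2)]])+
      have e: "\<kappa> (fst w) *\<^sub>R ?X = (\<Sum>a\<in>Basis. C a w *\<^sub>R E a w)"
        unfolding C_def by (rule E_expand[OF elim(1) h(1)])
      show ?case
      proof (cases i)
        case (Inl b)
        have "(\<Sum>a\<in>Basis. C a w *\<^sub>R D w (E a w) fundamental_field) = D w (\<Sum>a\<in>Basis. C a w *\<^sub>R E a w) fundamental_field"
          by (rule D_sum_dir[OF elim(2) eta_pi vf_tangent[OF E elim(2)], symmetric])
        also have "\<dots> = 0"
          unfolding e[symmetric] using D_scale_dir[OF elim(2) eta_pi h(1)] h(2) by simp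
        finally have "(\<Sum>a\<in>Basis. C a w *\<^sub>R D w (E a w) fundamental_field) (x b) = 0"
          by simp
        then show ?thesis
          unfolding sum_fun_apply by (simp add: Inl A_def r_def cov_def mult.commute)
      next
        case (Inr b)
        have "(\<Sum>a\<in>Basis. C a w *\<^sub>R E a w) (\<lambda>q. x b (fst q)) = \<kappa> (fst w) * rho M w ?X (x b)"
          unfolding e[symmetric] using M.smooth_at_coordinate[OF c(1), of "fst w" b] elim(1)
          by (auto simp: rho_apply x_def slit_dom_def)
        then show ?thesis
          unfolding sum_fun_apply h(3) by (simp add: Inr A_def r_def mult.commute)
      qed
    qed
    fix d assume d: "\<And>i. i \<in> UNIV \<Longrightarrow> (\<Sum>a\<in>Basis. A i a u * d a) = 0"
    \<comment> \<open>A solution of the homogeneous system is the component vector of a vector that is both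
      horizontal and vertical.\<close>
    define X where "X = (\<Sum>a\<in>Basis. d a *\<^sub>R E a u)"
    have X: "X \<in> T u"
      unfolding X_def
      by (intro subspace_sum[OF subspace_tangent_space] subspace_scale[OF subspace_tangent_space] vf_tangent[OF E u])
    have DX: "D u X fundamental_field = (\<Sum>a\<in>Basis. d a *\<^sub>R cov D (E a) fundamental_field u)"
      unfolding X_def cov_def by (rule D_sum_dir[OF u eta_pi vf_tangent[OF E u]])
    have "X = 0"
    proof (rule horizontal_eq_0[OF u X])
      show "D u X fundamental_field = 0"
      proof (rule M.tangent_eqI[OF c])
        show "D u X fundamental_field \<in> tangent_space M (fst u)"
          unfolding DX
          by (intro subspace_sum[OF subspace_tangent_space] subspace_scale[OF subspace_tangent_space]
              pi_tangent[OF cov_pi[OF E eta_pi] u])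
        show "0 \<in> tangent_space M (fst u)"
          by (rule subspace_0[OF subspace_tangent_space])
        show "D u X fundamental_field (\<lambda>q. \<phi> q \<bullet> b) = 0 (\<lambda>q. \<phi> q \<bullet> b)" for b
          using d[of "Inl b"] unfolding DX sum_fun_apply by (simp add: A_def x_def mult.commute)
      qed
      show "rho M u X = 0"
      proof (rule M.tangent_eqI[OF c rho_tangent[OF u X]])
        show "0 \<in> tangent_space M (fst u)"
          by (rule subspace_0[OF subspace_tangent_space])
        show "rho M u X (\<lambda>q. \<phi> q \<bullet> b) = 0 (\<lambda>q. \<phi> q \<bullet> b)" for b
          using d[of "Inr b"] sx[of b] unfolding rho_apply X_def sum_fun_apply
          by (simp add: A_def x_def mult.commute)
      qed
    qed
    moreover have "X = \<kappa> (fst u) *\<^sub>R coord_vec (slit M) (slit_dom M U) (slit_chart \<phi>) u (\<Sum>a\<in>Basis. d a *\<^sub>R a)"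
      unfolding X_def E_def vf.frame_def using c'(2)
      by (simp add: linear_sum[OF N.linear_coord_vec[OF c']] linear_cmul[OF N.linear_coord_vec[OF c']]
          scaleR_sum_right mult_ac)
    ultimately have "coord_vec (slit M) (slit_dom M U) (slit_chart \<phi>) u (\<Sum>a\<in>Basis. d a *\<^sub>R a) = 0"
      using k(1) by simp
    then have "(\<Sum>a\<in>Basis. d a *\<^sub>R a) = coords (slit_chart \<phi>) 0"
      using N.coords_coord_vec[OF c'] by metis
    then have "(\<Sum>a\<in>Basis. d a *\<^sub>R a) = (0 :: 'e \<times> 'e)"
      by (simp add: coords_def)
    then show "\<forall>a\<in>Basis. d a = 0"
      using inner_sum_left_Basis[of _ d] by (metis inner_zero_left)
  qed
  then have C: "smooth_at (slit M) u (C a)" if "a \<in> Basis" for a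
    using that by blast
  show "smooth_at (slit M) u (\<lambda>q. hlift M D s q f)"
  proof (rule vf.smooth_local_combination[OF c' u C _ f])
    show "eventually (\<lambda>q. hlift M D s q
        = (\<Sum>a\<in>Basis. C a q *\<^sub>R coord_vec (slit M) (slit_dom M U) (slit_chart \<phi>) q a)) (near (slit M) u)"
      using N.eventually_near_chart[OF c'] N.eventually_near_points[OF u]
    proof eventually_elim
      case (elim q)
      have "hlift M D s q \<in> T q"
        unfolding hlift_def by (rule hmap(1)[OF elim(2) pi_tangent[OF s elim(2)]])
      from N.tangent_expansion[OF c'(1) elim(1) this] show ?case
        unfolding C_def .
    qed
  qed
qed

section \<open>Tensoriality of the curvature\<close>

lemma hlift_tangent: "s \<in> pi_fields M \<Longrightarrow> u \<in> S \<Longrightarrow> hlift M D s u \<in> T u"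
  by (rule vf_tangent[OF hlift_vf])

lemma hlift_add: "s \<in> pi_fields M \<Longrightarrow> t \<in> pi_fields M \<Longrightarrow> u \<in> S \<Longrightarrow>
    hlift M D (s + t) u = hlift M D s u + hlift M D t u"
  unfolding hlift_def plus_fun_apply[of s t u] by (rule hmap_add[OF _ pi_tangent pi_tangent])

lemma hlift_scale: "s \<in> pi_fields M \<Longrightarrow> u \<in> S \<Longrightarrow>
    hlift M D (\<lambda>w. f w *\<^sub>R s w) u = f u *\<^sub>R hlift M D s u"
  unfolding hlift_def by (rule hmap_scale[OF _ pi_tangent])

lemma hcurvature_eq: "hcurvature M D X Y Z u =
    - D u (hlift M D X u) (cov D (hlift M D Y) Z) + D u (hlift M D Y u) (cov D (hlift M D X) Z)
    + D u (lie_bracket (slit M) (hlift M D X) (hlift M D Y) u) Z"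
  by (simp add: hcurvature_def curvature_def cov_def)

lemma hcurvature_pi:
  assumes "X \<in> pi_fields M" "Y \<in> pi_fields M" "Z \<in> pi_fields M"
  shows "hcurvature M D X Y Z \<in> pi_fields M"
proof -
  have neg: "- s \<in> pi_fields M" if "s \<in> pi_fields M" for s
    using pi_cscale[OF that, of "- 1"] by simp
  show ?thesis
    unfolding hcurvature_def curvature_def
    by (intro pi_add neg cov_pi hlift_vf assms bracket_vf)
qed

lemma smooth_function_apply: "X \<in> vector_fields (slit M) \<Longrightarrow> f \<in> smooth_functions (slit M) \<Longrightarrow>
    (\<lambda>w. X w f) \<in> smooth_functions (slit M)"
  unfolding smooth_functions_def[of "slit M"] using vf_smooth by (auto simp: smooth_functions_def)

lemma hcurvature_add2:
  assumes X: "X \<in> pi_fields M" and Y: "Y \<in> pi_fields M" and Y': "Y' \<in> pi_fields M"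
    and Z: "Z \<in> pi_fields M" and u: "u \<in> S"
  shows "hcurvature M D X (Y + Y') Z u = hcurvature M D X Y Z u + hcurvature M D X Y' Z u"
proof -
  note vX = hlift_vf[OF X] and vY = hlift_vf[OF Y] and vY' = hlift_vf[OF Y']
  have "D u (hlift M D X u) (cov D (hlift M D (Y + Y')) Z)
      = D u (hlift M D X u) (cov D (hlift M D Y) Z + cov D (hlift M D Y') Z)"
  proof (rule D_cong[OF u hlift_tangent[OF X u] cov_pi[OF hlift_vf[OF pi_add[OF Y Y']] Z]
        pi_add[OF cov_pi[OF vY Z] cov_pi[OF vY' Z]]])
    show "cov D (hlift M D (Y + Y')) Z w = (cov D (hlift M D Y) Z + cov D (hlift M D Y') Z) w" if "w \<in> S" for w
      using D_add_dir[OF that Z hlift_tangent[OF Y that] hlift_tangent[OF Y' that]] hlift_add[OF Y Y' that]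
      by (simp add: cov_def)
  qed
  moreover have "lie_bracket (slit M) (hlift M D X) (hlift M D (Y + Y')) u
      = lie_bracket (slit M) (hlift M D X) (hlift M D Y) u + lie_bracket (slit M) (hlift M D X) (hlift M D Y') u"
    unfolding bracket_add[OF vX vY vY' u, symmetric] by (rule bracket_cong[OF vX u hlift_add[OF Y Y']])
  ultimately show ?thesis
    using D_add[OF u hlift_tangent[OF X u] cov_pi[OF vY Z] cov_pi[OF vY' Z]]
      D_add_dir[OF u cov_pi[OF vX Z] hlift_tangent[OF Y u] hlift_tangent[OF Y' u]] hlift_add[OF Y Y' u]
      D_add_dir[OF u Z bracket_tangent[OF vX vY u] bracket_tangent[OF vX vY' u]]
    by (simp add: hcurvature_eq)
qed

text \<open>The derivative of \<open>f\<close> along \<open>X\<close> appears once from differentiating \<open>f D\<^sub>Y Z\<close> and once, with the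
  opposite sign, from the Lie bracket.\<close>
lemma hcurvature_scale2:
  assumes X: "X \<in> pi_fields M" and Y: "Y \<in> pi_fields M" and f: "f \<in> smooth_functions (slit M)"
    and Z: "Z \<in> pi_fields M" and u: "u \<in> S"
  shows "hcurvature M D X (\<lambda>w. f w *\<^sub>R Y w) Z u = f u *\<^sub>R hcurvature M D X Y Z u"
proof -
  note vX = hlift_vf[OF X] and vY = hlift_vf[OF Y]
  let ?Y = "\<lambda>w. f w *\<^sub>R Y w"
  have "D u (hlift M D X u) (cov D (hlift M D ?Y) Z)
      = D u (hlift M D X u) (\<lambda>w. f w *\<^sub>R cov D (hlift M D Y) Z w)"
  proof (rule D_cong[OF u hlift_tangent[OF X u] cov_pi[OF hlift_vf[OF pi_scale[OF f Y]] Z]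
        pi_scale[OF f cov_pi[OF vY Z]]])
    show "cov D (hlift M D ?Y) Z w = f w *\<^sub>R cov D (hlift M D Y) Z w" if "w \<in> S" for w
      using D_scale_dir[OF that Z hlift_tangent[OF Y that]] hlift_scale[OF Y that]
      by (simp add: cov_def)
  qed
  also have "\<dots> = hlift M D X u f *\<^sub>R cov D (hlift M D Y) Z u + f u *\<^sub>R D u (hlift M D X u) (cov D (hlift M D Y) Z)"
    by (rule D_leibniz[OF u hlift_tangent[OF X u] f cov_pi[OF vY Z]])
  finally have 1: "D u (hlift M D X u) (cov D (hlift M D ?Y) Z) = \<dots>" .
  have "lie_bracket (slit M) (hlift M D X) (hlift M D ?Y) u
      = hlift M D X u f *\<^sub>R hlift M D Y u + f u *\<^sub>R lie_bracket (slit M) (hlift M D X) (hlift M D Y) u"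
    unfolding bracket_scale[OF vX vY f u, symmetric] by (rule bracket_cong[OF vX u hlift_scale[OF Y]])
  moreover have "D u \<dots> Z = hlift M D X u f *\<^sub>R cov D (hlift M D Y) Z u
      + f u *\<^sub>R D u (lie_bracket (slit M) (hlift M D X) (hlift M D Y) u) Z"
    using D_add_dir[OF u Z subspace_scale[OF subspace_tangent_space hlift_tangent[OF Y u]]
        subspace_scale[OF subspace_tangent_space bracket_tangent[OF vX vY u]]]
      D_scale_dir[OF u Z hlift_tangent[OF Y u]] D_scale_dir[OF u Z bracket_tangent[OF vX vY u]]
    by (simp add: cov_def)
  ultimately show ?thesis
    using 1 D_scale_dir[OF u cov_pi[OF vX Z] hlift_tangent[OF Y u]] hlift_scale[OF Y u]
    by (simp add: hcurvature_eq algebra_simps)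
qed

lemma hcurvature_add3:
  assumes X: "X \<in> pi_fields M" and Y: "Y \<in> pi_fields M"
    and Z: "Z \<in> pi_fields M" and Z': "Z' \<in> pi_fields M" and u: "u \<in> S"
  shows "hcurvature M D X Y (Z + Z') u = hcurvature M D X Y Z u + hcurvature M D X Y Z' u"
proof -
  have "D u A (cov D B (Z + Z')) = D u A (cov D B Z) + D u A (cov D B Z')"
    if A: "A \<in> T u" and B: "B \<in> vector_fields (slit M)" for A B
  proof -
    have "D u A (cov D B (Z + Z')) = D u A (cov D B Z + cov D B Z')"
    proof (rule D_cong[OF u A cov_pi[OF B pi_add[OF Z Z']] pi_add[OF cov_pi[OF B Z] cov_pi[OF B Z']]])
      show "cov D B (Z + Z') w = (cov D B Z + cov D B Z') w" if "w \<in> S" for w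
        using D_add[OF that vf_tangent[OF B that] Z Z'] by (simp add: cov_def)
    qed
    then show ?thesis
      using D_add[OF u A cov_pi[OF B Z] cov_pi[OF B Z']] by simp
  qed
  from this[OF hlift_tangent[OF X u] hlift_vf[OF Y]] this[OF hlift_tangent[OF Y u] hlift_vf[OF X]]
    D_add[OF u bracket_tangent[OF hlift_vf[OF X] hlift_vf[OF Y] u] Z Z']
  show ?thesis
    by (simp add: hcurvature_eq)
qed

text \<open>The mixed first-order terms are symmetric in \<open>X\<close> and \<open>Y\<close>, and the second derivatives of \<open>f\<close> are
  absorbed by the Lie bracket.\<close>
lemma hcurvature_scale3:
  assumes X: "X \<in> pi_fields M" and Y: "Y \<in> pi_fields M" and f: "f \<in> smooth_functions (slit M)"
    and Z: "Z \<in> pi_fields M" and u: "u \<in> S"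
  shows "hcurvature M D X Y (\<lambda>w. f w *\<^sub>R Z w) u = f u *\<^sub>R hcurvature M D X Y Z u"
proof -
  let ?Z = "\<lambda>w. f w *\<^sub>R Z w"
  have DD: "D u A (cov D B ?Z) = A (\<lambda>w. B w f) *\<^sub>R Z u + B u f *\<^sub>R D u A Z
      + (A f *\<^sub>R cov D B Z u + f u *\<^sub>R D u A (cov D B Z))"
    if A: "A \<in> T u" and B: "B \<in> vector_fields (slit M)" for A B
  proof -
    note Bf = smooth_function_apply[OF B f]
    have "D u A (cov D B ?Z) = D u A ((\<lambda>w. B w f *\<^sub>R Z w) + (\<lambda>w. f w *\<^sub>R cov D B Z w))"
    proof (rule D_cong[OF u A cov_pi[OF B pi_scale[OF f Z]] pi_add[OF pi_scale[OF Bf Z] pi_scale[OF f cov_pi[OF B Z]]]])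
      show "cov D B ?Z w = ((\<lambda>w. B w f *\<^sub>R Z w) + (\<lambda>w. f w *\<^sub>R cov D B Z w)) w" if "w \<in> S" for w
        using D_leibniz[OF that vf_tangent[OF B that] f Z] by (simp add: cov_def)
    qed
    then show ?thesis
      using D_add[OF u A pi_scale[OF Bf Z] pi_scale[OF f cov_pi[OF B Z]]]
        D_leibniz[OF u A Bf Z] D_leibniz[OF u A f cov_pi[OF B Z]] by simp
  qed
  note X' = hlift_tangent[OF X u] hlift_vf[OF X] and Y' = hlift_tangent[OF Y u] hlift_vf[OF Y]
  have br: "lie_bracket (slit M) (hlift M D X) (hlift M D Y) u f
      = hlift M D X u (\<lambda>w. hlift M D Y w f) - hlift M D Y u (\<lambda>w. hlift M D X w f)"
    using vf.smooth_functionD[OF f u] by (simp add: bracket_apply)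
  have "D u (lie_bracket (slit M) (hlift M D X) (hlift M D Y) u) ?Z
      = (hlift M D X u (\<lambda>w. hlift M D Y w f) - hlift M D Y u (\<lambda>w. hlift M D X w f)) *\<^sub>R Z u
        + f u *\<^sub>R D u (lie_bracket (slit M) (hlift M D X) (hlift M D Y) u) Z"
    using D_leibniz[OF u bracket_tangent[OF X'(2) Y'(2) u] f Z] unfolding br .
  then show ?thesis
    using DD[OF X'(1) Y'(2)] DD[OF Y'(1) X'(2)]
    by (simp add: hcurvature_eq cov_def algebra_simps)
qed

end

section \<open>The Ricci tensor\<close>

text \<open>The trace is defined through an unspecified basis. Any finite spanning family with linear
  coordinate functions computes it: expand the images of the basis vectors and exchange the sums.\<close>
lemma subspace_trace_coordinates:
  fixes V :: "'v::real_vector set"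
  assumes V: "subspace V" and I: "finite I"
    and e: "\<And>i. i \<in> I \<Longrightarrow> e i \<in> V"
    and expand: "\<And>v. v \<in> V \<Longrightarrow> v = (\<Sum>i\<in>I. \<xi> i v *\<^sub>R e i)"
    and lin: "\<And>i. i \<in> I \<Longrightarrow> linear (\<xi> i)"
    and g: "\<And>i. i \<in> I \<Longrightarrow> g i \<in> V"
    and f: "\<And>v. v \<in> V \<Longrightarrow> f v = (\<Sum>i\<in>I. \<xi> i v *\<^sub>R g i)"
  shows "subspace_trace V f = (\<Sum>i\<in>I. \<xi> i (g i))"
proof -
  define B where "B = (SOME B. independent B \<and> span B = V)"
  obtain B' where "B' \<subseteq> V" "independent B'" "V \<subseteq> span B'" "card B' = dim V"
    by (rule real_vector.basis_exists)
  then have "\<exists>B. independent B \<and> span B = V"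
    using real_vector.span_subspace[OF _ _ V] by (intro exI[of _ B'] conjI)
  then have "independent B \<and> span B = V"
    unfolding B_def by (rule someI_ex)
  then have B: "independent B" "span B = V" by auto
  have "v \<in> span (e ` I)" if "v \<in> V" for v
    by (subst expand[OF that]) (intro real_vector.span_sum real_vector.span_scale real_vector.span_base imageI)
  then have "B \<subseteq> span (e ` I)"
    using real_vector.span_superset[of B] B(2) by auto
  then have fin: "finite B"
    using real_vector.independent_span_bound[OF finite_imageI[OF I] B(1)] by simp
  have rep: "(\<Sum>b\<in>B. representation B v b *\<^sub>R b) = v" if "v \<in> V" for v
    using real_vector.sum_representation_eq[OF B(1) _ fin] that B(2) by blast
  have "subspace_trace V f = (\<Sum>b\<in>B. representation B (f b) b)"
    unfolding subspace_trace_def B_def[symmetric] Let_def ..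
  also have "\<dots> = (\<Sum>b\<in>B. \<Sum>i\<in>I. \<xi> i b * representation B (g i) b)"
  proof (rule sum.cong[OF refl])
    fix b assume "b \<in> B"
    then have b: "b \<in> V"
      using real_vector.span_base[of b B] B(2) by simp
    have gs: "\<xi> i b *\<^sub>R g i \<in> span B" if "i \<in> I" for i
      using subspace_scale[OF V g[OF that]] B(2) by simp
    have "representation B (\<Sum>i\<in>I. \<xi> i b *\<^sub>R g i) = (\<lambda>b'. \<Sum>i\<in>I. representation B (\<xi> i b *\<^sub>R g i) b')"
      by (rule real_vector.representation_sum[OF B(1) gs])
    then show "representation B (f b) b = (\<Sum>i\<in>I. \<xi> i b * representation B (g i) b)"
      unfolding f[OF b] using g B by (auto simp: real_vector.representation_scale intro!: sum.cong)
  qed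
  also have "\<dots> = (\<Sum>i\<in>I. \<Sum>b\<in>B. \<xi> i b * representation B (g i) b)"
    by (rule sum.swap)
  also have "\<dots> = (\<Sum>i\<in>I. \<xi> i (g i))"
  proof (rule sum.cong[OF refl])
    fix i assume i: "i \<in> I"
    have "\<xi> i (g i) = \<xi> i (\<Sum>b\<in>B. representation B (g i) b *\<^sub>R b)"
      by (simp only: rep[OF g[OF i]])
    also have "\<dots> = (\<Sum>b\<in>B. representation B (g i) b *\<^sub>R \<xi> i b)"
      by (simp only: linear_sum[OF lin[OF i]] linear_cmul[OF lin[OF i]])
    finally show "(\<Sum>b\<in>B. \<xi> i b * representation B (g i) b) = \<xi> i (g i)"
      by (simp add: mult.commute)
  qed
  finally show ?thesis .
qed

context regular_pi_connection
begin

text \<open>Tensoriality in the second argument makes the endomorphism under the trace independent of the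
  chosen extensions, and lets a frame around \<open>u\<close> compute it. The formula holds with the same frame at
  all nearby points, which is what smoothness of the Ricci tensor needs.\<close>
lemma ric_coords:
  assumes X: "X \<in> pi_fields M" and Y: "Y \<in> pi_fields M" and u: "u \<in> S"
    and c: "(U, \<phi>) \<in> M" "fst u \<in> U" and k: "pi.cutoff U \<kappa>" "\<kappa> u \<noteq> 0"
  shows "ric M D X Y u = (\<Sum>b\<in>Basis. hcurvature M D X (pi.frame U \<phi> \<kappa> b) Y u (\<lambda>q. \<phi> q \<bullet> b) * inverse (\<kappa> u))"
proof -
  let ?E = "pi.frame U \<phi> \<kappa>"
  have ext: "hcurvature M D X (SOME Z. Z \<in> pi_fields M \<and> Z u = v) Y u
      = (\<Sum>b\<in>Basis. v (\<lambda>q. \<phi> q \<bullet> b) *\<^sub>R (inverse (\<kappa> u) *\<^sub>R hcurvature M D X (?E b) Y u))"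
    if v: "v \<in> tangent_space M (fst u)" for v
  proof -
    define Z where "Z = (SOME Z. Z \<in> pi_fields M \<and> Z u = v)"
    have "\<exists>Z. Z \<in> pi_fields M \<and> Z u = v"
      using pi_extend[OF u v] by blast
    then have Z: "Z \<in> pi_fields M \<and> Z u = v"
      unfolding Z_def by (rule someI_ex)
    have "hcurvature M D X Z Y u = (\<Sum>b\<in>Basis. (Z u (\<lambda>q. \<phi> q \<bullet> b) / \<kappa> u) *\<^sub>R hcurvature M D X (?E b) Y u)"
    proof (rule pi_expansion[OF _ _ c u k])
      show "hcurvature M D X (s + t) Y u = hcurvature M D X s Y u + hcurvature M D X t Y u"
        if "s \<in> pi_fields M" "t \<in> pi_fields M" for s t
        by (rule hcurvature_add2[OF X that Y u])
      show "hcurvature M D X (\<lambda>q. f q *\<^sub>R s q) Y u = f u *\<^sub>R hcurvature M D X s Y u"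
        if "f \<in> smooth_functions (slit M)" "s \<in> pi_fields M" for f s
        by (rule hcurvature_scale2[OF X that(2,1) Y u])
      show "Z \<in> pi_fields M" using Z by blast
    qed
    then show ?thesis
      using Z unfolding Z_def[symmetric] by (simp only: scaleR_scaleR divide_inverse)
  qed
  have lin: "linear (\<lambda>v :: 'm tangent. v f)" for f
    by (rule linearI) simp_all
  have "ric M D X Y u = (\<Sum>b\<in>Basis. (inverse (\<kappa> u) *\<^sub>R hcurvature M D X (?E b) Y u) (\<lambda>q. \<phi> q \<bullet> b))"
    unfolding ric_def pi_trace_def
    by (rule subspace_trace_coordinates[OF subspace_tangent_space finite_Basis M.coord_vec_tangent[OF c]
        M.tangent_expansion[OF c] lin subspace_scale[OF subspace_tangent_space pi_tangent[OF hcurvature_pi[OF X pi_frame[OF c(1) k(1)] Y] u]] ext])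
  then show ?thesis
    by (simp add: mult.commute)
qed

text \<open>A chart, together with a function that localises to it, around the base point of \<open>u\<close>.\<close>
lemma local_data:
  assumes u: "u \<in> S"
  obtains U \<phi> \<kappa> where "(U, \<phi>) \<in> M" "fst u \<in> U" "pi.cutoff U \<kappa>" "\<kappa> u \<noteq> 0"
proof -
  obtain U \<phi> where c: "(U, \<phi>) \<in> M" "fst u \<in> U"
    using M.points_chart[of "fst u"] u points_slit by blast
  obtain \<kappa> where "\<kappa> (fst u) \<noteq> 0" "pi.cutoff U (\<lambda>u. \<kappa> (fst u))"
    using cutoff_exists[OF c] by blast
  then show ?thesis
    using that[OF c, of "\<lambda>u. \<kappa> (fst u)"] by simp
qed

lemma near_chart_slit:
  assumes "(U, \<phi>) \<in> M" "fst u \<in> U" "u \<in> S"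
  shows "eventually (\<lambda>w. fst w \<in> U) (near (slit M) u)"
  by (rule M.near_slit[OF assms(3) M.eventually_near_chart[OF assms(1,2)]])

lemma cutoff_smooth: "pi.cutoff U \<kappa> \<Longrightarrow> u \<in> S \<Longrightarrow> smooth_at (slit M) u \<kappa>"
  unfolding pi.cutoff_def smooth_functions_def by blast

lemma smooth_at_chart_coordinate:
  assumes "(U, \<phi>) \<in> M" "fst u \<in> U" "s \<in> pi_fields M" "u \<in> S"
  shows "smooth_at (slit M) u (\<lambda>w. s w (\<lambda>q. \<phi> q \<bullet> b))"
  by (rule pi_smooth[OF assms(3,4) M.smooth_at_coordinate[OF assms(1,2)]])

lemma ric_smooth:
  assumes X: "X \<in> pi_fields M" and Y: "Y \<in> pi_fields M"
  shows "ric M D X Y \<in> smooth_functions (slit M)"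
  unfolding smooth_functions_def
proof (intro CollectI ballI)
  fix u assume u: "u \<in> S"
  obtain U \<phi> \<kappa> where c: "(U, \<phi>) \<in> M" "fst u \<in> U" and k: "pi.cutoff U \<kappa>" "\<kappa> u \<noteq> 0"
    by (rule local_data[OF u])
  show "smooth_at (slit M) u (ric M D X Y)"
  proof (rule N.smooth_at_transfer)
    show "smooth_at (slit M) u (\<lambda>u. \<Sum>b\<in>Basis. hcurvature M D X (pi.frame U \<phi> \<kappa> b) Y u (\<lambda>q. \<phi> q \<bullet> b) * inverse (\<kappa> u))"
      by (intro N.smooth_at_sum[OF u] N.smooth_at_mult N.smooth_at_inverse cutoff_smooth[OF k(1) u] k(2)
          smooth_at_chart_coordinate[OF c _ u] hcurvature_pi X Y pi_frame[OF c(1) k(1)])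
    show "eventually (\<lambda>u. (\<Sum>b\<in>Basis. hcurvature M D X (pi.frame U \<phi> \<kappa> b) Y u (\<lambda>q. \<phi> q \<bullet> b) * inverse (\<kappa> u))
        = ric M D X Y u) (near (slit M) u)"
      using near_chart_slit[OF c u] N.eventually_near_points[OF u] N.smooth_at_nonzero[OF cutoff_smooth[OF k(1) u] k(2)]
      by eventually_elim (rule ric_coords[OF X Y _ c(1) _ k(1), symmetric])
  qed
qed

lemma ric_add2:
  assumes X: "X \<in> pi_fields M" and Y: "Y \<in> pi_fields M" "Y' \<in> pi_fields M" and u: "u \<in> S"
  shows "ric M D X (Y + Y') u = ric M D X Y u + ric M D X Y' u"
proof -
  obtain U \<phi> \<kappa> where c: "(U, \<phi>) \<in> M" "fst u \<in> U" and k: "pi.cutoff U \<kappa>" "\<kappa> u \<noteq> 0"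
    by (rule local_data[OF u])
  show ?thesis
    unfolding ric_coords[OF X pi_add[OF Y] u c k] ric_coords[OF X Y(1) u c k] ric_coords[OF X Y(2) u c k]
      hcurvature_add3[OF X pi_frame[OF c(1) k(1)] Y u]
    by (simp add: sum.distrib distrib_right)
qed

lemma ric_scale2:
  assumes X: "X \<in> pi_fields M" and f: "f \<in> smooth_functions (slit M)" and Y: "Y \<in> pi_fields M" and u: "u \<in> S"
  shows "ric M D X (\<lambda>w. f w *\<^sub>R Y w) u = f u * ric M D X Y u"
proof -
  obtain U \<phi> \<kappa> where c: "(U, \<phi>) \<in> M" "fst u \<in> U" and k: "pi.cutoff U \<kappa>" "\<kappa> u \<noteq> 0"
    by (rule local_data[OF u])
  show ?thesis
    unfolding ric_coords[OF X pi_scale[OF f Y] u c k] ric_coords[OF X Y u c k]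
      hcurvature_scale3[OF X pi_frame[OF c(1) k(1)] f Y u]
    by (simp add: sum_distrib_left mult.assoc)
qed

text \<open>By tensoriality the Ricci tensor is determined at \<open>u\<close> by its values on a frame.\<close>
lemma ric_expansion:
  assumes X: "X \<in> pi_fields M" and Y: "Y \<in> pi_fields M" and u: "u \<in> S"
    and c: "(U, \<phi>) \<in> M" "fst u \<in> U" and k: "pi.cutoff U \<kappa>" "\<kappa> u \<noteq> 0"
  shows "ric M D X Y u = (\<Sum>b\<in>Basis. Y u (\<lambda>q. \<phi> q \<bullet> b) * (ric M D X (pi.frame U \<phi> \<kappa> b) u * inverse (\<kappa> u)))"
  using pi_expansion[where T = "\<lambda>Y. ric M D X Y u", OF ric_add2[OF X _ _ u] _ c u k Y] ric_scale2[OF X _ _ u]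
  by (simp add: divide_inverse mult_ac)

lemma hcurvature_nonzero_if_ric_nonzero:
  assumes "ric_nonzero M D"
  shows "hcurvature_nonzero M D"
proof (rule ccontr)
  assume z: "\<not> hcurvature_nonzero M D"
  obtain X Y u where X: "X \<in> pi_fields M" and Y: "Y \<in> pi_fields M" and u: "u \<in> S" and ne: "ric M D X Y u \<noteq> 0"
    using assms unfolding ric_nonzero_def by blast
  obtain U \<phi> \<kappa> where c: "(U, \<phi>) \<in> M" "fst u \<in> U" and k: "pi.cutoff U \<kappa>" "\<kappa> u \<noteq> 0"
    by (rule local_data[OF u])
  have "hcurvature M D X (pi.frame U \<phi> \<kappa> b) Y u = 0" for b
    using z X Y u pi_frame[OF c(1) k(1)] unfolding hcurvature_nonzero_def by blast
  then show False
    using ne unfolding ric_coords[OF X Y u c k] by simp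
qed

end

section \<open>The Finsler metric\<close>

lemma has_derivative_along_line:
  assumes "smooth_around G z"
  shows "((\<lambda>t. G (z + t *\<^sub>R d)) has_real_derivative frechet_derivative G (at z) d) (at 0)"
proof -
  have G: "(G has_derivative frechet_derivative G (at z)) (at (z + 0 *\<^sub>R d))"
    using smooth_around_has_derivative[OF assms] by simp
  have "((\<lambda>t. z + t *\<^sub>R d) has_derivative (\<lambda>t. t *\<^sub>R d)) (at 0)"
    by (auto intro!: derivative_eq_intros)
  from has_derivative_compose[OF this G]
  have "((\<lambda>t. G (z + t *\<^sub>R d)) has_derivative (\<lambda>t. frechet_derivative G (at z) (t *\<^sub>R d))) (at 0)" .
  then show ?thesis
    using linear_cmul[OF linear_frechet_derivative[OF smooth_around_differentiable[OF assms]]]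
    by (simp add: has_field_derivative_def mult.commute[of _ "frechet_derivative G (at z) d"])
qed

context slit_manifold
begin

text \<open>The coefficients \<open>g\<^sub>i\<^sub>j = 1/2 \<partial>\<^sup>2L\<^sup>2/\<partial>y\<^sup>i\<partial>y\<^sup>j\<close> as functions on the induced chart.\<close>
definition metric_coeff ::
  "('m tvec \<Rightarrow> real) \<Rightarrow> 'm set \<Rightarrow> ('m \<Rightarrow> 'e) \<Rightarrow> 'e \<Rightarrow> 'e \<Rightarrow> 'e \<times> 'e \<Rightarrow> real" where
  "metric_coeff L U \<phi> i j z = 1/2 * frechet_derivative (\<lambda>z. frechet_derivative
     (\<lambda>z. (L (inv_into (slit_dom M U) (slit_chart \<phi>) z))\<^sup>2) (at z) (0, j)) (at z) (0, i)"

lemma smooth_energy: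
  assumes L: "L \<in> smooth_functions (slit M)" and c: "(U, \<phi>) \<in> M" and z: "z \<in> slit_chart \<phi> ` slit_dom M U"
  shows "smooth_around (\<lambda>z. (L (inv_into (slit_dom M U) (slit_chart \<phi>) z))\<^sup>2) z"
proof -
  obtain u where u: "u \<in> slit_dom M U" "z = slit_chart \<phi> u"
    using z by blast
  have "smooth_at (slit M) u L"
    using L u(1) N.chart_points[OF slit_mem[OF c]] unfolding smooth_functions_def by blast
  then have "smooth_around (\<lambda>z. L (inv_into (slit_dom M U) (slit_chart \<phi>) z)) z"
    unfolding N.smooth_at_iff[OF slit_mem[OF c] u(1)] u(2) comp_def .
  from smooth_around_mult[OF this this] show ?thesis
    by (simp add: power2_eq_square)
qed

lemma smooth_metric_coeff:
  assumes L: "L \<in> smooth_functions (slit M)" and c: "(U, \<phi>) \<in> M" "fst u \<in> U" and u: "u \<in> S"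
  shows "smooth_at (slit M) u (\<lambda>w. metric_coeff L U \<phi> i j (slit_chart \<phi> w))"
proof (rule N.smooth_at_chart[OF slit_mem[OF c(1)] slit_dom_mem[OF u c(2)]])
  have "slit_chart \<phi> u \<in> slit_chart \<phi> ` slit_dom M U"
    using slit_dom_mem[OF u c(2)] by blast
  then show "smooth_around (metric_coeff L U \<phi> i j) (slit_chart \<phi> u)"
    unfolding metric_coeff_def[abs_def]
    by (intro smooth_around_mult[OF smooth_around_const] smooth_around_frechet_derivative smooth_energy[OF L c(1)])
qed

lemma coords_linear: "coords \<phi> (v + w) = coords \<phi> v + coords \<phi> w" "coords \<phi> (c *\<^sub>R v) = c *\<^sub>R coords \<phi> v"
  by (simp_all add: coords_def scaleR_add_left sum.distrib scaleR_sum_right)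

text \<open>Moving a tangent vector along a line in its tangent space moves its coordinates along a line in
  the fibre direction, as long as the vector stays nonzero. The iterated derivative in the definition
  of the metric is thus a second directional derivative of the energy, hence bilinear with smooth
  coefficients.\<close>
lemma fmetric_coords:
  assumes L: "L \<in> smooth_functions (slit M)" and c: "(U, \<phi>) \<in> M" "fst u \<in> U" and u: "u \<in> S"
    and v: "v \<in> tangent_space M (fst u)" and w: "w \<in> tangent_space M (fst u)"
  shows "fmetric L u v w = (\<Sum>i\<in>Basis. \<Sum>j\<in>Basis. v (\<lambda>q. \<phi> q \<bullet> i) * w (\<lambda>q. \<phi> q \<bullet> j)
    * metric_coeff L U \<phi> i j (slit_chart \<phi> u))"
proof -
  define G where "G = (\<lambda>z. (L (inv_into (slit_dom M U) (slit_chart \<phi>) z))\<^sup>2)"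
  define a where "a = coords \<phi> v"
  define b where "b = coords \<phi> w"
  define k where "k d z = frechet_derivative G (at z) (0, d)" for d z
  let ?z = "slit_chart \<phi> u"
  let ?O = "slit_chart \<phi> ` slit_dom M U"
  have op: "open ?O"
    by (rule N.chart_open[OF slit_mem[OF c(1)]])
  have zO: "?z \<in> ?O"
    using slit_dom_mem[OF u c(2)] by blast
  have G: "smooth_around G z" if "z \<in> ?O" for z
    unfolding G_def by (rule smooth_energy[OF L c(1) that])
  have k: "smooth_around (k d) z" if "z \<in> ?O" for d z
    unfolding k_def[abs_def] by (rule smooth_around_frechet_derivative[OF G[OF that]])
  have near0: "eventually (\<lambda>t. z + t *\<^sub>R d \<in> ?O) (nhds 0)" if "z \<in> ?O" for z d
  proof -
    have "((\<lambda>t::real. z + t *\<^sub>R d) \<longlongrightarrow> z + 0 *\<^sub>R d) (nhds 0)"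
      by (intro tendsto_intros filterlim_ident)
    then show ?thesis
      using topological_tendstoD[OF _ op, of "\<lambda>t. z + t *\<^sub>R d" z] that by simp
  qed
  have energy: "(L (fst u, snd u + s *\<^sub>R v + t *\<^sub>R w))\<^sup>2 = G (?z + s *\<^sub>R (0, a) + t *\<^sub>R (0, b))"
    if "?z + s *\<^sub>R (0, a) + t *\<^sub>R (0, b) \<in> ?O" for s t
  proof -
    let ?v = "snd u + s *\<^sub>R v + t *\<^sub>R w"
    have tv: "?v \<in> tangent_space M (fst u)"
      using u by (intro subspace_add[OF subspace_tangent_space] subspace_scale[OF subspace_tangent_space] v w)
        (simp add: points_slit)
    have z: "slit_chart \<phi> (fst u, ?v) = ?z + s *\<^sub>R (0, a) + t *\<^sub>R (0, b)"
      by (simp add: slit_chart_def case_prod_unfold coords_linear a_def b_def)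
    have "coords \<phi> ?v \<noteq> 0"
      using that unfolding z[symmetric] using M.slit_chart_image[OF c(1), of U]
      by (auto simp: slit_chart_def)
    then have "(fst u, ?v) \<in> slit_dom M U"
      using M.coords_eq_0[OF c tv] tv c(2) by (auto simp: slit_dom_def)
    then show ?thesis
      unfolding G_def z[symmetric] using N.chart_inv[OF slit_mem[OF c(1)]] by simp
  qed
  have inner: "deriv (\<lambda>t. (L (fst u, snd u + s *\<^sub>R v + t *\<^sub>R w))\<^sup>2) 0 = k b (?z + s *\<^sub>R (0, a))"
    if "?z + s *\<^sub>R (0, a) \<in> ?O" for s
  proof -
    have "eventually (\<lambda>t. (L (fst u, snd u + s *\<^sub>R v + t *\<^sub>R w))\<^sup>2 = G (?z + s *\<^sub>R (0, a) + t *\<^sub>R (0, b))) (nhds 0)"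
      using near0[OF that] by eventually_elim (rule energy)
    then have "deriv (\<lambda>t. (L (fst u, snd u + s *\<^sub>R v + t *\<^sub>R w))\<^sup>2) 0 = deriv (\<lambda>t. G (?z + s *\<^sub>R (0, a) + t *\<^sub>R (0, b))) 0"
      by (rule deriv_cong_ev) simp
    also have "\<dots> = k b (?z + s *\<^sub>R (0, a))"
      unfolding k_def by (rule DERIV_imp_deriv[OF has_derivative_along_line[OF G[OF that]]])
    finally show ?thesis .
  qed
  have "eventually (\<lambda>s. deriv (\<lambda>t. (L (fst u, snd u + s *\<^sub>R v + t *\<^sub>R w))\<^sup>2) 0 = k b (?z + s *\<^sub>R (0, a))) (nhds 0)"
    using near0[OF zO] by eventually_elim (rule inner)
  then have "deriv (\<lambda>s. deriv (\<lambda>t. (L (fst u, snd u + s *\<^sub>R v + t *\<^sub>R w))\<^sup>2) 0) 0 = deriv (\<lambda>s. k b (?z + s *\<^sub>R (0, a))) 0"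
    by (rule deriv_cong_ev) simp
  also have "\<dots> = frechet_derivative (k b) (at ?z) (0, a)"
    by (rule DERIV_imp_deriv[OF has_derivative_along_line[OF k[OF zO]]])
  also have "frechet_derivative (k b) (at ?z) = (\<lambda>d. \<Sum>j\<in>Basis. (b \<bullet> j) * frechet_derivative (k j) (at ?z) d)"
  proof -
    have "((\<lambda>z. \<Sum>j\<in>Basis. (b \<bullet> j) * k j z) has_derivative
        (\<lambda>d. \<Sum>j\<in>Basis. (b \<bullet> j) * frechet_derivative (k j) (at ?z) d)) (at ?z)"
      by (intro has_derivative_sum has_derivative_mult_right smooth_around_has_derivative k[OF zO])
    moreover have "(\<Sum>j\<in>Basis. (b \<bullet> j) * k j z) = k b z" if "z \<in> ?O" for z
    proof -
      have l: "linear (frechet_derivative G (at z))"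
        by (rule linear_frechet_derivative[OF smooth_around_differentiable[OF G[OF that]]])
      have "linear (\<lambda>d. k d z)"
        using linear_add[OF l, of "(0, _)" "(0, _)"] linear_cmul[OF l, of _ "(0, _)"]
        unfolding k_def by (intro linearI) simp_all
      from linear_sum_Basis[OF this, of b] show ?thesis
        by (simp only: real_scaleR_def)
    qed
    ultimately have "(k b has_derivative (\<lambda>d. \<Sum>j\<in>Basis. (b \<bullet> j) * frechet_derivative (k j) (at ?z) d)) (at ?z)"
      using has_derivative_transform_within_open[OF _ op zO] by blast
    then show ?thesis
      by (rule frechet_derivative_at[symmetric])
  qed
  also have "(\<Sum>j\<in>Basis. (b \<bullet> j) * frechet_derivative (k j) (at ?z) (0, a))
      = (\<Sum>j\<in>Basis. \<Sum>i\<in>Basis. (b \<bullet> j) * ((a \<bullet> i) * frechet_derivative (k j) (at ?z) (0, i)))"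
  proof (rule sum.cong[OF refl])
    fix j :: 'e assume "j \<in> Basis"
    have l: "linear (frechet_derivative (k j) (at ?z))"
      by (rule linear_frechet_derivative[OF smooth_around_differentiable[OF k[OF zO]]])
    have "linear (\<lambda>d. frechet_derivative (k j) (at ?z) (0, d))"
      using linear_add[OF l, of "(0, _)" "(0, _)"] linear_cmul[OF l, of _ "(0, _)"]
      by (intro linearI) simp_all
    from linear_sum_Basis[OF this, of a]
    show "(b \<bullet> j) * frechet_derivative (k j) (at ?z) (0, a)
        = (\<Sum>i\<in>Basis. (b \<bullet> j) * ((a \<bullet> i) * frechet_derivative (k j) (at ?z) (0, i)))"
      by (simp only: real_scaleR_def sum_distrib_left)
  qed
  also have "\<dots> = (\<Sum>i\<in>Basis. \<Sum>j\<in>Basis. (b \<bullet> j) * ((a \<bullet> i) * frechet_derivative (k j) (at ?z) (0, i)))"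
    by (rule sum.swap)
  finally have "fmetric L u v w = 1/2 * \<dots>"
    unfolding fmetric_def by (simp only:)
  also have "\<dots> = (\<Sum>i\<in>Basis. \<Sum>j\<in>Basis. v (\<lambda>q. \<phi> q \<bullet> i) * w (\<lambda>q. \<phi> q \<bullet> j)
    * metric_coeff L U \<phi> i j (slit_chart \<phi> u))"
    unfolding sum_distrib_left
    by (intro sum.cong refl)
      (simp add: a_def b_def coords_inner metric_coeff_def k_def[abs_def] G_def)
  finally show ?thesis .
qed

lemma metric_smooth:
  assumes L: "L \<in> smooth_functions (slit M)" and X: "X \<in> pi_fields M" and Y: "Y \<in> pi_fields M"
  shows "metric L X Y \<in> smooth_functions (slit M)"
  unfolding smooth_functions_def
proof (intro CollectI ballI)
  fix u assume u: "u \<in> S"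
  obtain U \<phi> where c: "(U, \<phi>) \<in> M" "fst u \<in> U"
    using M.points_chart[of "fst u"] u points_slit by blast
  show "smooth_at (slit M) u (metric L X Y)"
  proof (rule N.smooth_at_transfer)
    show "smooth_at (slit M) u (\<lambda>u. \<Sum>i\<in>Basis. \<Sum>j\<in>Basis. X u (\<lambda>q. \<phi> q \<bullet> i) * Y u (\<lambda>q. \<phi> q \<bullet> j)
        * metric_coeff L U \<phi> i j (slit_chart \<phi> u))"
      by (intro N.smooth_at_sum[OF u] N.smooth_at_mult smooth_metric_coeff[OF L c u]
          pi_smooth[OF X u M.smooth_at_coordinate[OF c]] pi_smooth[OF Y u M.smooth_at_coordinate[OF c]])
    show "eventually (\<lambda>u. (\<Sum>i\<in>Basis. \<Sum>j\<in>Basis. X u (\<lambda>q. \<phi> q \<bullet> i) * Y u (\<lambda>q. \<phi> q \<bullet> j)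
        * metric_coeff L U \<phi> i j (slit_chart \<phi> u)) = metric L X Y u) (near (slit M) u)"
      using M.near_slit[OF u M.eventually_near_chart[OF c]] N.eventually_near_points[OF u]
    proof eventually_elim
      case (elim w)
      show ?case
        unfolding metric_def
        by (rule fmetric_coords[OF L c(1) elim pi_tangent[OF X elim(2)] pi_tangent[OF Y elim(2)], symmetric])
    qed
  qed
qed

lemma fmetric_left:
  assumes L: "L \<in> smooth_functions (slit M)" and u: "u \<in> S"
    and v: "v \<in> tangent_space M (fst u)" "v' \<in> tangent_space M (fst u)" and w: "w \<in> tangent_space M (fst u)"
  shows "fmetric L u (v + r *\<^sub>R v') w = fmetric L u v w + r * fmetric L u v' w"
proof -
  obtain U \<phi> where c: "(U, \<phi>) \<in> M" "fst u \<in> U"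
    using M.points_chart[of "fst u"] u points_slit by blast
  show ?thesis
    unfolding fmetric_coords[OF L c u v(1) w] fmetric_coords[OF L c u v(2) w]
      fmetric_coords[OF L c u subspace_add[OF subspace_tangent_space v(1) subspace_scale[OF subspace_tangent_space v(2)]] w]
    by (simp add: distrib_right sum.distrib sum_distrib_left mult.assoc)
qed

lemma fmetric_right_sum:
  assumes L: "L \<in> smooth_functions (slit M)" and u: "u \<in> S"
    and v: "v \<in> tangent_space M (fst u)" and w: "\<And>i. i \<in> I \<Longrightarrow> w i \<in> tangent_space M (fst u)"
  shows "fmetric L u v (\<Sum>i\<in>I. r i *\<^sub>R w i) = (\<Sum>i\<in>I. r i * fmetric L u v (w i))"
proof -
  obtain U \<phi> where c: "(U, \<phi>) \<in> M" "fst u \<in> U"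
    using M.points_chart[of "fst u"] u points_slit by blast
  have s: "(\<Sum>i\<in>I. r i *\<^sub>R w i) \<in> tangent_space M (fst u)"
    by (intro subspace_sum[OF subspace_tangent_space] subspace_scale[OF subspace_tangent_space] w)
  have "fmetric L u v (\<Sum>i\<in>I. r i *\<^sub>R w i)
      = (\<Sum>k\<in>Basis. \<Sum>j\<in>Basis. \<Sum>i\<in>I. r i * (v (\<lambda>q. \<phi> q \<bullet> k) * w i (\<lambda>q. \<phi> q \<bullet> j) * metric_coeff L U \<phi> k j (slit_chart \<phi> u)))"
    unfolding fmetric_coords[OF L c u v s] sum_fun_apply
    by (simp add: sum_distrib_left sum_distrib_right mult_ac)
  also have "\<dots> = (\<Sum>i\<in>I. \<Sum>k\<in>Basis. \<Sum>j\<in>Basis. r i * (v (\<lambda>q. \<phi> q \<bullet> k) * w i (\<lambda>q. \<phi> q \<bullet> j) * metric_coeff L U \<phi> k j (slit_chart \<phi> u)))"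
    unfolding sum.swap[where B = I] ..
  also have "\<dots> = (\<Sum>i\<in>I. r i * fmetric L u v (w i))"
    by (intro sum.cong refl) (simp only: fmetric_coords[OF L c u v w] sum_distrib_left)
  finally show ?thesis .
qed

end

section \<open>The Ricci operator\<close>

locale cartan_manifold = regular_pi_connection M D
  for M :: "('m, 'e::euclidean_space) atlas" and D :: "'m connection" +
  fixes L :: "'m tvec \<Rightarrow> real"
  assumes finsler: "finsler_manifold M L" and cartan: "cartan_connection M L D"
begin

lemma L_smooth: "L \<in> smooth_functions (slit M)"
  using finsler unfolding finsler_manifold_def by blast

lemma fmetric_pos: "u \<in> S \<Longrightarrow> v \<in> tangent_space M (fst u) \<Longrightarrow> v \<noteq> 0 \<Longrightarrow> fmetric L u v v > 0"
  using finsler unfolding finsler_manifold_def by blast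

text \<open>The vector itself, extended to a field, is a test field.\<close>
lemma fmetric_nondegenerate:
  assumes "u \<in> S" "v \<in> tangent_space M (fst u)" "\<And>Z. Z \<in> pi_fields M \<Longrightarrow> fmetric L u v (Z u) = 0"
  shows "v = 0"
proof -
  obtain Z where "Z \<in> pi_fields M" "Z u = v"
    by (rule pi_extend[OF assms(1,2)])
  then show ?thesis
    using fmetric_pos[OF assms(1,2)] assms(3) by force
qed

lemma fmetric_left_0: "u \<in> S \<Longrightarrow> w \<in> tangent_space M (fst u) \<Longrightarrow> fmetric L u 0 w = 0"
  using fmetric_left[OF L_smooth _ subspace_0[OF subspace_tangent_space] subspace_0[OF subspace_tangent_space], of u w 1]
  by simp

text \<open>Positivity of the metric makes the lowering of indices injective, hence surjective.\<close>
lemma ric_op_exists: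
  assumes X: "X \<in> pi_fields M" and u: "u \<in> S"
  shows "\<exists>v. v \<in> tangent_space M (fst u) \<and> (\<forall>Y\<in>pi_fields M. fmetric L u v (Y u) = ric M D X Y u)"
proof -
  obtain U \<phi> \<kappa> where c: "(U, \<phi>) \<in> M" "fst u \<in> U" and k: "pi.cutoff U \<kappa>" "\<kappa> u \<noteq> 0"
    by (rule local_data[OF u])
  let ?d = "coord_vec M U \<phi> (fst u)"
  note t = M.coord_vec_tangent[OF c] and lin = M.linear_coord_vec[OF c]
  define G where "G y = (\<Sum>j\<in>Basis. fmetric L u (?d y) (?d j) *\<^sub>R j)" for y
  have expand: "fmetric L u v w = (\<Sum>j\<in>Basis. w (\<lambda>q. \<phi> q \<bullet> j) * fmetric L u v (?d j))"
    if "v \<in> tangent_space M (fst u)" "w \<in> tangent_space M (fst u)" for v w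
    using fmetric_right_sum[where I = Basis and r = "\<lambda>j. w (\<lambda>q. \<phi> q \<bullet> j)" and w = ?d, OF L_smooth u that(1) t]
    unfolding M.tangent_expansion[OF c that(2), symmetric] .
  have G_inner: "G y \<bullet> j = fmetric L u (?d y) (?d j)" if "j \<in> Basis" for y j
    using that by (simp add: G_def inner_sum_left_Basis)
  have "linear G"
  proof (rule linearI)
    show "G (x + y) = G x + G y" for x y
      using fmetric_left[OF L_smooth u t t t, of x 1 y]
      by (simp add: G_def linear_add[OF lin] scaleR_add_left sum.distrib)
    show "G (r *\<^sub>R x) = r *\<^sub>R G x" for r x
      using fmetric_left[OF L_smooth u subspace_0[OF subspace_tangent_space] t t, of r x] fmetric_left_0[OF u t]
      by (simp add: G_def linear_cmul[OF lin] scaleR_sum_right)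
  qed
  moreover have "y = 0" if "G y = 0" for y
  proof -
    have "fmetric L u (?d y) (?d j) = 0" if "j \<in> Basis" for j
      using G_inner[OF that, of y] \<open>G y = 0\<close> by simp
    then have "fmetric L u (?d y) (?d y) = 0"
      using expand[OF t t, of y y] by simp
    then have "?d y = 0"
      using fmetric_pos[OF u t, of y] by force
    then have "coords \<phi> (?d y) = 0"
      by (simp add: coords_def)
    then show "y = 0"
      using M.coords_coord_vec[OF c] by simp
  qed
  ultimately have G_surj: "surj G"
    using linear_injective_0[of G] linear_injective_imp_surjective[of G] by simp
  obtain y where y: "(\<Sum>j\<in>Basis. (ric M D X (pi.frame U \<phi> \<kappa> j) u * inverse (\<kappa> u)) *\<^sub>R j) = G y"
    by (rule surjE[OF G_surj])
  have yj: "fmetric L u (?d y) (?d j) = ric M D X (pi.frame U \<phi> \<kappa> j) u * inverse (\<kappa> u)" if "j \<in> Basis" for j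
    unfolding G_inner[OF that, symmetric] y[symmetric] using that by (simp add: inner_sum_left_Basis)
  have "fmetric L u (?d y) (Y u) = ric M D X Y u" if Y: "Y \<in> pi_fields M" for Y
    unfolding expand[OF t pi_tangent[OF Y u]] ric_expansion[OF X Y u c k]
    by (intro sum.cong) (simp_all add: yj)
  then show ?thesis
    using t by blast
qed

lemma ric_op:
  assumes X: "X \<in> pi_fields M" and u: "u \<in> S"
  shows "ric_op M L D X u \<in> tangent_space M (fst u)"
    and "\<And>Y. Y \<in> pi_fields M \<Longrightarrow> fmetric L u (ric_op M L D X u) (Y u) = ric M D X Y u"
proof -
  let ?P = "\<lambda>v. v \<in> tangent_space M (fst u) \<and> (\<forall>Y\<in>pi_fields M. fmetric L u v (Y u) = ric M D X Y u)"
  have unique: "v = v'" if v: "?P v" and v': "?P v'" for v v'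
  proof -
    have "v + (- 1) *\<^sub>R v' = 0"
    proof (rule fmetric_nondegenerate[OF u])
      show "v + (- 1) *\<^sub>R v' \<in> tangent_space M (fst u)"
        using v v' by (intro subspace_add[OF subspace_tangent_space] subspace_scale[OF subspace_tangent_space]) auto
      show "fmetric L u (v + (- 1) *\<^sub>R v') (Z u) = 0" if "Z \<in> pi_fields M" for Z
        using fmetric_left[OF L_smooth u _ _ pi_tangent[OF that u], of v v' "- 1"] v v' that by simp
    qed
    then show ?thesis by simp
  qed
  have "\<exists>!v. ?P v"
    using ric_op_exists[OF X u] unique by blast
  from theI'[OF this]
  show "ric_op M L D X u \<in> tangent_space M (fst u)"
    "\<And>Y. Y \<in> pi_fields M \<Longrightarrow> fmetric L u (ric_op M L D X u) (Y u) = ric M D X Y u"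
    unfolding ric_op_def by auto
qed

text \<open>Around each point the components of the Ricci operator solve the linear system
  \<open>\<Sum>\<^sub>i g\<^sub>i\<^sub>j c\<^sub>i = Ric(X, \<partial>\<^sub>j)\<close>, which is injective because the metric is positive definite.\<close>
lemma ric_op_pi:
  assumes X: "X \<in> pi_fields M"
  shows "ric_op M L D X \<in> pi_fields M"
  unfolding pi_fields_def
proof (rule pi.fieldI)
  fix u assume u: "u \<in> S"
  show "ric_op M L D X u \<in> tangent_space M (fst u)"
    by (rule ric_op(1)[OF X u])
  obtain U \<phi> \<kappa> where c: "(U, \<phi>) \<in> M" "fst u \<in> U" and k: "pi.cutoff U \<kappa>" "\<kappa> u \<noteq> 0"
    by (rule local_data[OF u])
  define h where "h j i w = metric_coeff L U \<phi> i j (slit_chart \<phi> w)" for j i w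
  define C where "C i w = ric_op M L D X w (\<lambda>q. \<phi> q \<bullet> i)" for i w
  have coord: "coord_vec M U \<phi> p i (\<lambda>q. \<phi> q \<bullet> j) = i \<bullet> j" if "p \<in> U" "j \<in> Basis" for p i j
    using M.coords_coord_vec[OF c(1) that(1), of i] coords_inner[OF that(2), of \<phi> "coord_vec M U \<phi> p i"] by simp
  have pair: "fmetric L w v (coord_vec M U \<phi> (fst w) j) = (\<Sum>i\<in>Basis. h j i w * v (\<lambda>q. \<phi> q \<bullet> i))"
    if w: "w \<in> S" "fst w \<in> U" and v: "v \<in> tangent_space M (fst w)" and j: "j \<in> Basis" for w v j
    unfolding fmetric_coords[OF L_smooth c(1) w(2,1) v M.coord_vec_tangent[OF c(1) w(2)]] h_def
    using j by (intro sum.cong refl) (simp add: coord[OF w(2)] inner_Basis if_distrib if_distribR sum.delta mult.commute cong: if_cong)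
  have C: "\<forall>i\<in>Basis. smooth_at (slit M) u (C i)"
  proof (rule N.smooth_at_linear_system[OF u finite_Basis, of Basis h])
    show "smooth_at (slit M) u (h j i)" for j i
      unfolding h_def[abs_def] by (rule smooth_metric_coeff[OF L_smooth c u])
    show "smooth_at (slit M) u (\<lambda>w. ric M D X (pi.frame U \<phi> \<kappa> j) w * inverse (\<kappa> w))" for j
      by (intro N.smooth_at_mult N.smooth_at_inverse cutoff_smooth[OF k(1) u] k(2)
          vf.smooth_functionD[OF ric_smooth[OF X pi_frame[OF c(1) k(1)]] u])
    show "eventually (\<lambda>w. (\<Sum>i\<in>Basis. h j i w * C i w)
        = ric M D X (pi.frame U \<phi> \<kappa> j) w * inverse (\<kappa> w)) (near (slit M) u)" if j: "j \<in> Basis" for j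
      using near_chart_slit[OF c u] N.eventually_near_points[OF u] N.smooth_at_nonzero[OF cutoff_smooth[OF k(1) u] k(2)]
    proof eventually_elim
      case (elim w)
      note r = ric_op[OF X elim(2)]
      have "ric M D X (pi.frame U \<phi> \<kappa> j) w = fmetric L w (ric_op M L D X w) (\<Sum>i\<in>{j}. \<kappa> w *\<^sub>R coord_vec M U \<phi> (fst w) i)"
        using r(2)[OF pi_frame[OF c(1) k(1)], of j] elim(1) by (simp add: pi.frame_def)
      also have "\<dots> = \<kappa> w * (\<Sum>i\<in>Basis. h j i w * C i w)"
        unfolding fmetric_right_sum[OF L_smooth elim(2) r(1) M.coord_vec_tangent[OF c(1) elim(1)]] C_def
        using pair[OF elim(2,1) r(1) j] by simp
      finally show ?case
        using elim(3) by (simp add: field_simps)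
    qed
    fix d assume d: "\<And>j. j \<in> Basis \<Longrightarrow> (\<Sum>i\<in>Basis. h j i u * d i) = 0"
    define v where "v = coord_vec M U \<phi> (fst u) (\<Sum>i\<in>Basis. d i *\<^sub>R i)"
    have tv: "v \<in> tangent_space M (fst u)"
      unfolding v_def by (rule M.coord_vec_tangent[OF c])
    have vi: "v (\<lambda>q. \<phi> q \<bullet> i) = d i" if "i \<in> Basis" for i
      unfolding v_def using that by (simp add: coord[OF c(2)] inner_sum_left_Basis)
    have "fmetric L u v (coord_vec M U \<phi> (fst u) j) = 0" if "j \<in> Basis" for j
      using pair[OF u c(2) tv that] d[OF that] vi by simp
    then have "fmetric L u v v = 0"
      using fmetric_right_sum[where I = Basis and r = "\<lambda>j. v (\<lambda>q. \<phi> q \<bullet> j)" and w = "coord_vec M U \<phi> (fst u)", OF L_smooth u tv M.coord_vec_tangent[OF c]]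
      unfolding M.tangent_expansion[OF c tv, symmetric] by simp
    then have "v = 0"
      using fmetric_pos[OF u tv] by force
    then show "\<forall>i\<in>Basis. d i = 0"
      using vi by simp
  qed
  fix f assume f: "smooth_at M (fst u) f"
  show "smooth_at (slit M) u (\<lambda>q. ric_op M L D X q f)"
  proof (rule pi.smooth_local_combination[OF c u bspec[OF C] _ f])
    show "eventually (\<lambda>q. ric_op M L D X q = (\<Sum>b\<in>Basis. C b q *\<^sub>R coord_vec M U \<phi> (fst q) b)) (near (slit M) u)"
      using near_chart_slit[OF c u] N.eventually_near_points[OF u]
    proof eventually_elim
      case (elim q)
      from M.tangent_expansion[OF c(1) elim(1) ric_op(1)[OF X elim(2)]] show ?case
        unfolding C_def .
    qed
  qed
qed

section \<open>Recurrent tensors\<close>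

text \<open>The condition \<open>\<nabla>\<^sub>V B = a B\<close> at a point is linear in \<open>B\<close>. Hence it suffices to check it
  for the building blocks of the curvature.\<close>
definition eigentensor ::
  "('m tvec \<Rightarrow> 'm tvec tangent) \<Rightarrow> real \<Rightarrow> 'm tvec \<Rightarrow>
    ('m pi_section \<Rightarrow> 'm pi_section \<Rightarrow> 'm pi_section \<Rightarrow> 'm pi_section) \<Rightarrow> bool" where
  "eigentensor V a u B \<longleftrightarrow> (\<forall>X\<in>pi_fields M. \<forall>Y\<in>pi_fields M. \<forall>Z\<in>pi_fields M.
     B X Y Z \<in> pi_fields M \<and> cov_vector3 D V B X Y Z u = a *\<^sub>R B X Y Z u)"

lemma cov_vector3_apply: "cov_vector3 D V B X Y Z u = D u (V u) (B X Y Z)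
    - B (cov D V X) Y Z u - B X (cov D V Y) Z u - B X Y (cov D V Z) u"
  by (simp add: cov_vector3_def cov_def)

lemma eigentensor_add_scale:
  assumes V: "V \<in> vector_fields (slit M)" and u: "u \<in> S"
    and B: "eigentensor V a u B" and C: "eigentensor V a u C"
  shows "eigentensor V a u (\<lambda>X Y Z. B X Y Z + r *\<^sub>R C X Y Z)"
  unfolding eigentensor_def
proof (intro ballI conjI)
  fix X Y Z assume XYZ: "X \<in> pi_fields M" "Y \<in> pi_fields M" "Z \<in> pi_fields M"
  have b: "B X Y Z \<in> pi_fields M" "cov_vector3 D V B X Y Z u = a *\<^sub>R B X Y Z u"
    using B XYZ unfolding eigentensor_def by blast+
  have c: "C X Y Z \<in> pi_fields M" "cov_vector3 D V C X Y Z u = a *\<^sub>R C X Y Z u"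
    using C XYZ unfolding eigentensor_def by blast+
  show "B X Y Z + r *\<^sub>R C X Y Z \<in> pi_fields M"
    by (intro pi_add pi_cscale b(1) c(1))
  have "D u (V u) (B X Y Z + r *\<^sub>R C X Y Z) = D u (V u) (B X Y Z) + r *\<^sub>R D u (V u) (C X Y Z)"
    using D_add[OF u vf_tangent[OF V u] b(1) pi_cscale[OF c(1)]] D_cscale[OF u vf_tangent[OF V u] c(1)] by simp
  then have "cov_vector3 D V (\<lambda>X Y Z. B X Y Z + r *\<^sub>R C X Y Z) X Y Z u
      = cov_vector3 D V B X Y Z u + r *\<^sub>R cov_vector3 D V C X Y Z u"
    by (simp add: cov_vector3_apply scaleR_fun_def[of r "C _ _ _"] algebra_simps)
  then show "cov_vector3 D V (\<lambda>X Y Z. B X Y Z + r *\<^sub>R C X Y Z) X Y Z u = a *\<^sub>R (B X Y Z + r *\<^sub>R C X Y Z) u"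
    by (simp add: b(2) c(2) scaleR_fun_def[of r "C _ _ _"] algebra_simps)
qed

lemma eigentensor_swap:
  assumes "eigentensor V a u B"
  shows "eigentensor V a u (\<lambda>X Y Z. B Y X Z)"
proof -
  have "cov_vector3 D V (\<lambda>X Y Z. B Y X Z) X Y Z u = cov_vector3 D V B Y X Z u" for X Y Z
    by (simp add: cov_vector3_apply)
  then show ?thesis
    using assms unfolding eigentensor_def by simp
qed

text \<open>In the Leibniz rule the terms that differentiate \<open>Y\<close> cancel, and the derivative of the
  Ricci tensor remains.\<close>
lemma ricci_block_eigentensor:
  assumes V: "V \<in> vector_fields (slit M)" and u: "u \<in> S"
    and ric: "\<And>X Y. X \<in> pi_fields M \<Longrightarrow> Y \<in> pi_fields M \<Longrightarrow> cov_scalar2 D V (ric M D) X Y u = a * ric M D X Y u"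
  shows "eigentensor V a u (\<lambda>X Y Z w. ric M D X Z w *\<^sub>R Y w)"
  unfolding eigentensor_def
proof (intro ballI conjI)
  fix X Y Z assume X: "X \<in> pi_fields M" and Y: "Y \<in> pi_fields M" and Z: "Z \<in> pi_fields M"
  show "(\<lambda>w. ric M D X Z w *\<^sub>R Y w) \<in> pi_fields M"
    by (rule pi_scale[OF ric_smooth[OF X Z] Y])
  have "cov_vector3 D V (\<lambda>X Y Z w. ric M D X Z w *\<^sub>R Y w) X Y Z u = cov_scalar2 D V (ric M D) X Z u *\<^sub>R Y u"
    unfolding cov_vector3_apply D_leibniz[OF u vf_tangent[OF V u] ric_smooth[OF X Z] Y]
    by (simp add: cov_scalar2_def cov_def algebra_simps)
  then show "cov_vector3 D V (\<lambda>X Y Z w. ric M D X Z w *\<^sub>R Y w) X Y Z u = a *\<^sub>R ric M D X Z u *\<^sub>R Y u"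
    using ric[OF X Z] by simp
qed

text \<open>As the connection is metric, lowering an index commutes with \<open>\<nabla>\<^sub>V\<close>, and so the Ricci operator
  inherits the equation satisfied by the Ricci tensor.\<close>
lemma ric_op_recurrent:
  assumes V: "V \<in> vector_fields (slit M)" and u: "u \<in> S"
    and ric: "\<And>X Y. X \<in> pi_fields M \<Longrightarrow> Y \<in> pi_fields M \<Longrightarrow> cov_scalar2 D V (ric M D) X Y u = a * ric M D X Y u"
    and Y: "Y \<in> pi_fields M"
  shows "D u (V u) (ric_op M L D Y) - ric_op M L D (cov D V Y) u = a *\<^sub>R ric_op M L D Y u"
proof -
  note Vu = vf_tangent[OF V u] and VY = cov_pi[OF V Y]
  let ?d = "cov D V (ric_op M L D Y) u"
  have t: "?d \<in> tangent_space M (fst u)" "ric_op M L D (cov D V Y) u \<in> tangent_space M (fst u)"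
    "ric_op M L D Y u \<in> tangent_space M (fst u)"
    using pi_tangent[OF cov_pi[OF V ric_op_pi[OF Y]] u] ric_op(1)[OF VY u] ric_op(1)[OF Y u] by auto
  have t2: "?d + (- 1) *\<^sub>R ric_op M L D (cov D V Y) u \<in> tangent_space M (fst u)"
    by (intro subspace_add[OF subspace_tangent_space] subspace_scale[OF subspace_tangent_space] t)
  have "?d + (- 1) *\<^sub>R ric_op M L D (cov D V Y) u + (- a) *\<^sub>R ric_op M L D Y u = 0"
  proof (rule fmetric_nondegenerate[OF u])
    show "?d + (- 1) *\<^sub>R ric_op M L D (cov D V Y) u + (- a) *\<^sub>R ric_op M L D Y u \<in> tangent_space M (fst u)"
      by (intro subspace_add[OF subspace_tangent_space] subspace_scale[OF subspace_tangent_space] t t2)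
    fix Z assume Z: "Z \<in> pi_fields M"
    note Zt = pi_tangent[OF Z u]
    have "cov_scalar2 D V (metric L) (ric_op M L D Y) Z u = 0"
      using cartan V ric_op_pi[OF Y] Z u unfolding cartan_connection_def by blast
    then have "V u (metric L (ric_op M L D Y) Z) = fmetric L u ?d (Z u) + fmetric L u (ric_op M L D Y u) (cov D V Z u)"
      by (simp add: cov_scalar2_def metric_def)
    moreover have "V u (metric L (ric_op M L D Y) Z) = V u (ric M D Y Z)"
    proof (rule N.tangent_local[OF Vu u])
      show "eventually (\<lambda>w. metric L (ric_op M L D Y) Z w = ric M D Y Z w) (near (slit M) u)"
        using N.eventually_near_points[OF u]
        by eventually_elim (simp add: metric_def ric_op(2)[OF Y _ Z])
    qed
    moreover have "V u (ric M D Y Z) - ric M D (cov D V Y) Z u - ric M D Y (cov D V Z) u = a * ric M D Y Z u"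
      using ric[OF Y Z] by (simp add: cov_scalar2_def)
    ultimately show "fmetric L u (?d + (- 1) *\<^sub>R ric_op M L D (cov D V Y) u + (- a) *\<^sub>R ric_op M L D Y u) (Z u) = 0"
      unfolding fmetric_left[OF L_smooth u t2 t(3) Zt] fmetric_left[OF L_smooth u t(1,2) Zt]
      using ric_op(2)[OF Y u Z] ric_op(2)[OF VY u Z] ric_op(2)[OF Y u cov_pi[OF V Z]] by simp
  qed
  then show ?thesis
    by (simp add: cov_def algebra_simps)
qed

text \<open>The metric is parallel, so only the derivative of the Ricci operator remains.\<close>
lemma metric_block_eigentensor:
  assumes V: "V \<in> vector_fields (slit M)" and u: "u \<in> S"
    and ric: "\<And>X Y. X \<in> pi_fields M \<Longrightarrow> Y \<in> pi_fields M \<Longrightarrow> cov_scalar2 D V (ric M D) X Y u = a * ric M D X Y u"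
  shows "eigentensor V a u (\<lambda>X Y Z w. metric L X Z w *\<^sub>R ric_op M L D Y w)"
  unfolding eigentensor_def
proof (intro ballI conjI)
  fix X Y Z assume X: "X \<in> pi_fields M" and Y: "Y \<in> pi_fields M" and Z: "Z \<in> pi_fields M"
  note g = metric_smooth[OF L_smooth X Z]
  show "(\<lambda>w. metric L X Z w *\<^sub>R ric_op M L D Y w) \<in> pi_fields M"
    by (rule pi_scale[OF g ric_op_pi[OF Y]])
  have "cov_vector3 D V (\<lambda>X Y Z w. metric L X Z w *\<^sub>R ric_op M L D Y w) X Y Z u
      = cov_scalar2 D V (metric L) X Z u *\<^sub>R ric_op M L D Y u
        + metric L X Z u *\<^sub>R (D u (V u) (ric_op M L D Y) - ric_op M L D (cov D V Y) u)"
    unfolding cov_vector3_apply D_leibniz[OF u vf_tangent[OF V u] g ric_op_pi[OF Y]]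
    by (simp add: cov_scalar2_def algebra_simps)
  moreover have "cov_scalar2 D V (metric L) X Z u = 0"
    using cartan V X Z u unfolding cartan_connection_def by blast
  ultimately show "cov_vector3 D V (\<lambda>X Y Z w. metric L X Z w *\<^sub>R ric_op M L D Y w) X Y Z u
      = a *\<^sub>R metric L X Z u *\<^sub>R ric_op M L D Y u"
    using ric_op_recurrent[OF V u ric Y] by (simp add: mult.commute)
qed

lemma recurrent_with_if_m_projectively_recurrent:
  assumes ric: "ricci_recurrent_with M D \<alpha>" and mp: "m_projectively_recurrent_with M L D \<alpha>"
  shows "recurrent_with M D \<alpha>"
  unfolding recurrent_with_def
proof (intro conjI ballI)
  show "nonzero_pi_form M \<alpha>"
    using ric unfolding ricci_recurrent_with_def by blast
  show "hcurvature_nonzero M D"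
    using ric unfolding ricci_recurrent_with_def by (intro hcurvature_nonzero_if_ric_nonzero) blast
  fix W X Y Z u assume W: "W \<in> pi_fields M" and X: "X \<in> pi_fields M" and Y: "Y \<in> pi_fields M"
    and Z: "Z \<in> pi_fields M" and u: "u \<in> S"
  let ?V = "hlift M D W" and ?a = "\<alpha> W u"
  note V = hlift_vf[OF W]
  define k where "k = 1 / (2 * (real DIM('e) - 1))"
  define P :: "'m pi_section \<Rightarrow> 'm pi_section \<Rightarrow> 'm pi_section \<Rightarrow> 'm pi_section"
    where "P = (\<lambda>X Y Z w. ric M D X Z w *\<^sub>R Y w)"
  define Q :: "'m pi_section \<Rightarrow> 'm pi_section \<Rightarrow> 'm pi_section \<Rightarrow> 'm pi_section"
    where "Q = (\<lambda>X Y Z w. metric L X Z w *\<^sub>R ric_op M L D Y w)"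
  have r: "cov_scalar2 D ?V (ric M D) X Y u = ?a * ric M D X Y u" if "X \<in> pi_fields M" "Y \<in> pi_fields M" for X Y
    using ric that W u unfolding ricci_recurrent_with_def by blast
  have P: "eigentensor ?V ?a u P" and Q: "eigentensor ?V ?a u Q"
    unfolding P_def Q_def by (rule ricci_block_eigentensor[OF V u r] metric_block_eigentensor[OF V u r]; assumption)+
  have m: "m_projective M L D X Y Z = hcurvature M D X Y Z
      + (- k) *\<^sub>R P X Y Z + k *\<^sub>R P Y X Z + (- k) *\<^sub>R Q X Y Z + k *\<^sub>R Q Y X Z" for X Y Z
    unfolding m_projective_def k_def[symmetric]
    by (rule ext)
      (simp add: P_def Q_def scaleR_fun_def[where f = "\<lambda>w. _ w *\<^sub>R _ w"]
        scaleR_add_right scaleR_diff_right)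
  have "eigentensor ?V ?a u (m_projective M L D)"
    unfolding eigentensor_def
  proof (intro ballI conjI)
    fix X Y Z assume XYZ: "X \<in> pi_fields M" "Y \<in> pi_fields M" "Z \<in> pi_fields M"
    then have "P X Y Z \<in> pi_fields M" "P Y X Z \<in> pi_fields M" "Q X Y Z \<in> pi_fields M" "Q Y X Z \<in> pi_fields M"
      using P Q unfolding eigentensor_def by blast+
    then show "m_projective M L D X Y Z \<in> pi_fields M"
      unfolding m by (intro pi_add pi_cscale hcurvature_pi XYZ)
    show "cov_vector3 D ?V (m_projective M L D) X Y Z u = ?a *\<^sub>R m_projective M L D X Y Z u"
      using mp W XYZ u unfolding m_projectively_recurrent_with_def by blast
  qed
  moreover have "eigentensor ?V ?a u (\<lambda>X Y Z. P Y X Z)" "eigentensor ?V ?a u (\<lambda>X Y Z. Q Y X Z)"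
    by (rule eigentensor_swap[OF P], rule eigentensor_swap[OF Q])
  ultimately have "eigentensor ?V ?a u (\<lambda>X Y Z. m_projective M L D X Y Z + k *\<^sub>R P X Y Z + (- k) *\<^sub>R P Y X Z
      + k *\<^sub>R Q X Y Z + (- k) *\<^sub>R Q Y X Z)"
    by (intro eigentensor_add_scale[OF V u] P Q)
  also have "(\<lambda>X Y Z. m_projective M L D X Y Z + k *\<^sub>R P X Y Z + (- k) *\<^sub>R P Y X Z
      + k *\<^sub>R Q X Y Z + (- k) *\<^sub>R Q Y X Z) = hcurvature M D"
    unfolding m by (intro ext) (simp add: scaleR_minus_left)
  finally show "cov_vector3 D ?V (hcurvature M D) X Y Z u = ?a *\<^sub>R hcurvature M D X Y Z u"
    using X Y Z unfolding eigentensor_def by blast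
qed

end

theorem theorem3p4:
  fixes M :: "('m, 'e::euclidean_space) atlas"
    and L :: "'m tvec \<Rightarrow> real"
    and D :: "'m connection"
    and \<alpha> :: "'m pi_section \<Rightarrow> 'm tvec \<Rightarrow> real"
  assumes "finsler_manifold M L"
    and "DIM('e) \<ge> 3"
    and "cartan_connection M L D"
    and "ric_nonzero M D"
    and "ricci_recurrent_with M D \<alpha>"
    and "m_projectively_recurrent_with M L D \<alpha>"
  shows "recurrent M D"
proof -
  interpret cartan_manifold M D L
    by unfold_locales (use assms in \<open>auto simp: finsler_manifold_def cartan_connection_def\<close>)
  show ?thesis
    unfolding recurrent_def using recurrent_with_if_m_projectively_recurrent[OF assms(5,6)] by blast
qed

end
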